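(* Let $\rho\in(0,1)$ and let $Q(\zeta)=|\zeta|^2$ if $|\zeta|\le\sqrt2\rho$ and $Q(\zeta)=+\infty$ otherwise. Let $\sigma\in\{+1,-1\}$ and $p=\sigma\sqrt2\rho$. Let $\boldsymbol\zeta=\{\zeta_j\}_{j=1}^N$ be the planar symplectic ensemble with potential $Q$, and let $R_{N,k}$ be the $k$-point correlation function of the rescaled process $z_j=\sigma\gamma_N^{-1}(\zeta_j-p)$, where $\gamma_N=\frac{\sqrt2\rho}{N(1-\rho^2)}$. Then for every $k\ge1$, as $N\to\infty$, $R_{N,k}$ converges locally uniformly on $\mathbb{H}_-^k$, where $\mathbb{H}_-=\{z\in\mathbb{C}:\operatorname{Re}z<0\}$, to $$R_k(z_1,\dots,z_k)=\prod_{j=1}^k(\bar z_j-z_j)\,\mathrm{Pf}\Bigl[\begin{pmatrix}\kappa(z_j,z_l)&\kappa(z_j,\bar z_l)\\ \kappa(\bar z_j,z_l)&\kappa(\bar z_j,\bar z_l)\end{pmatrix}\Bigr]_{j,l=1}^k,$$ where $$\kappa(z,w)=\int_0^1W(f_w,f_z)(u)\,du,\qquad f_z(u)=\int_0^ut^{1/2}e^{2zt}\,dt.$$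
   Context: Planar symplectic ensemble with potential $Q$ (satisfying $Q(\zeta)=Q(\bar\zeta)$): the random configuration $\boldsymbol\zeta=(\zeta_1,\dots,\zeta_N)\in\mathbb{C}^N$ with law $$d\mathbf{P}_N(\boldsymbol\zeta)=\frac1{Z_N}\prod_{j>k=1}^N|\zeta_j-\zeta_k|^2|\zeta_j-\bar\zeta_k|^2\prod_{j=1}^N|\zeta_j-\bar\zeta_j|^2e^{-NQ(\zeta_j)}\,dA(\zeta_j),\qquad dA(\zeta)=\tfrac1\pi d^2\zeta,$$ where $Z_N$ is the normalising constant, $d^2\zeta$ is Lebesgue measure on $\mathbb{C}$ and $e^{-\infty}=0$. Writing $\mathbf{P}_N(\zeta_1,\dots,\zeta_N)$ for the density of this law with respect to $\prod_j dA(\zeta_j)$, the $k$-point correlation function is $$\mathbf{R}_{N,k}(\zeta_1,\dots,\zeta_k)=\frac{N!}{(N-k)!}\int_{\mathbb{C}^{N-k}}\mathbf{P}_N(\zeta_1,\dots,\zeta_N)\prod_{j=k+1}^N dA(\zeta_j).$$ For the rescaled process, $R_{N,k}(z_1,\dots,z_k)=\gamma_N^{2k}\mathbf{R}_{N,k}(\zeta_1,\dots,\zeta_k)$ with $\zeta_j=p+\sigma\gamma_Nz_j$. The factor $\sigma=e^{i\theta}$ is the outward normal direction at $p$ of the disk of radius $\sqrt2\rho$. $W(f,g)=fg'-gf'$ is the Wronskian (derivatives in $u$). For a skew-symmetric $2n\times2n$ matrix $A=(a_{j,k})$, $\mathrm{Pf}(A)=\frac{1}{2^nn!}\sum_{\pi\in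 S_{2n}}\mathrm{sgn}(\pi)\prod_{j=1}^na_{\pi(2j-1),\pi(2j)}$, with $S_{2n}$ the symmetric group on $2n$ letters; it is applied to the $2k\times2k$ matrix made of the indicated $2\times2$ blocks. *)

theory Defs
  imports "HOL-Analysis.Analysis"
begin

section \<open>The planar symplectic ensemble\<close>

definition dA :: "complex measure" where
  "dA = density lborel (\<lambda>_. ennreal (1 / pi))"

text \<open>\<open>exp (- N * q)\<close> for an extended real \<open>q > -\<infinity>\<close>, with \<open>exp (-\<infinity>) = 0\<close>.\<close>

definition boltzmann :: "nat \<Rightarrow> ereal \<Rightarrow> real" where
  "boltzmann N q = (if q = \<infinity> then 0 else exp (- (real N * real_of_ereal q)))"

text \<open>A configuration of \<open>N\<close> particles is a function \<open>nat \<Rightarrow> complex\<close> on the index set \<open>{1..N}\<close>.\<close>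

definition symplectic_weight :: "(complex \<Rightarrow> ereal) \<Rightarrow> nat \<Rightarrow> (nat \<Rightarrow> complex) \<Rightarrow> real" where
  "symplectic_weight Q N \<zeta> =
     (\<Prod>j\<in>{1..N}. \<Prod>k\<in>{1..<j}. (cmod (\<zeta> j - \<zeta> k))\<^sup>2 * (cmod (\<zeta> j - cnj (\<zeta> k)))\<^sup>2) *
     (\<Prod>j\<in>{1..N}. (cmod (\<zeta> j - cnj (\<zeta> j)))\<^sup>2 * boltzmann N (Q (\<zeta> j)))"

definition partition_function :: "(complex \<Rightarrow> ereal) \<Rightarrow> nat \<Rightarrow> real" where
  "partition_function Q N = (\<integral>\<zeta>. symplectic_weight Q N \<zeta> \<partial>(Pi\<^sub>M {1..N} (\<lambda>_. dA)))"

definition symplectic_density :: "(complex \<Rightarrow> ereal) \<Rightarrow> nat \<Rightarrow> (nat \<Rightarrow> complex) \<Rightarrow> real" where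
  "symplectic_density Q N \<zeta> = symplectic_weight Q N \<zeta> / partition_function Q N"

text \<open>
  The \<open>k\<close>-point correlation function, meaningful for \<open>k \<le> N\<close>; \<open>merge\<close> joins the arguments
  \<open>\<zeta> 1, \<dots>, \<zeta> k\<close> with the integration variables \<open>\<eta> (k + 1), \<dots>, \<eta> N\<close>.
\<close>

definition correlation :: "(complex \<Rightarrow> ereal) \<Rightarrow> nat \<Rightarrow> nat \<Rightarrow> (nat \<Rightarrow> complex) \<Rightarrow> real" where
  "correlation Q N k \<zeta> = fact N / fact (N - k) *
     (\<integral>\<eta>. symplectic_density Q N (merge {1..k} {k+1..N} (\<zeta>, \<eta>)) \<partial>(Pi\<^sub>M {k+1..N} (\<lambda>_. dA)))"

text \<open>The process is rescaled by \<open>\<zeta> j = p + \<sigma> * \<gamma> * z j\<close>, where \<open>cmod \<sigma> = 1\<close> and \<open>\<gamma> > 0\<close>.\<close>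

definition rescaled_correlation ::
  "(complex \<Rightarrow> ereal) \<Rightarrow> nat \<Rightarrow> nat \<Rightarrow> complex \<Rightarrow> complex \<Rightarrow> real \<Rightarrow> (nat \<Rightarrow> complex) \<Rightarrow> real" where
  "rescaled_correlation Q N k p \<sigma> \<gamma> z =
     \<gamma> ^ (2 * k) * correlation Q N k (\<lambda>j\<in>{1..k}. p + \<sigma> * complex_of_real \<gamma> * z j)"

section \<open>Pfaffians\<close>

text \<open>The Pfaffian of a skew-symmetric \<open>2n \<times> 2n\<close> matrix with rows and columns indexed by \<open>{1..2n}\<close>.\<close>

definition pfaffian :: "nat \<Rightarrow> (nat \<Rightarrow> nat \<Rightarrow> complex) \<Rightarrow> complex" where
  "pfaffian n A = 1 / (2 ^ n * fact n) *
     (\<Sum>\<pi> | \<pi> permutes {1..2*n}. of_int (sign \<pi>) * (\<Prod>j\<in>{1..n}. A (\<pi> (2*j-1)) (\<pi> (2*j))))"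

text \<open>
  The matrix made of the \<open>2 \<times> 2\<close> blocks \<open>B j l\<close> with \<open>j, l \<ge> 1\<close>: block row \<open>j\<close> consists of the
  rows \<open>2j - 1\<close> and \<open>2j\<close>, and likewise for columns.
\<close>

definition block_matrix :: "(nat \<Rightarrow> nat \<Rightarrow> complex^2^2) \<Rightarrow> nat \<Rightarrow> nat \<Rightarrow> complex" where
  "block_matrix B m n =
     B ((m + 1) div 2) ((n + 1) div 2) $ (if odd m then 1 else 2) $ (if odd n then 1 else 2)"

section \<open>The limiting kernel\<close>

definition wronskian :: "(real \<Rightarrow> complex) \<Rightarrow> (real \<Rightarrow> complex) \<Rightarrow> real \<Rightarrow> complex" where
  "wronskian f g u = f u * vector_derivative g (at u) - g u * vector_derivative f (at u)"

definition edge_fun :: "complex \<Rightarrow> real \<Rightarrow> complex" where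
  "edge_fun z u = integral {0..u} (\<lambda>t. complex_of_real (sqrt t) * exp (2 * z * complex_of_real t))"

definition edge_kernel :: "complex \<Rightarrow> complex \<Rightarrow> complex" where
  "edge_kernel z w = integral {0..1} (wronskian (edge_fun w) (edge_fun z))"

definition limit_correlation :: "nat \<Rightarrow> (nat \<Rightarrow> complex) \<Rightarrow> complex" where
  "limit_correlation k z =
     (\<Prod>j\<in>{1..k}. cnj (z j) - z j) *
     pfaffian k (block_matrix (\<lambda>j l. vector
       [vector [edge_kernel (z j) (z l),       edge_kernel (z j) (cnj (z l))],
        vector [edge_kernel (cnj (z j)) (z l), edge_kernel (cnj (z j)) (cnj (z l))]]))"

section \<open>Locally uniform convergence\<close>

text \<open>Every point of \<open>S\<close> has a neighbourhood, relative to \<open>S\<close>, on which the convergence is uniform.\<close>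

definition locally_uniform_limit ::
  "'a topology \<Rightarrow> 'a set \<Rightarrow> ('i \<Rightarrow> 'a \<Rightarrow> 'b::metric_space) \<Rightarrow> ('a \<Rightarrow> 'b) \<Rightarrow> 'i filter \<Rightarrow> bool" where
  "locally_uniform_limit X S f g F \<longleftrightarrow>
     (\<forall>x\<in>S. \<exists>U. openin (subtopology X S) U \<and> x \<in> U \<and> uniform_limit U f g F)"

end

theory Submission
  imports Defs
begin

text \<open>
  For a radial weight the moments \<open>h n\<close> determine a skew-orthogonal basis consisting of the odd
  monomials and of even polynomials with explicit coefficients. In this basis a particle that is
  integrated out occupies one pair of consecutive basis functions, so the expansion of the
  Vandermonde determinant yields the correlation functions as Pfaffians of a kernel that is a double
  sum over \<open>l \<le> m < N\<close>. At the hard edge \<open>1 / (N * h (2 * m))\<close>, suitably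
  normalised, behaves like \<open>2 * max 0 (m / N - \<rho>\<^sup>2)\<close>. The moments are log-convex, so the square of each coefficient lies
  between two quotients of moments and the coefficients of the kernel converge without any expansion.
  The double sum is then an integral of step functions, to which dominated convergence applies along
  arbitrary sequences \<open>N \<rightarrow> \<infinity>\<close> and \<open>z \<rightarrow> z0\<close>; on compact sets this amounts to uniform convergence.
\<close>

text \<open>Put \<open>b = 2 * \<rho>\<^sup>2\<close>, the squared radius, and
  \<open>\<kappa> = 1 - \<rho>\<^sup>2\<close>. In the variable \<open>s\<close>, the squared
  modulus, \<open>s ^ n * exp (- N * s)\<close> peaks at \<open>s = n / N\<close>. If the limit
  \<open>\<tau>\<close> of \<open>n / N\<close> exceeds \<open>b\<close>, the mass of the truncated
  weight sits in a boundary layer of width \<open>1 / N\<close>, and \<open>N\<close> times the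
  normalised moment tends to \<open>1 / (\<tau> - b)\<close>; otherwise the reciprocal of that
  product tends to 0. With \<open>n\<close> close to \<open>2 * m\<close>, only indices with
  \<open>m / N\<close> between \<open>\<rho>\<^sup>2\<close> and 1 survive, and
  \<open>t = \<rho>\<^sup>2 + \<kappa> * v\<close> maps this window to \<open>{0..1}\<close>. This
  accounts for the interval of integration, the square roots and the exponent
  \<open>2 * z * v\<close> of the limiting kernel. The two orders of the arguments in the double sum
  give the two terms of the Wronskian. The obstacle is the region below the window, where quotients
  of moments are out of control; only products of two reciprocals of moments, one per index, are
  passed to the limit. Both signs of \<open>\<sigma>\<close> are treated at once: the kernel
  contains \<open>\<sigma>\<close> to odd powers only, and this cancels against the
  \<open>\<sigma>\<close> in \<open>\<zeta> - cnj \<zeta>\<close>.\<close>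

section \<open>Sums over permutations and Pfaffians\<close>

text \<open>Composing \<open>p\<close> with the transposition of \<open>l j\<close> and
  \<open>r j\<close> flips the sign and exchanges the two terms of the difference for
  \<open>j\<close>, so after reindexing both terms contribute equally: one factor 2 per pair. The
  weight \<open>H\<close> makes the induction work: it absorbs the difference of one pair while the
  induction hypothesis treats the others.\<close>

lemma sum_permutes_antisym:
  fixes f :: "'j \<Rightarrow> 'p \<Rightarrow> 'p \<Rightarrow> 'a::comm_ring_1"
  assumes "finite J" and "finite P"
    and "\<And>j. j \<in> J \<Longrightarrow> l j \<in> P \<and> r j \<in> P \<and> l j \<noteq> r j"
    and "\<And>i j. i \<in> J \<Longrightarrow> j \<in> J \<Longrightarrow> i \<noteq> j \<Longrightarrow> l i \<noteq> l j \<and> l i \<noteq> r j \<and> r i \<noteq> r j"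
    and "\<And>p j. j \<in> J \<Longrightarrow> H (p \<circ> Transposition.transpose (l j) (r j)) = H p"
  shows "(\<Sum>p | p permutes P. of_int (sign p) * H p *
             (\<Prod>j\<in>J. f j (p (l j)) (p (r j)) - f j (p (r j)) (p (l j)))) =
         2 ^ card J * (\<Sum>p | p permutes P. of_int (sign p) * H p * (\<Prod>j\<in>J. f j (p (l j)) (p (r j))))"
  using assms
proof (induction J arbitrary: H rule: finite_induct)
  case empty
  then show ?case by simp
next
  case (insert j J)
  define H' where "H' p = H p * (f j (p (l j)) (p (r j)) - f j (p (r j)) (p (l j)))" for p
  define G where "G p = (\<Prod>i\<in>J. f i (p (l i)) (p (r i)))" for p :: "'p \<Rightarrow> 'p"
  let ?t = "Transposition.transpose (l j) (r j)"
  have tt: "?t permutes P"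
    using insert.prems(2)[of j] by (intro permutes_swap_id) auto
  have sgn: "sign (p \<circ> ?t) = - sign p" if "p permutes P" for p
  proof -
    have "permutation p" "permutation ?t"
      using that tt insert.prems(1) permutes_imp_permutation by blast+
    then show ?thesis
      using insert.prems(2)[of j] by (simp add: sign_compose sign_swap_id)
  qed
  have H'inv: "H' (p \<circ> Transposition.transpose (l i) (r i)) = H' p" if "i \<in> J" for p i
  proof -
    have "i \<noteq> j" using that insert.hyps by blast
    with insert.prems(3)[of i j] insert.prems(3)[of j i] that
    have "Transposition.transpose (l i) (r i) (l j) = l j" "Transposition.transpose (l i) (r i) (r j) = r j"
      by (auto simp: Transposition.transpose_def)
    moreover have Heq: "H (p \<circ> Transposition.transpose (l i) (r i)) = H p"
      using insert.prems(4)[of i p] that by blast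
    ultimately show ?thesis unfolding H'_def Heq by simp
  qed
  have Ginv: "G (p \<circ> ?t) = G p" for p
    unfolding G_def
  proof (rule prod.cong[OF refl])
    fix i assume "i \<in> J"
    then have "i \<noteq> j" using insert.hyps by blast
    with insert.prems(3)[of i j] insert.prems(3)[of j i] \<open>i \<in> J\<close>
    show "f i ((p \<circ> ?t) (l i)) ((p \<circ> ?t) (r i)) = f i (p (l i)) (p (r i))"
      by (auto simp: Transposition.transpose_def)
  qed
  have "(\<Sum>p | p permutes P. of_int (sign p) * H p *
             (\<Prod>j\<in>insert j J. f j (p (l j)) (p (r j)) - f j (p (r j)) (p (l j))))
      = (\<Sum>p | p permutes P. of_int (sign p) * H' p *
             (\<Prod>j\<in>J. f j (p (l j)) (p (r j)) - f j (p (r j)) (p (l j))))"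
    using insert.hyps by (simp add: H'_def mult.assoc)
  also have "\<dots> = 2 ^ card J * (\<Sum>p | p permutes P. of_int (sign p) * H' p * G p)"
    unfolding G_def
  proof (rule insert.IH)
    show "H' (p \<circ> Transposition.transpose (l i) (r i)) = H' p" if "i \<in> J" for p i
      using that by (rule H'inv)
  qed (use insert.prems(1-3) in simp_all)
  also have "(\<Sum>p | p permutes P. of_int (sign p) * H' p * G p)
      = (\<Sum>p | p permutes P. of_int (sign p) * H p * f j (p (l j)) (p (r j)) * G p)
      - (\<Sum>p | p permutes P. of_int (sign p) * H p * f j (p (r j)) (p (l j)) * G p)"
    by (simp add: H'_def algebra_simps sum_subtractf)
  also have "(\<Sum>p | p permutes P. of_int (sign p) * H p * f j (p (r j)) (p (l j)) * G p)
      = (\<Sum>p | p permutes P. of_int (sign (p \<circ> ?t)) * H (p \<circ> ?t) *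
          f j ((p \<circ> ?t) (r j)) ((p \<circ> ?t) (l j)) * G (p \<circ> ?t))"
    by (rule sum_permutations_compose_right[OF tt])
  also have "\<dots> = (\<Sum>p | p permutes P. - (of_int (sign p) * H p * f j (p (l j)) (p (r j)) * G p))"
  proof (rule sum.cong[OF refl])
    fix p assume "p \<in> {p. p permutes P}"
    moreover have Hj: "H (p \<circ> ?t) = H p" by (rule insert.prems(4)) simp
    ultimately show "of_int (sign (p \<circ> ?t)) * H (p \<circ> ?t) *
          f j ((p \<circ> ?t) (r j)) ((p \<circ> ?t) (l j)) * G (p \<circ> ?t) =
        - (of_int (sign p) * H p * f j (p (l j)) (p (r j)) * G p)"
      unfolding Hj Ginv by (simp add: sgn)
  qed
  finally show ?case
    using insert.hyps by (simp add: sum_negf G_def mult.assoc)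
qed

text \<open>For \<open>p\<close> in the set, \<open>inv d \<circ> p\<close> fixes
  \<open>P - A\<close> pointwise, so the set is a left coset of the symmetric group of
  \<open>A\<close>. This turns sums over constrained permutations into sums over a smaller symmetric
  group.\<close>

lemma permutes_agreeing_coset:
  assumes "d permutes P" "A \<subseteq> P"
  shows "{p. p permutes P \<and> (\<forall>i\<in>P - A. p i = d i)} = (\<lambda>t. d \<circ> t) ` {t. t permutes A}"
proof (intro equalityI subsetI)
  fix p assume "p \<in> {p. p permutes P \<and> (\<forall>i\<in>P - A. p i = d i)}"
  then have p: "p permutes P" and eq: "\<And>i. i \<in> P - A \<Longrightarrow> p i = d i" by auto
  have "inv d \<circ> p permutes A"
  proof (rule permutes_superset)
    show "inv d \<circ> p permutes P"
      using p assms(1) by (intro permutes_compose permutes_inv)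
    show "(inv d \<circ> p) x = x" if "x \<in> P - A" for x
      using eq[OF that] permutes_inverses[OF assms(1)] by simp
  qed
  moreover have "p = d \<circ> (inv d \<circ> p)"
    using permutes_inverses[OF assms(1)] by (auto simp: fun_eq_iff)
  ultimately show "p \<in> (\<lambda>t. d \<circ> t) ` {t. t permutes A}" by blast
next
  fix p assume "p \<in> (\<lambda>t. d \<circ> t) ` {t. t permutes A}"
  then obtain t where t: "t permutes A" "p = d \<circ> t" by blast
  then show "p \<in> {p. p permutes P \<and> (\<forall>i\<in>P - A. p i = d i)}"
    using assms permutes_subset[OF t(1) assms(2)] by (auto intro: permutes_compose simp: permutes_not_in)
qed

lemma inj_on_compose_permutes:
  assumes "d permutes P"
  shows "inj_on (\<lambda>t. d \<circ> t) T"
proof (rule inj_onI)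
  fix s t assume "d \<circ> s = d \<circ> t"
  then have "d (s x) = d (t x)" for x by (metis comp_apply)
  then show "s = t" using permutes_inj[OF assms] by (auto simp: inj_def fun_eq_iff)
qed

lemma permutes_extend:
  assumes "finite S" "J \<subseteq> S" "m \<in> J \<rightarrow> S" "inj_on m J"
  obtains d where "d permutes S" "\<And>j. j \<in> J \<Longrightarrow> d j = m j"
proof -
  have "card (S - J) = card (S - m ` J)"
    using assms card_image[OF assms(4)]
    by (subst card_Diff_subset; (subst card_Diff_subset)?) (auto intro: finite_subset)
  then obtain b where b: "bij_betw b (S - J) (S - m ` J)"
    using assms(1) by (meson bij_betw_iff_card finite_Diff)
  define d where "d x = (if x \<in> J then m x else if x \<in> S then b x else x)" for x
  have "bij_betw d (J \<union> (S - J)) (m ` J \<union> (S - m ` J))"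
  proof (rule bij_betw_combine)
    show "bij_betw d J (m ` J)"
      using assms(4) by (subst bij_betw_cong[of _ _ m]) (auto simp: d_def bij_betw_def)
    show "bij_betw d (S - J) (S - m ` J)"
      using b by (subst bij_betw_cong[of _ _ b]) (auto simp: d_def)
  qed auto
  moreover have "J \<union> (S - J) = S" "m ` J \<union> (S - m ` J) = S"
    using assms by auto
  ultimately have "d permutes S"
    using assms(2) by (intro bij_imp_permutes) (auto simp: d_def)
  then show thesis by (rule that) (auto simp: d_def)
qed

lemma card_permutes_extending:
  assumes "finite S" "J \<subseteq> S" "m \<in> J \<rightarrow> S" "inj_on m J"
  shows "card {p. p permutes S \<and> (\<forall>j\<in>J. p j = m j)} = fact (card S - card J)"
proof -
  obtain d where d: "d permutes S" "\<And>j. j \<in> J \<Longrightarrow> d j = m j"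
    using permutes_extend[OF assms] by blast
  have "{p. p permutes S \<and> (\<forall>j\<in>J. p j = m j)} = (\<lambda>t. d \<circ> t) ` {t. t permutes S - J}"
    using permutes_agreeing_coset[OF d(1), of "S - J"] d(2) assms(2)
    by (simp add: double_diff)
  then have "card {p. p permutes S \<and> (\<forall>j\<in>J. p j = m j)} = card {t. t permutes S - J}"
    using card_image[OF inj_on_compose_permutes[OF d(1)]] by metis
  also have "\<dots> = fact (card S - card J)"
    using assms by (intro card_permutations card_Diff_subset) (auto intro: finite_subset)
  finally show ?thesis .
qed

text \<open>Each injection of \<open>J\<close> into \<open>S\<close> extends to equally many
  permutations. Expanded products produce sums over injections; this rewrites them as sums over all
  permutations, where the two sides of the Pfaffian identity can be compared.\<close>

lemma sum_permutes_restrict: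
  fixes \<Phi> :: "('a \<Rightarrow> 'a) \<Rightarrow> 'b::{comm_semiring_1,semiring_char_0}"
  assumes "finite S" "J \<subseteq> S"
  shows "(\<Sum>p | p permutes S. \<Phi> (restrict p J)) =
         fact (card S - card J) * (\<Sum>m | m \<in> J \<rightarrow>\<^sub>E S \<and> inj_on m J. \<Phi> m)"
proof -
  let ?T = "{m. m \<in> J \<rightarrow>\<^sub>E S \<and> inj_on m J}"
  have finJ: "finite J" using assms finite_subset by blast
  have "(\<Sum>p | p permutes S. \<Phi> (restrict p J))
      = (\<Sum>m\<in>?T. \<Sum>p | p \<in> {p. p permutes S} \<and> restrict p J = m. \<Phi> (restrict p J))"
  proof (rule sum.group[symmetric])
    show "finite {p. p permutes S}" using assms by (simp add: finite_permutations)
    show "finite ?T" using finJ assms(1) by (auto intro: finite_subset[OF _ finite_PiE[of J "\<lambda>_. S"]])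
    show "(\<lambda>p. restrict p J) ` {p. p permutes S} \<subseteq> ?T"
      using assms(2) by (auto simp: inj_on_restrict_eq permutes_in_image intro: permutes_inj_on)
  qed
  also have "\<dots> = (\<Sum>m\<in>?T. fact (card S - card J) * \<Phi> m)"
  proof (rule sum.cong[OF refl])
    fix m assume m: "m \<in> ?T"
    have "{p. p \<in> {p. p permutes S} \<and> restrict p J = m} = {p. p permutes S \<and> (\<forall>j\<in>J. p j = m j)}"
      using m by (fastforce simp: fun_eq_iff PiE_def extensional_def)
    moreover have "card {p. p permutes S \<and> (\<forall>j\<in>J. p j = m j)} = fact (card S - card J)"
      using m assms by (intro card_permutes_extending) auto
    ultimately have "of_nat (card {p. p \<in> {p. p permutes S} \<and> restrict p J = m}) = (fact (card S - card J) :: 'b)"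
      by simp
    moreover have "(\<Sum>p | p \<in> {p. p permutes S} \<and> restrict p J = m. \<Phi> (restrict p J)) =
        (\<Sum>p | p \<in> {p. p permutes S} \<and> restrict p J = m. \<Phi> m)"
      by (rule sum.cong) auto
    ultimately show "(\<Sum>p | p \<in> {p. p permutes S} \<and> restrict p J = m. \<Phi> (restrict p J)) =
        fact (card S - card J) * \<Phi> m"
      by (simp only: sum_constant)
  qed
  finally show ?thesis by (simp add: sum_distrib_left)
qed

text \<open>The lift acts as a copy \<open>L\<close> of \<open>\<mu>\<close> on the odd positions
  and a copy \<open>R\<close> on the even ones. Both have the sign of \<open>\<mu>\<close>, so their
  product is even: moving whole pairs never produces a sign.\<close>

lemma pair_permutation:
  assumes "\<mu> permutes {1..N::nat}"
  obtains d where "d permutes {1..2*N}" "sign d = 1"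
    "\<And>j. j \<in> {1..N} \<Longrightarrow> d (2*j-1) = 2 * \<mu> j - 1 \<and> d (2*j) = 2 * \<mu> j"
proof -
  let ?S = "{1..N}" and ?l = "\<lambda>j::nat. 2*j-1" and ?r = "\<lambda>j::nat. 2*j"
  define L where "L = map_permutation ?S ?l \<mu>"
  define R where "R = map_permutation ?S ?r \<mu>"
  have injl: "inj_on ?l ?S" and injr: "inj_on ?r ?S" by (auto simp: inj_on_def)
  have L: "L permutes ?l ` ?S" and R: "R permutes ?r ` ?S"
    unfolding L_def R_def using injl injr assms
    by (auto intro!: map_permutation_permutes simp: bij_betw_def)
  have disj: "a \<notin> ?l ` ?S" if "a \<in> ?r ` ?S" for a
    using that by auto presburger
  have disj': "a \<notin> ?r ` ?S" if "a \<in> ?l ` ?S" for a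
    using that disj by blast
  have sub: "?l ` ?S \<subseteq> {1..2*N}" "?r ` ?S \<subseteq> {1..2*N}" by auto
  have "L \<circ> R permutes {1..2*N}"
    using permutes_subset[OF L sub(1)] permutes_subset[OF R sub(2)] by (rule permutes_compose[rotated])
  moreover have "sign (L \<circ> R) = 1"
  proof -
    have "permutation L" "permutation R"
      using L R by (auto intro: permutes_imp_permutation[rotated])
    then show ?thesis
      using injl injr assms by (simp add: sign_compose L_def R_def sign_map_permutation)
  qed
  moreover have "(L \<circ> R) (2*j-1) = 2 * \<mu> j - 1 \<and> (L \<circ> R) (2*j) = 2 * \<mu> j" if "j \<in> ?S" for j
  proof -
    have \<mu>j: "\<mu> j \<in> ?S" using that assms permutes_in_image by metis
    have "R (?l j) = ?l j"
      using that by (intro permutes_not_in[OF R] disj') blast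
    moreover have "L (?l j) = ?l (\<mu> j)"
      unfolding L_def using map_permutation_apply[OF injl that] by simp
    moreover have "R (?r j) = ?r (\<mu> j)"
      unfolding R_def using map_permutation_apply[OF injr that] by simp
    moreover have "L (?r (\<mu> j)) = ?r (\<mu> j)"
      using \<mu>j by (intro permutes_not_in[OF L] disj) blast
    ultimately show ?thesis by simp
  qed
  ultimately show thesis using that by blast
qed

lemma prod_doubled_interval:
  fixes f :: "nat \<Rightarrow> 'a::comm_monoid_mult"
  shows "(\<Prod>i=1..2*k. f i) = (\<Prod>j=1..k. f (2*j-1) * f (2*j))"
proof (induction k)
  case (Suc k)
  have "{1..2 * Suc k} = insert (2*k+2) (insert (2*k+1) {1..2*k})" by auto
  moreover have "{1..Suc k} = insert (k+1) {1..k}" by auto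
  ultimately show ?case using Suc by (simp add: mult_ac)
qed simp

lemma interval_pair_cases:
  assumes "i \<in> {1..2*k} - {1..2*j::nat}"
  obtains a where "a \<in> {j+1..k}" "i = 2*a-1" | a where "a \<in> {j+1..k}" "i = 2*a"
proof (cases "odd i")
  case True
  then obtain b where "i = 2*b+1" by (elim oddE)
  with that(1)[of "b+1"] assms show thesis by auto
next
  case False
  then obtain b where "i = 2*b" by (metis dvdE)
  with that(2)[of b] assms show thesis by auto
qed

text \<open>Equal factors make the sum vanish because it is the determinant of a matrix with repeated columns.\<close>

lemma sum_permutes_eq_0:
  fixes X :: "nat \<Rightarrow> nat \<Rightarrow> 'a::{comm_ring_1,ring_char_0,semiring_no_zero_divisors}"
  assumes "a \<in> {1..k}" "b \<in> {1..k}" "a \<noteq> b" "m a = m b"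
  shows "(\<Sum>p | p permutes {1..2*k}. of_int (sign p) *
            (\<Prod>j=1..k. X (p (2*j-1)) (2 * m j - 1) * X (p (2*j)) (2 * m j))) = 0"
proof -
  let ?t = "Transposition.transpose (2*a-1) (2*b-1)"
  define c where "c i = (if odd i then 2 * m ((i+1) div 2) - 1 else 2 * m (i div 2))" for i
  have prod: "(\<Prod>j=1..k. X (p (2*j-1)) (2 * m j - 1) * X (p (2*j)) (2 * m j))
      = (\<Prod>i=1..2*k. X (p i) (c i))" for p
    unfolding prod_doubled_interval by (rule prod.cong) (auto simp: c_def)
  have tt: "?t permutes {1..2*k}"
    using assms by (intro permutes_swap_id) auto
  have ct: "c (?t i) = c i" for i
  proof -
    have "c (2*j-1) = 2 * m j - 1" if "1 \<le> j" for j
      using that by (cases j) (auto simp: c_def)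
    from this[of a] this[of b] assms show ?thesis
      by (auto simp: Transposition.transpose_def)
  qed
  have neq: "2*a-1 \<noteq> 2*b-1" using assms by auto
  define S where "S = (\<Sum>p | p permutes {1..2*k}. of_int (sign p) * (\<Prod>i=1..2*k. X (p i) (c i)))"
  have "S = (\<Sum>p | p permutes {1..2*k}. of_int (sign (p \<circ> ?t)) * (\<Prod>i=1..2*k. X ((p \<circ> ?t) i) (c i)))"
    unfolding S_def by (rule sum_permutations_compose_right[OF tt])
  also have "\<dots> = (\<Sum>p | p permutes {1..2*k}. - (of_int (sign p) * (\<Prod>i=1..2*k. X (p i) (c i))))"
  proof (rule sum.cong[OF refl])
    fix p assume "p \<in> {p. p permutes {1..2*k}}"
    then have perm: "permutation p" "permutation ?t"
      using tt permutes_imp_permutation by blast+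
    then have "sign (p \<circ> ?t) = - sign p"
      using neq by (simp add: sign_compose sign_swap_id)
    moreover have "(\<Prod>i=1..2*k. X ((p \<circ> ?t) i) (c i)) = (\<Prod>i=1..2*k. X (p i) (c i))"
      using prod.permute[OF tt, of "\<lambda>i. X (p i) (c i)"] by (simp only: o_def ct)
    ultimately show "of_int (sign (p \<circ> ?t)) * (\<Prod>i=1..2*k. X ((p \<circ> ?t) i) (c i)) =
        - (of_int (sign p) * (\<Prod>i=1..2*k. X (p i) (c i)))"
      by (simp only: of_int_minus mult_minus_left)
  qed
  also have "\<dots> = - S" by (simp add: S_def sum_negf)
  finally have "S = - S" .
  then have "2 * S = 0" by (metis add.right_inverse mult_2)
  then have "S = 0" by simp
  then show ?thesis by (simp only: prod S_def)
qed

text \<open>The kernel is a sum of \<open>N\<close> skew forms of rank two, so expanding the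
  Pfaffian assigns an index \<open>m j\<close> to each of the \<open>k\<close> pairs; assignments
  that are not injective vanish by \<open>sum_permutes_eq_0\<close>. The factor
  \<open>fact (N - k)\<close> converts injections of \<open>{1..k}\<close> into permutations of
  \<open>{1..N}\<close>, the form that \<open>sum_permutes_contraction\<close> arrives at.\<close>

lemma pfaffian_sum_rank_two:
  fixes X :: "nat \<Rightarrow> nat \<Rightarrow> complex" and r :: "nat \<Rightarrow> complex"
  assumes "k \<le> N"
  shows "fact k * fact (N - k) * pfaffian k (\<lambda>i i'. \<Sum>m=1..N.
            (X i (2*m-1) * X i' (2*m) - X i (2*m) * X i' (2*m-1)) / r m) =
         (\<Sum>\<mu> | \<mu> permutes {1..N}. (\<Prod>j=1..k. 1 / r (\<mu> j)) *
           (\<Sum>p | p permutes {1..2*k}. of_int (sign p) *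
              (\<Prod>j=1..k. X (p (2*j-1)) (2 * \<mu> j - 1) * X (p (2*j)) (2 * \<mu> j))))"
proof -
  define D where "D m = (\<Sum>p | p permutes {1..2*k}. of_int (sign p) *
              (\<Prod>j=1..k. X (p (2*j-1)) (2 * m j - 1) * X (p (2*j)) (2 * m j)))" for m
  define B where "B i i' = (\<Sum>m=1..N. X i (2*m-1) * X i' (2*m) / r m)" for i i'
  define \<Phi> where "\<Phi> m = (\<Prod>j=1..k. 1 / r (m j)) * D m" for m
  have K: "(\<Sum>m=1..N. (X i (2*m-1) * X i' (2*m) - X i (2*m) * X i' (2*m-1)) / r m) = B i i' - B i' i" for i i'
    by (simp add: B_def sum_subtractf diff_divide_distrib mult_ac)
  \<comment> \<open>Only \<open>B\<close>, half of the skew form, has to be expanded: the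
    differences cost exactly the \<open>2 ^ k\<close> in the definition of the Pfaffian.\<close>
  have "2 ^ k * fact k * pfaffian k (\<lambda>i i'. B i i' - B i' i) =
     (\<Sum>p | p permutes {1..2*k}. of_int (sign p) * 1 *
        (\<Prod>j=1..k. B (p (2*j-1)) (p (2*j)) - B (p (2*j)) (p (2*j-1))))"
    by (simp add: pfaffian_def)
  also have "\<dots> = 2 ^ card {1..k} * (\<Sum>p | p permutes {1..2*k}. of_int (sign p) * 1 *
        (\<Prod>j=1..k. B (p (2*j-1)) (p (2*j))))"
    by (rule sum_permutes_antisym[where l = "\<lambda>j. 2*j-1" and r = "\<lambda>j. 2*j" and H = "\<lambda>_. 1"
              and f = "\<lambda>_. B"]) auto
  finally have "fact k * pfaffian k (\<lambda>i i'. B i i' - B i' i) =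
      (\<Sum>p | p permutes {1..2*k}. of_int (sign p) * (\<Prod>j=1..k. B (p (2*j-1)) (p (2*j))))"
    by simp
  also have "\<dots> = (\<Sum>p | p permutes {1..2*k}. of_int (sign p) * (\<Sum>m\<in>{1..k} \<rightarrow>\<^sub>E {1..N}.
       \<Prod>j=1..k. X (p (2*j-1)) (2*m j-1) * X (p (2*j)) (2*m j) / r (m j)))"
    unfolding B_def by (subst prod_sum_PiE) auto
  also have "\<dots> = (\<Sum>m\<in>{1..k} \<rightarrow>\<^sub>E {1..N}. \<Phi> m)"
    unfolding \<Phi>_def D_def sum_distrib_left
    by (subst sum.swap) (simp add: prod_dividef mult_ac)
  also have "\<dots> = (\<Sum>m | m \<in> {1..k} \<rightarrow>\<^sub>E {1..N} \<and> inj_on m {1..k}. \<Phi> m)"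
  proof (rule sum.mono_neutral_right)
    show "finite ({1..k} \<rightarrow>\<^sub>E {1..N})" by (simp add: finite_PiE)
    show "\<forall>m\<in>({1..k} \<rightarrow>\<^sub>E {1..N}) - {m. m \<in> {1..k} \<rightarrow>\<^sub>E {1..N} \<and> inj_on m {1..k}}. \<Phi> m = 0"
    proof
      fix m assume "m \<in> ({1..k} \<rightarrow>\<^sub>E {1..N}) - {m. m \<in> {1..k} \<rightarrow>\<^sub>E {1..N} \<and> inj_on m {1..k}}"
      then obtain a b where "a \<in> {1..k}" "b \<in> {1..k}" "a \<noteq> b" "m a = m b"
        by (auto simp: inj_on_def)
      then have "D m = 0" unfolding D_def by (rule sum_permutes_eq_0)
      then show "\<Phi> m = 0" by (simp add: \<Phi>_def)
    qed
  qed auto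
  finally have "fact (N - k) * (fact k * pfaffian k (\<lambda>i i'. B i i' - B i' i)) =
      fact (N - k) * (\<Sum>m | m \<in> {1..k} \<rightarrow>\<^sub>E {1..N} \<and> inj_on m {1..k}. \<Phi> m)"
    by simp
  also have "\<dots> = (\<Sum>\<mu> | \<mu> permutes {1..N}. \<Phi> (restrict \<mu> {1..k}))"
    using sum_permutes_restrict[of "{1..N}" "{1..k}" \<Phi>] assms by simp
  also have "\<dots> = (\<Sum>\<mu> | \<mu> permutes {1..N}. \<Phi> \<mu>)"
    unfolding \<Phi>_def D_def by (intro sum.cong refl arg_cong2[where f = "(*)"] prod.cong) auto
  finally show ?thesis
    unfolding K \<Phi>_def D_def by (simp add: mult_ac)
qed

text \<open>Prescribing the last \<open>N - k\<close> pairs leaves the coset of the even lift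
  \<open>d\<close> of \<open>\<mu>\<close>, so only \<open>d \<circ> t\<close> with \<open>t\<close>
  acting on the first \<open>2 * k\<close> positions occurs, with the sign of \<open>t\<close>
  alone. Passing to the inverse of \<open>t\<close> then moves the permutation from the second index
  of \<open>X\<close> to the first.\<close>

lemma sum_permutes_fixed_tail:
  fixes X :: "nat \<Rightarrow> nat \<Rightarrow> 'a::comm_ring_1"
  assumes "k \<le> N" "\<mu> permutes {1..N}"
  shows "(\<Sum>p | p permutes {1..2*N} \<and> (\<forall>j\<in>{k+1..N}. p (2*j-1) = 2 * \<mu> j - 1 \<and> p (2*j) = 2 * \<mu> j).
            of_int (sign p) * (\<Prod>j=1..k. X (2*j-1) (p (2*j-1)) * X (2*j) (p (2*j)))) =
         (\<Sum>p | p permutes {1..2*k}. of_int (sign p) *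
              (\<Prod>j=1..k. X (p (2*j-1)) (2 * \<mu> j - 1) * X (p (2*j)) (2 * \<mu> j)))"
proof -
  let ?pair = "\<lambda>j p. p (2*j-1) = 2 * \<mu> j - 1 \<and> p (2*j) = 2 * \<mu> j"
  obtain d where d: "d permutes {1..2*N}" "sign d = 1"
    and dj: "\<And>j. j \<in> {1..N} \<Longrightarrow> d (2*j-1) = 2 * \<mu> j - 1 \<and> d (2*j) = 2 * \<mu> j"
    using pair_permutation[OF assms(2)] by blast
  have "p permutes {1..2*N} \<and> (\<forall>j\<in>{k+1..N}. ?pair j p) \<longleftrightarrow>
      p permutes {1..2*N} \<and> (\<forall>i\<in>{1..2*N} - {1..2*k}. p i = d i)" for p
  proof (intro conj_cong refl iffI ballI)
    fix i assume *: "\<forall>j\<in>{k+1..N}. ?pair j p"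
      and i: "i \<in> {1..2*N} - {1..2*k}"
    show "p i = d i"
      using i by (rule interval_pair_cases) (use * dj in auto)
  next
    fix j assume *: "\<forall>i\<in>{1..2*N} - {1..2*k}. p i = d i" and j: "j \<in> {k+1..N}"
    then have "2*j-1 \<in> {1..2*N} - {1..2*k}" "2*j \<in> {1..2*N} - {1..2*k}" by auto
    with * have "p (2*j-1) = d (2*j-1)" "p (2*j) = d (2*j)" by blast+
    with dj j show "?pair j p" by simp
  qed
  then have set: "{p. p permutes {1..2*N} \<and> (\<forall>j\<in>{k+1..N}. ?pair j p)}
      = (\<lambda>t. d \<circ> t) ` {t. t permutes {1..2*k}}"
    using permutes_agreeing_coset[OF d(1), of "{1..2*k}"] assms(1) by simp
  have "(\<Sum>p | p permutes {1..2*N} \<and> (\<forall>j\<in>{k+1..N}. ?pair j p).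
            of_int (sign p) * (\<Prod>j=1..k. X (2*j-1) (p (2*j-1)) * X (2*j) (p (2*j))))
     = (\<Sum>t | t permutes {1..2*k}. of_int (sign (d \<circ> t)) * (\<Prod>i=1..2*k. X i (d (t i))))"
    unfolding set prod_doubled_interval[of "\<lambda>i. X i (p i)" for p, symmetric]
    by (subst sum.reindex[OF inj_on_compose_permutes[OF d(1)]]) (simp only: comp_def)
  also have "\<dots> = (\<Sum>t | t permutes {1..2*k}. of_int (sign t) * (\<Prod>i=1..2*k. X (inv t i) (d i)))"
  proof (rule sum.cong[OF refl])
    fix t assume t: "t \<in> {t. t permutes {1..2*k}}"
    then have t': "t permutes {1..2*k}" by simp
    have "permutation d" "permutation t"
      using t d(1) permutes_imp_permutation by blast+
    then have "sign (d \<circ> t) = sign t" by (simp add: sign_compose d(2))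
    moreover have "(\<Prod>i=1..2*k. X (inv t i) (d i)) = (\<Prod>i=1..2*k. X i (d (t i)))"
      by (subst prod.permute[OF t']) (simp add: permutes_inverses[OF t'])
    ultimately show "of_int (sign (d \<circ> t)) * (\<Prod>i=1..2*k. X i (d (t i))) =
        of_int (sign t) * (\<Prod>i=1..2*k. X (inv t i) (d i))" by simp
  qed
  also have "\<dots> = (\<Sum>t | t permutes {1..2*k}. of_int (sign t) * (\<Prod>i=1..2*k. X (t i) (d i)))"
  proof (subst sum_permutations_inverse, rule sum.cong[OF refl])
    fix t assume "t \<in> {t. t permutes {1..2*k}}"
    then have t: "t permutes {1..2*k}" by simp
    then have "permutation t" by (auto intro: permutes_imp_permutation[rotated])
    then show "of_int (sign (inv t)) * (\<Prod>i=1..2*k. X (inv (inv t) i) (d i)) =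
        of_int (sign t) * (\<Prod>i=1..2*k. X (t i) (d i))"
      by (simp add: sign_inverse permutes_inv_inv[OF t])
  qed
  also have "\<dots> = (\<Sum>p | p permutes {1..2*k}. of_int (sign p) *
              (\<Prod>j=1..k. X (p (2*j-1)) (2 * \<mu> j - 1) * X (p (2*j)) (2 * \<mu> j)))"
    unfolding prod_doubled_interval using assms(1) dj
    by (intro sum.cong refl arg_cong2[where f = "(*)"] prod.cong) auto
  finally show ?thesis .
qed

text \<open>Here \<open>X i a\<close> stands for the value of basis function \<open>a\<close> at
  retained node \<open>i\<close>, and \<open>I a b\<close> for the skew product left by integrating
  a particle. The integrated particles occupy distinct pairs; their norms \<open>r\<close> multiply
  to the product of all norms divided by those of the \<open>k\<close> free pairs, and these
  divisions are the denominators of the kernel.\<close>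

theorem sum_permutes_contraction:
  fixes X I :: "nat \<Rightarrow> nat \<Rightarrow> complex" and r :: "nat \<Rightarrow> complex"
  assumes "k \<le> N" and r: "\<And>m. m \<in> {1..N} \<Longrightarrow> r m \<noteq> 0"
    and I: "\<And>a b. a \<in> {1..2*N} \<Longrightarrow> b \<in> {1..2*N} \<Longrightarrow> I a b =
      (\<Sum>m=1..N. r m * (of_bool (a = 2*m-1 \<and> b = 2*m) - of_bool (b = 2*m-1 \<and> a = 2*m)))"
  shows "(\<Sum>p | p permutes {1..2*N}. of_int (sign p) *
            ((\<Prod>j=1..k. X (2*j-1) (p (2*j-1)) * X (2*j) (p (2*j))) *
             (\<Prod>j=k+1..N. I (p (2*j-1)) (p (2*j))))) =
         2 ^ (N - k) * fact (N - k) * (\<Prod>m=1..N. r m) *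
         pfaffian k (\<lambda>i i'. \<Sum>m=1..N. (X i (2*m-1) * X i' (2*m) - X i (2*m) * X i' (2*m-1)) / r m)"
proof -
  let ?K = "\<lambda>i i'. \<Sum>m=1..N. (X i (2*m-1) * X i' (2*m) - X i (2*m) * X i' (2*m-1)) / r m"
  let ?P = "{1..2*N}" and ?T = "{k+1..N}"
  let ?pair = "\<lambda>m j p. p (2*j-1) = 2 * m j - 1 \<and> p (2*j) = 2 * m j"
  let ?tr = "\<lambda>j. Transposition.transpose (2*j-1) (2*j)"
  define J where "J a b = (\<Sum>m=1..N. r m * of_bool (a = 2*m-1 \<and> b = 2*m))" for a b
  define H where "H p = (\<Prod>j=1..k. X (2*j-1) (p (2*j-1)) * X (2*j) (p (2*j)))" for p
  define D where "D m = (\<Sum>p | p permutes {1..2*k}. of_int (sign p) *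
              (\<Prod>j=1..k. X (p (2*j-1)) (2 * m j - 1) * X (p (2*j)) (2 * m j)))" for m
  define W where "W m = (\<Prod>j\<in>?T. r (m j)) *
      (\<Sum>p | p permutes ?P \<and> (\<forall>j\<in>?T. ?pair m j p). of_int (sign p) * H p)" for m
  have "(\<Sum>p | p permutes ?P. of_int (sign p) * (H p * (\<Prod>j\<in>?T. I (p (2*j-1)) (p (2*j)))))
      = (\<Sum>p | p permutes ?P. of_int (sign p) * H p *
           (\<Prod>j\<in>?T. J (p (2*j-1)) (p (2*j)) - J (p (2*j)) (p (2*j-1))))"
  proof (rule sum.cong[OF refl])
    fix p assume "p \<in> {p. p permutes ?P}"
    then have p: "p permutes ?P" by simp
    have "(\<Prod>j\<in>?T. I (p (2*j-1)) (p (2*j))) = (\<Prod>j\<in>?T. J (p (2*j-1)) (p (2*j)) - J (p (2*j)) (p (2*j-1)))"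
    proof (rule prod.cong[OF refl])
      fix j assume "j \<in> ?T"
      then have "2*j-1 \<in> ?P" "2*j \<in> ?P" by auto
      then have "p (2*j-1) \<in> ?P" "p (2*j) \<in> ?P" using permutes_in_image[OF p] by blast+
      then show "I (p (2*j-1)) (p (2*j)) = J (p (2*j-1)) (p (2*j)) - J (p (2*j)) (p (2*j-1))"
        by (simp only: I J_def right_diff_distrib sum_subtractf)
    qed
    then show "of_int (sign p) * (H p * (\<Prod>j\<in>?T. I (p (2*j-1)) (p (2*j)))) = of_int (sign p) * H p *
           (\<Prod>j\<in>?T. J (p (2*j-1)) (p (2*j)) - J (p (2*j)) (p (2*j-1)))" by simp
  qed
  also have "\<dots> = 2 ^ card ?T * (\<Sum>p | p permutes ?P. of_int (sign p) * H p *
           (\<Prod>j\<in>?T. J (p (2*j-1)) (p (2*j))))"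
  proof (rule sum_permutes_antisym[where l = "\<lambda>j. 2*j-1" and r = "\<lambda>j. 2*j" and H = H and f = "\<lambda>_. J"])
    fix p j assume j: "j \<in> ?T"
    show "H (p \<circ> ?tr j) = H p"
      unfolding H_def
    proof (rule prod.cong[OF refl])
      fix i assume "i \<in> {1..k}"
      with j have "?tr j (2*i-1) = 2*i-1"
         "?tr j (2*i) = 2*i"
        by (auto simp: Transposition.transpose_def)
      then show "X (2*i-1) ((p \<circ> ?tr j) (2*i-1)) *
          X (2*i) ((p \<circ> ?tr j) (2*i)) =
          X (2*i-1) (p (2*i-1)) * X (2*i) (p (2*i))" by simp
    qed
  qed auto
  also have "(\<Sum>p | p permutes ?P. of_int (sign p) * H p * (\<Prod>j\<in>?T. J (p (2*j-1)) (p (2*j))))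
      = (\<Sum>p | p permutes ?P. \<Sum>m\<in>?T \<rightarrow>\<^sub>E {1..N}. of_int (sign p) * H p *
          (\<Prod>j\<in>?T. r (m j) * of_bool (?pair m j p)))"
    unfolding J_def by (subst prod_sum_PiE) (simp_all only: finite_atLeastAtMost sum_distrib_left)
  also have "\<dots> = (\<Sum>m\<in>?T \<rightarrow>\<^sub>E {1..N}. \<Sum>p | p permutes ?P. of_int (sign p) * H p *
          (\<Prod>j\<in>?T. r (m j) * of_bool (?pair m j p)))"
    by (rule sum.swap)
  also have "\<dots> = (\<Sum>m\<in>?T \<rightarrow>\<^sub>E {1..N}. W m)"
  proof (rule sum.cong[OF refl])
    fix m
    have bool: "(\<Prod>j\<in>?T. r (m j) * of_bool (?pair m j p)) =
        (\<Prod>j\<in>?T. r (m j)) * of_bool (\<forall>j\<in>?T. ?pair m j p)" for p :: "nat \<Rightarrow> nat"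
    proof -
      have "(\<Prod>j\<in>?T. of_bool (?pair m j p)) =
        (of_bool (\<forall>j\<in>?T. ?pair m j p) :: complex)"
      proof (cases "\<forall>j\<in>?T. ?pair m j p")
        case False
        then obtain j where j: "j \<in> ?T" "\<not> (?pair m j p)" by blast
        then have "\<exists>j\<in>?T. of_bool (?pair m j p) = (0 :: complex)"
          by (intro bexI[of _ j]) (simp_all only: of_bool_eq simp_thms)
        then have "(\<Prod>j\<in>?T. of_bool (?pair m j p)) = (0 :: complex)"
          by (intro prod_zero) (simp_all only: finite_atLeastAtMost)
        with False show ?thesis by (simp only: of_bool_eq)
      next
        case True
        have "(\<Prod>j\<in>?T. of_bool (?pair m j p)) = (\<Prod>j\<in>?T. 1 :: complex)"
          using True by (intro prod.cong) (simp_all only: of_bool_eq simp_thms)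
        also have "\<dots> = of_bool (\<forall>j\<in>?T. ?pair m j p)"
          unfolding eqTrueI[OF True] by simp
        finally show ?thesis .
      qed
      then show ?thesis by (simp only: prod.distrib)
    qed
    have "(\<Sum>p | p permutes ?P. of_int (sign p) * H p *
          (\<Prod>j\<in>?T. r (m j) * of_bool (?pair m j p))) =
       (\<Sum>p\<in>{p. p permutes ?P} \<inter> {p. \<forall>j\<in>?T. ?pair m j p}.
          of_int (sign p) * H p * (\<Prod>j\<in>?T. r (m j)))"
      unfolding bool
      by (subst sum.inter_restrict) (simp_all only: finite_permutations finite_atLeastAtMost of_bool_def if_distrib[where f = "(*) _"]
        mult_1_right mult_zero_right mem_Collect_eq)
    also have "\<dots> = W m"
      unfolding W_def Collect_conj_eq[symmetric] by (simp add: sum_distrib_left mult_ac)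
    finally show "(\<Sum>p | p permutes ?P. of_int (sign p) * H p *
          (\<Prod>j\<in>?T. r (m j) * of_bool (?pair m j p))) = W m" .
  qed
  also have "\<dots> = (\<Sum>m | m \<in> ?T \<rightarrow>\<^sub>E {1..N} \<and> inj_on m ?T. W m)"
  proof (rule sum.mono_neutral_right)
    show "finite (?T \<rightarrow>\<^sub>E {1..N})" by (simp add: finite_PiE)
    show "\<forall>m\<in>(?T \<rightarrow>\<^sub>E {1..N}) - {m. m \<in> ?T \<rightarrow>\<^sub>E {1..N} \<and> inj_on m ?T}. W m = 0"
    proof
      fix m assume "m \<in> (?T \<rightarrow>\<^sub>E {1..N}) - {m. m \<in> ?T \<rightarrow>\<^sub>E {1..N} \<and> inj_on m ?T}"
      then obtain a b where ab: "a \<in> ?T" "b \<in> ?T" "a \<noteq> b" "m a = m b"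
        by (auto simp: inj_on_def)
      have "\<not> (\<forall>j\<in>?T. ?pair m j p)" if "p permutes ?P" for p
      proof
        assume "\<forall>j\<in>?T. ?pair m j p"
        with ab have "p (2*a) = p (2*b)" by simp
        then have "2*a = 2*b" by (rule injD[OF permutes_inj[OF that]])
        with ab show False by simp
      qed
      then have "{p. p permutes ?P \<and> (\<forall>j\<in>?T. ?pair m j p)} = {}" by blast
      then show "W m = 0" unfolding W_def by (simp only: sum.empty mult_zero_right)
    qed
  qed auto
  \<comment> \<open>The factor \<open>fact k\<close> counts the extensions of an injection of
    \<open>{k+1..N}\<close> to a permutation of \<open>{1..N}\<close>. It occurs again in
    \<open>pfaffian_sum_rank_two\<close> and cancels at the end.\<close>
  finally have "fact k * (\<Sum>p | p permutes ?P. of_int (sign p) * (H p * (\<Prod>j\<in>?T. I (p (2*j-1)) (p (2*j)))))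
      = 2 ^ (N - k) * (fact k * (\<Sum>m | m \<in> ?T \<rightarrow>\<^sub>E {1..N} \<and> inj_on m ?T. W m))"
    by simp
  also have "fact k * (\<Sum>m | m \<in> ?T \<rightarrow>\<^sub>E {1..N} \<and> inj_on m ?T. W m) =
      (\<Sum>\<mu> | \<mu> permutes {1..N}. W (restrict \<mu> ?T))"
    using sum_permutes_restrict[of "{1..N}" ?T W] assms(1) by simp
  also have "\<dots> = (\<Sum>\<mu> | \<mu> permutes {1..N}. (\<Prod>m=1..N. r m) * ((\<Prod>j=1..k. 1 / r (\<mu> j)) * D \<mu>))"
  proof (rule sum.cong[OF refl])
    fix \<mu> assume "\<mu> \<in> {\<mu>. \<mu> permutes {1..N}}"
    then have \<mu>: "\<mu> permutes {1..N}" by simp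
    have "W (restrict \<mu> ?T) = W \<mu>"
      unfolding W_def by (intro arg_cong2[where f = "(*)"] prod.cong sum.cong) auto
    also have "\<dots> = (\<Prod>j\<in>?T. r (\<mu> j)) * D \<mu>"
      unfolding W_def H_def D_def using sum_permutes_fixed_tail[OF assms(1) \<mu>, of X] by simp
    also have "(\<Prod>j\<in>?T. r (\<mu> j)) = (\<Prod>m=1..N. r m) * (\<Prod>j=1..k. 1 / r (\<mu> j))"
    proof -
      have "(\<Prod>m=1..N. r m) = (\<Prod>j=1..N. r (\<mu> j))"
        by (subst prod.permute[OF \<mu>]) simp
      also have "\<dots> = (\<Prod>j\<in>{1..k} \<union> ?T. r (\<mu> j))"
        using assms(1) by (intro prod.cong) auto
      also have "\<dots> = (\<Prod>j=1..k. r (\<mu> j)) * (\<Prod>j\<in>?T. r (\<mu> j))"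
        by (rule prod.union_disjoint) auto
      finally have "(\<Prod>m=1..N. r m) = (\<Prod>j=1..k. r (\<mu> j)) * (\<Prod>j\<in>?T. r (\<mu> j))" .
      moreover have "(\<Prod>j=1..k. r (\<mu> j)) \<noteq> 0"
      proof -
        have "\<mu> j \<in> {1..N}" if "j \<in> {1..k}" for j
          using that assms(1) permutes_in_image[OF \<mu>, of j] by auto
        then show ?thesis using r by (simp add: prod_zero_iff)
      qed
      ultimately show ?thesis by (simp add: prod_dividef)
    qed
    finally show "W (restrict \<mu> ?T) = (\<Prod>m=1..N. r m) * ((\<Prod>j=1..k. 1 / r (\<mu> j)) * D \<mu>)"
      by (simp only: mult.assoc)
  qed
  also have "\<dots> = (\<Prod>m=1..N. r m) * (fact k * fact (N - k) * pfaffian k ?K)"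
    unfolding pfaffian_sum_rank_two[OF assms(1)] D_def by (simp add: sum_distrib_left)
  finally show ?thesis
    unfolding H_def by simp
qed

section \<open>Vandermonde determinants\<close>

lemma sum_permutes_fix_point:
  assumes "finite S" "a \<notin> S" "\<And>p. p permutes insert a S \<Longrightarrow> p a \<noteq> a \<Longrightarrow> f p = 0"
  shows "(\<Sum>p | p permutes insert a S. f p) = (\<Sum>p | p permutes S. f p)"
proof (rule sum.mono_neutral_right)
  show "finite {p. p permutes insert a S}" using assms by (simp add: finite_permutations)
  show "{p. p permutes S} \<subseteq> {p. p permutes insert a S}" by (auto intro: permutes_subset)
  show "\<forall>p\<in>{p. p permutes insert a S} - {p. p permutes S}. f p = 0"
  proof
    fix p assume p: "p \<in> {p. p permutes insert a S} - {p. p permutes S}"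
    then have "p a \<noteq> a" by (auto intro: permutes_superset)
    with p assms(3) show "f p = 0" by auto
  qed
qed

text \<open>The sums are determinants. In the last column the monic polynomial of degree \<open>n\<close> may be
  replaced by the one that vanishes at the first \<open>n\<close> nodes, because their difference is a
  combination of the preceding columns.\<close>

lemma vandermonde_monic_columns:
  fixes q :: "nat \<Rightarrow> 'a::field_char_0 poly"
  assumes "\<And>a. a \<in> {1..n} \<Longrightarrow> degree (q a) = a - 1 \<and> lead_coeff (q a) = 1"
  shows "(\<Sum>p | p permutes {1..n}. of_int (sign p) * (\<Prod>a=1..n. poly (q a) (x (p a)))) =
         (\<Prod>i=1..n. \<Prod>j\<in>{1..<i}. x i - x j)"
  using assms
proof (induction n)
  case 0
  then show ?case by simp
next
  case (Suc n)
  let ?S = "{1..Suc n}"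
  let ?c = "\<lambda>p. \<Prod>a=1..n. poly (q a) (x (p a))"
  define L where "L f = (\<Sum>p | p permutes ?S. of_int (sign p) * poly f (x (p (Suc n))) *
      ?c p)" for f
  have L_add: "L (f + g) = L f + L g" for f g
    by (simp add: L_def algebra_simps sum.distrib)
  have L_smult: "L (smult c f) = c * L f" for c f
    by (simp add: L_def sum_distrib_left mult_ac)
  have L_column: "L (q b) = 0" if b: "b \<in> {1..n}" for b
  proof -
    let ?t = "Transposition.transpose b (Suc n)"
    have tt: "?t permutes ?S"
      using b by (intro permutes_swap_id) auto
    define F where "F p = of_int (sign p) * poly (q b) (x (p (Suc n))) *
       ?c p" for p
    have "F (p \<circ> ?t) = - F p" if "p permutes ?S" for p
    proof -
      have "permutation p" "permutation ?t"
        using that tt permutes_imp_permutation by blast+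
      then have "sign (p \<circ> ?t) = - sign p"
        using b by (simp add: sign_compose sign_swap_id)
      moreover have "(\<Prod>a=1..n. poly (q a) (x (r a))) =
          poly (q b) (x (r b)) * (\<Prod>a\<in>{1..n}-{b}. poly (q a) (x (r a)))" for r
        using b by (subst prod.remove[of _ b]) auto
      moreover have "(\<Prod>a\<in>{1..n}-{b}. poly (q a) (x ((p \<circ> ?t) a))) = (\<Prod>a\<in>{1..n}-{b}. poly (q a) (x (p a)))"
        by (rule prod.cong) (auto simp: Transposition.transpose_def)
      ultimately show ?thesis by (simp add: F_def mult_ac)
    qed
    then have "(\<Sum>p | p permutes ?S. F p) = (\<Sum>p | p permutes ?S. - F p)"
      by (subst sum_permutations_compose_right[OF tt]) (auto intro: sum.cong)
    then have "L (q b) = - L (q b)" unfolding L_def F_def sum_negf .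
    then have "2 * L (q b) = 0" by (metis add.right_inverse mult_2)
    then show ?thesis by simp
  qed
  have L_low: "L f = 0" if "degree f < d" "d \<le> n" for f d
    using that
  proof (induction d arbitrary: f)
    case (Suc d)
    have deg: "degree (q (Suc d)) = d" "lead_coeff (q (Suc d)) = 1"
      using Suc.prems(2) \<open>\<And>a. a \<in> {1..Suc n} \<Longrightarrow> _\<close>[of "Suc d"] by auto
    define c where "c = coeff f d"
    have "L (f - smult c (q (Suc d))) = 0"
    \<comment> \<open>A degree cannot drop below 0, so the case \<open>d = 0\<close> is separate:
      there the difference is the zero polynomial itself.\<close>
    proof (cases "d = 0")
      case True
      then have "f = [:c:]" "q (Suc d) = [:1:]"
        using Suc.prems(1) deg by (auto simp: c_def elim!: degree_eq_zeroE)
      then show ?thesis by (simp add: L_def)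
    next
      case False
      have "degree (f - smult c (q (Suc d))) < d"
      proof (rule degree_lessI)
        show "f - smult c (q (Suc d)) \<noteq> 0 \<or> d > 0" using False by simp
        show "\<forall>k\<ge>d. coeff (f - smult c (q (Suc d))) k = 0"
        proof (intro allI impI)
          fix k assume "d \<le> k"
          show "coeff (f - smult c (q (Suc d))) k = 0"
          proof (cases "k = d")
            case True
            then show ?thesis using deg by (simp add: c_def)
          next
            case False
            with \<open>d \<le> k\<close> Suc.prems(1) deg(1) show ?thesis by (simp add: coeff_eq_0)
          qed
        qed
      qed
      then show ?thesis using Suc.IH Suc.prems(2) by simp
    qed
    then have "L (f - smult c (q (Suc d)) + smult c (q (Suc d))) = 0"
      using Suc.prems(2) L_column[of "Suc d"] by (simp only: L_add L_smult) simp
    then show ?case by simp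
  qed simp
  define g where "g = (\<Prod>j=1..n. [:- x j, 1:])"
  have "degree g = n"
    unfolding g_def by (simp add: degree_prod_eq_sum_degree)
  moreover have "lead_coeff g = (\<Prod>j=1..n. lead_coeff [:- x j, 1:])"
    unfolding g_def by (rule lead_coeff_prod)
  ultimately have g: "degree g = n" "lead_coeff g = 1" by simp_all
  have qn: "degree (q (Suc n)) = n" "lead_coeff (q (Suc n)) = 1"
    using Suc.prems[of "Suc n"] by auto
  have "L (q (Suc n) - g) = 0"
  proof (cases "n = 0")
    case True
    then have "q (Suc n) - g = 0"
      using g qn by (auto elim!: degree_eq_zeroE)
    then show ?thesis by (simp add: L_def)
  next
    case False
    have "degree (q (Suc n) - g) < n"
      using False g qn by (intro degree_lessI) (auto simp: coeff_eq_0 le_less)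
    then show ?thesis using L_low[of _ n] by simp
  qed
  then have "L (q (Suc n)) = L g"
    using L_add[of "q (Suc n) - g" g] by simp
  also have "\<dots> = (\<Sum>p | p permutes {1..n}. of_int (sign p) * poly g (x (p (Suc n))) *
      ?c p)"
  proof -
    have ins: "{1..Suc n} = insert (Suc n) {1..n}" by auto
    show ?thesis
      unfolding L_def ins
    proof (rule sum_permutes_fix_point)
      fix p assume p: "p permutes insert (Suc n) {1..n}" "p (Suc n) \<noteq> Suc n"
      then have "p (Suc n) \<in> {1..n}" using permutes_in_image[OF p(1), of "Suc n"] by auto
      then have "poly g (x (p (Suc n))) = 0"
        unfolding g_def poly_prod by (intro prod_zero) auto
      then show "of_int (sign p) * poly g (x (p (Suc n))) * ?c p = 0" by simp
    qed auto
  qed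
  also have "\<dots> = (\<Sum>p | p permutes {1..n}. poly g (x (Suc n)) *
      (of_int (sign p) * ?c p))"
    by (rule sum.cong) (auto simp: permutes_not_in mult_ac)
  also have "\<dots> = poly g (x (Suc n)) * (\<Prod>i=1..n. \<Prod>j\<in>{1..<i}. x i - x j)"
  proof -
    have "degree (q a) = a - 1 \<and> lead_coeff (q a) = 1" if "a \<in> {1..n}" for a
      by (rule Suc.prems) (use that in auto)
    then show ?thesis unfolding sum_distrib_left[symmetric] by (subst Suc.IH) blast+
  qed
  also have "poly g (x (Suc n)) = (\<Prod>j\<in>{1..<Suc n}. x (Suc n) - x j)"
    unfolding g_def poly_prod by (rule prod.cong) auto
  finally have "L (q (Suc n)) = (\<Prod>i=1..Suc n. \<Prod>j\<in>{1..<i}. x i - x j)"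
    by (simp add: mult.commute)
  moreover have "L (q (Suc n)) = (\<Sum>p | p permutes ?S. of_int (sign p) * (\<Prod>a\<in>?S. poly (q a) (x (p a))))"
    by (simp add: L_def mult_ac)
  ultimately show ?case by simp
qed

text \<open>The transposed determinant: the permutation now selects the polynomial and not the node,
  so that each term is a product over nodes and can be integrated particle by particle.\<close>

lemma vandermonde_monic:
  fixes q :: "nat \<Rightarrow> 'a::field_char_0 poly"
  assumes "\<And>a. a \<in> {1..n} \<Longrightarrow> degree (q a) = a - 1 \<and> lead_coeff (q a) = 1"
  shows "(\<Sum>p | p permutes {1..n}. of_int (sign p) * (\<Prod>i=1..n. poly (q (p i)) (x i))) =
         (\<Prod>i=1..n. \<Prod>j\<in>{1..<i}. x i - x j)"
proof -
  have "(\<Sum>p | p permutes {1..n}. of_int (sign p) * (\<Prod>i=1..n. poly (q (p i)) (x i)))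
      = (\<Sum>p | p permutes {1..n}. of_int (sign (inv p)) * (\<Prod>i=1..n. poly (q (inv p i)) (x i)))"
    by (rule sum_permutations_inverse)
  also have "\<dots> = (\<Sum>p | p permutes {1..n}. of_int (sign p) * (\<Prod>a=1..n. poly (q a) (x (p a))))"
  proof (rule sum.cong[OF refl])
    fix p assume "p \<in> {p. p permutes {1..n}}"
    then have p: "p permutes {1..n}" by simp
    then have "permutation p" by (auto intro: permutes_imp_permutation[rotated])
    moreover have "(\<Prod>i=1..n. poly (q (inv p i)) (x i)) = (\<Prod>a=1..n. poly (q a) (x (p a)))"
      by (subst prod.permute[OF p]) (simp add: permutes_inverses[OF p])
    ultimately show "of_int (sign (inv p)) * (\<Prod>i=1..n. poly (q (inv p i)) (x i)) =
      of_int (sign p) * (\<Prod>a=1..n. poly (q a) (x (p a)))"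
      by (simp add: sign_inverse)
  qed
  also have "\<dots> = (\<Prod>i=1..n. \<Prod>j\<in>{1..<i}. x i - x j)"
    by (rule vandermonde_monic_columns[OF assms])
  finally show ?thesis .
qed

text \<open>The list \<open>\<zeta> 1, cnj (\<zeta> 1), \<zeta> 2, cnj (\<zeta> 2), ...\<close>. Its
  numbering agrees with that of \<open>block_matrix\<close>, so a kernel evaluated at doubled nodes
  is the block matrix of the Pfaffian.\<close>

definition doubled :: "(nat \<Rightarrow> complex) \<Rightarrow> nat \<Rightarrow> complex" where
  "doubled \<zeta> i = (if odd i then \<zeta> ((i + 1) div 2) else cnj (\<zeta> (i div 2)))"

lemma doubled_even [simp]: "doubled \<zeta> (2 * j) = cnj (\<zeta> j)"
  by (simp add: doubled_def)

lemma doubled_odd: "1 \<le> j \<Longrightarrow> doubled \<zeta> (2 * j - 1) = \<zeta> j"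
  by (cases j) (simp_all add: doubled_def)

lemma norm_diff_cnj_squared:
  "complex_of_real ((cmod (z - w))\<^sup>2 * (cmod (z - cnj w))\<^sup>2) =
     (z - w) * (z - cnj w) * ((cnj z - w) * (cnj z - cnj w))"
  by (simp add: complex_norm_square mult_ac del: of_real_power)

text \<open>Appending \<open>\<zeta> j\<close> and its conjugate to the nodes contributes
  \<open>cnj (\<zeta> j) - \<zeta> j\<close> from within the pair and, by
  \<open>norm_diff_cnj_squared\<close>, exactly the interaction with all earlier particles. The
  squared modulus of \<open>\<zeta> j - cnj (\<zeta> j)\<close> splits into this factor and its
  negative; the latter stays outside and becomes part of the skew product.\<close>

lemma symplectic_weight_eq_vandermonde:
  "complex_of_real (symplectic_weight Q N \<zeta>) =
     (\<Prod>j=1..N. (\<zeta> j - cnj (\<zeta> j)) * boltzmann N (Q (\<zeta> j))) *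
     (\<Prod>i=1..2*N. \<Prod>j\<in>{1..<i}. doubled \<zeta> i - doubled \<zeta> j)"
proof -
  let ?x = "doubled \<zeta>"
  define A where "A j = (\<Prod>k\<in>{1..<j}. (cmod (\<zeta> j - \<zeta> k))\<^sup>2 * (cmod (\<zeta> j - cnj (\<zeta> k)))\<^sup>2)" for j
  have A: "complex_of_real (A (Suc n)) = (\<Prod>j=1..2*n. \<zeta> (Suc n) - ?x j) * (\<Prod>j=1..2*n. cnj (\<zeta> (Suc n)) - ?x j)" for n
    unfolding A_def of_real_prod norm_diff_cnj_squared prod_doubled_interval prod.distrib[symmetric]
    by (rule prod.cong) (auto simp: doubled_odd[simplified])
  have V: "(\<Prod>i=1..2*n. \<Prod>j\<in>{1..<i}. ?x i - ?x j) =
      (\<Prod>j=1..n. (cnj (\<zeta> j) - \<zeta> j) * complex_of_real (A j))" for n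
  proof (induction n)
    case (Suc n)
    have e1: "{1..2 * Suc n} = insert (2 * Suc n) (insert (2 * Suc n - 1) {1..2*n})" by auto
    have e2: "{1..<2 * Suc n} = insert (2 * Suc n - 1) {1..2*n}" by auto
    have e3: "{1..<2 * Suc n - 1} = {1..2*n}" by auto
    have xo: "?x (2 * Suc n - 1) = \<zeta> (Suc n)" by (rule doubled_odd) simp
    have "(\<Prod>i=1..2*Suc n. \<Prod>j\<in>{1..<i}. ?x i - ?x j) =
      (\<Prod>j\<in>{1..<2 * Suc n}. ?x (2 * Suc n) - ?x j) * ((\<Prod>j\<in>{1..<2 * Suc n - 1}. ?x (2 * Suc n - 1) - ?x j) *
       (\<Prod>i=1..2*n. \<Prod>j\<in>{1..<i}. ?x i - ?x j))"
      unfolding e1 by (subst prod.insert; (subst prod.insert)?) auto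
    also have "\<dots> = ((cnj (\<zeta> (Suc n)) - \<zeta> (Suc n)) * (\<Prod>j=1..2*n. cnj (\<zeta> (Suc n)) - ?x j)) *
        ((\<Prod>j=1..2*n. \<zeta> (Suc n) - ?x j) * (\<Prod>i=1..2*n. \<Prod>j\<in>{1..<i}. ?x i - ?x j))"
    proof -
      have "2 * Suc n - 1 \<notin> {1..2*n}" by simp
      then show ?thesis
        unfolding e2 e3 doubled_even
        by (simp only: prod.insert finite_atLeastAtMost xo not_False_eq_True)
    qed
    also have "\<dots> = (\<Prod>j=1..Suc n. (cnj (\<zeta> j) - \<zeta> j) * complex_of_real (A j))"
      using A[of n] Suc by (simp add: mult_ac)
    finally show ?case .
  qed simp
  have "complex_of_real (symplectic_weight Q N \<zeta>) =
     (\<Prod>j=1..N. complex_of_real (A j)) *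
     (\<Prod>j=1..N. complex_of_real ((cmod (\<zeta> j - cnj (\<zeta> j)))\<^sup>2) * complex_of_real (boltzmann N (Q (\<zeta> j))))"
    unfolding symplectic_weight_def A_def by simp
  also have "\<dots> = (\<Prod>j=1..N. (\<zeta> j - cnj (\<zeta> j)) * boltzmann N (Q (\<zeta> j))) *
      (\<Prod>j=1..N. (cnj (\<zeta> j) - \<zeta> j) * complex_of_real (A j))"
    unfolding prod.distrib[symmetric]
    by (rule prod.cong) (simp_all add: complex_norm_square mult_ac del: of_real_power)
  finally show ?thesis unfolding V .
qed

section \<open>Moments of the disk weight\<close>

lemma lborel_complex_eq_distr:
  "distr (lborel \<Otimes>\<^sub>M lborel) borel (\<lambda>(x, y). Complex x y) = lborel"
proof (rule lborel_eqI[symmetric])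
  fix l u :: complex
  assume le: "\<And>b. b \<in> Basis \<Longrightarrow> l \<bullet> b \<le> u \<bullet> b"
  have le': "Re l \<le> Re u" "Im l \<le> Im u"
    using le[of 1] le[of \<i>] by (simp_all add: Basis_complex_def)
  have [measurable]: "(\<lambda>(x, y). Complex x y) \<in> borel_measurable (lborel \<Otimes>\<^sub>M lborel)"
    by (simp add: Complex_eq)
  have "(\<lambda>(x, y). Complex x y) -` box l u \<inter> space (lborel \<Otimes>\<^sub>M lborel) = {Re l<..<Re u} \<times> {Im l<..<Im u}"
    by (auto simp: box_def Basis_complex_def space_pair_measure)
  then have "emeasure (distr (lborel \<Otimes>\<^sub>M lborel) borel (\<lambda>(x, y). Complex x y)) (box l u) =
      emeasure (lborel \<Otimes>\<^sub>M lborel) ({Re l<..<Re u} \<times> {Im l<..<Im u})"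
    by (subst emeasure_distr) auto
  also have "\<dots> = emeasure lborel {Re l<..<Re u} * emeasure lborel {Im l<..<Im u}"
    by (rule lborel.emeasure_pair_measure_Times) auto
  also have "\<dots> = (\<Prod>b\<in>Basis. (u - l) \<bullet> b)"
    using le' by (simp add: Basis_complex_def ennreal_mult'[symmetric] del: Complex_eq)
  finally show "emeasure (distr (lborel \<Otimes>\<^sub>M lborel) borel (\<lambda>(x, y). Complex x y)) (box l u) =
      (\<Prod>b\<in>Basis. (u - l) \<bullet> b)" .
qed simp

lemma measurable_Complex [measurable (raw)]:
  "f \<in> borel_measurable M \<Longrightarrow> g \<in> borel_measurable M \<Longrightarrow> (\<lambda>x. Complex (f x) (g x)) \<in> borel_measurable M"
  by (simp add: Complex_eq)

lemma nn_integral_lborel_complex: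
  fixes f :: "complex \<Rightarrow> ennreal"
  assumes [measurable]: "f \<in> borel_measurable borel"
  shows "(\<integral>\<^sup>+z. f z \<partial>lborel) = (\<integral>\<^sup>+x. \<integral>\<^sup>+y. f (Complex x y) \<partial>lborel \<partial>lborel)"
    and "(\<integral>\<^sup>+z. f z \<partial>lborel) = (\<integral>\<^sup>+y. \<integral>\<^sup>+x. f (Complex x y) \<partial>lborel \<partial>lborel)"
proof -
  have "(\<integral>\<^sup>+z. f z \<partial>lborel) = (\<integral>\<^sup>+z. f z \<partial>distr (lborel \<Otimes>\<^sub>M lborel) borel (\<lambda>p. Complex (fst p) (snd p)))"
    using lborel_complex_eq_distr by (simp add: case_prod_beta')
  also have "\<dots> = (\<integral>\<^sup>+p. f (Complex (fst p) (snd p)) \<partial>(lborel \<Otimes>\<^sub>M lborel))"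
    by (rule nn_integral_distr) measurable
  finally have *: "(\<integral>\<^sup>+z. f z \<partial>lborel) = (\<integral>\<^sup>+p. f (Complex (fst p) (snd p)) \<partial>(lborel \<Otimes>\<^sub>M lborel))" .
  have meas: "(\<lambda>p. f (Complex (fst p) (snd p))) \<in> borel_measurable (lborel \<Otimes>\<^sub>M lborel)"
    by measurable
  show "(\<integral>\<^sup>+z. f z \<partial>lborel) = (\<integral>\<^sup>+x. \<integral>\<^sup>+y. f (Complex x y) \<partial>lborel \<partial>lborel)"
    unfolding * using lborel.nn_integral_fst[OF meas] by simp
  show "(\<integral>\<^sup>+z. f z \<partial>lborel) = (\<integral>\<^sup>+y. \<integral>\<^sup>+x. f (Complex x y) \<partial>lborel \<partial>lborel)"
    unfolding * using lborel_pair.nn_integral_snd[OF meas] by simp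
qed

lemma nn_integral_complex_shear_Re:
  fixes f :: "complex \<Rightarrow> ennreal"
  assumes [measurable]: "f \<in> borel_measurable borel"
  shows "(\<integral>\<^sup>+z. f (Complex (Re z + a * Im z) (Im z)) \<partial>lborel) = (\<integral>\<^sup>+z. f z \<partial>lborel)"
proof -
  have "(\<integral>\<^sup>+x. f (Complex (x + a * y) y) \<partial>lborel) = (\<integral>\<^sup>+x. f (Complex x y) \<partial>lborel)" for y
    using nn_integral_real_affine[of "\<lambda>x. f (Complex x y)" 1 "a * y"] by (simp add: add.commute)
  then show ?thesis by (simp add: nn_integral_lborel_complex(2))
qed

lemma nn_integral_complex_shear_Im:
  fixes f :: "complex \<Rightarrow> ennreal"
  assumes [measurable]: "f \<in> borel_measurable borel"
  shows "(\<integral>\<^sup>+z. f (Complex (Re z) (Im z + a * Re z)) \<partial>lborel) = (\<integral>\<^sup>+z. f z \<partial>lborel)"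
proof -
  have "(\<integral>\<^sup>+y. f (Complex x (y + a * x)) \<partial>lborel) = (\<integral>\<^sup>+y. f (Complex x y) \<partial>lborel)" for x
    using nn_integral_real_affine[of "\<lambda>y. f (Complex x y)" 1 "a * x"] by (simp add: add.commute)
  then show ?thesis by (simp add: nn_integral_lborel_complex(1))
qed

text \<open>A rotation is a product of three shears.\<close>

lemma nn_integral_complex_rotate:
  fixes f :: "complex \<Rightarrow> ennreal"
  assumes [measurable]: "f \<in> borel_measurable borel" and "cos (\<theta> / 2) \<noteq> 0"
  shows "(\<integral>\<^sup>+z. f (cis \<theta> * z) \<partial>lborel) = (\<integral>\<^sup>+z. f z \<partial>lborel)"
proof -
  \<comment> \<open>The composition of the shears with parameters \<open>t\<close>,
    \<open>s\<close>, \<open>t\<close> has lower left entry \<open>s\<close> and both diagonal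
    entries \<open>1 + t * s\<close>; comparison with the rotation matrix gives
    \<open>s = sin \<theta>\<close> and \<open>t = - tan (\<theta> / 2)\<close>.\<close>
  define t where "t = - tan (\<theta> / 2)"
  define s where "s = sin \<theta>"
  have s: "s = 2 * sin (\<theta>/2) * cos (\<theta>/2)"
    unfolding s_def using sin_double[of "\<theta>/2"] by simp
  have c: "cos \<theta> = 1 - 2 * (sin (\<theta>/2))\<^sup>2" "cos \<theta> = 2 * (cos (\<theta>/2))\<^sup>2 - 1"
    using cos_double_sin[of "\<theta>/2"] cos_double_cos[of "\<theta>/2"] by simp_all
  have t: "t * cos (\<theta>/2) = - sin (\<theta>/2)"
    using assms(2) by (simp add: t_def tan_def)
  have "t * s = 2 * sin (\<theta>/2) * (t * cos (\<theta>/2))" by (simp add: s)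
  then have ts: "1 + t * s = cos \<theta>"
    unfolding c(1) t by (simp add: power2_eq_square)
  have "t * (1 + cos \<theta>) = 2 * cos (\<theta>/2) * (t * cos (\<theta>/2))"
    unfolding c(2) by (simp add: power2_eq_square)
  then have "t * (1 + cos \<theta>) = - s" unfolding t s by simp
  then have ts': "t + t * (1 + t * s) = - s" unfolding ts by (simp add: algebra_simps)
  define g where "g z = f (Complex (Re z + t * Im z) (Im z))" for z
  define h where "h z = g (Complex (Re z) (Im z + s * Re z))" for z
  have [measurable]: "g \<in> borel_measurable borel" unfolding g_def[abs_def] by measurable
  have [measurable]: "h \<in> borel_measurable borel" unfolding h_def[abs_def] by measurable
  have "f (cis \<theta> * z) = h (Complex (Re z + t * Im z) (Im z))" for z
  proof -
    have "Re z + t * Im z + t * (Im z + s * (Re z + t * Im z)) =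
        Re z * (1 + t * s) + Im z * (t + t * (1 + t * s))" by (simp add: algebra_simps)
    also have "\<dots> = cos \<theta> * Re z - sin \<theta> * Im z"
      unfolding ts' unfolding ts by (simp add: s_def mult_ac)
    finally have re: "Re z + t * Im z + t * (Im z + s * (Re z + t * Im z)) = cos \<theta> * Re z - sin \<theta> * Im z" .
    have "Im z + s * (Re z + t * Im z) = s * Re z + (1 + t * s) * Im z" by (simp add: algebra_simps)
    then have im: "Im z + s * (Re z + t * Im z) = sin \<theta> * Re z + cos \<theta> * Im z"
      by (simp only: ts) (simp only: s_def)
    have "cis \<theta> * z = Complex (cos \<theta> * Re z - sin \<theta> * Im z) (sin \<theta> * Re z + cos \<theta> * Im z)"
      by (simp add: complex_eq_iff)
    then show ?thesis unfolding h_def g_def by (simp only: complex.sel im re[unfolded im])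
  qed
  then have "(\<integral>\<^sup>+z. f (cis \<theta> * z) \<partial>lborel) = (\<integral>\<^sup>+z. h z \<partial>lborel)"
    by (simp add: nn_integral_complex_shear_Re)
  also have "\<dots> = (\<integral>\<^sup>+z. g z \<partial>lborel)"
    unfolding h_def by (rule nn_integral_complex_shear_Im) measurable
  also have "\<dots> = (\<integral>\<^sup>+z. f z \<partial>lborel)"
    unfolding g_def by (rule nn_integral_complex_shear_Re) measurable
  finally show ?thesis .
qed

lemma lborel_distr_rotate:
  assumes "cos (\<theta> / 2) \<noteq> 0"
  shows "distr lborel borel (\<lambda>z. cis \<theta> * z) = lborel"
proof (rule measure_eqI)
  fix A :: "complex set" assume "A \<in> sets (distr lborel borel (\<lambda>z. cis \<theta> * z))"
  then have [measurable]: "A \<in> sets borel" by simp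
  have "emeasure (distr lborel borel (\<lambda>z. cis \<theta> * z)) A = (\<integral>\<^sup>+z. indicator A z \<partial>distr lborel borel (\<lambda>z. cis \<theta> * z))"
    by simp
  also have "\<dots> = (\<integral>\<^sup>+z. indicator A (cis \<theta> * z) \<partial>lborel)"
    by (rule nn_integral_distr) measurable
  also have "\<dots> = emeasure lborel A"
    using assms by (subst nn_integral_complex_rotate) simp_all
  finally show "emeasure (distr lborel borel (\<lambda>z. cis \<theta> * z)) A = emeasure lborel A" .
qed simp

lemma sets_dA [simp, measurable_cong]: "sets dA = sets borel"
  by (simp add: dA_def)

lemma space_dA [simp]: "space dA = UNIV"
  by (simp add: dA_def)

lemma integral_dA:
  fixes f :: "complex \<Rightarrow> 'b::{banach, second_countable_topology}"
  assumes "f \<in> borel_measurable borel"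
  shows "(\<integral>z. f z \<partial>dA) = (1 / pi) *\<^sub>R (\<integral>z. f z \<partial>lborel)"
  using assms unfolding dA_def by (subst integral_density) auto

lemma emeasure_dA:
  assumes "A \<in> sets borel"
  shows "emeasure dA A = ennreal (1 / pi) * emeasure lborel A"
  using assms unfolding dA_def by (subst emeasure_density) (auto simp: nn_integral_cmult)

lemma indicator_cball_measurable_dA [measurable, simp]:
  "(indicator (cball c r) :: complex \<Rightarrow> ennreal) \<in> borel_measurable dA"
  "(indicator (cball c r) :: complex \<Rightarrow> real) \<in> borel_measurable dA"
  by (rule borel_measurable_indicator, simp)+

lemma sigma_finite_dA: "sigma_finite_measure dA"
  unfolding dA_def by (subst sigma_finite_measure.sigma_finite_iff_density_finite[OF sigma_finite_lborel]) auto

lemma integral_dA_rotate: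
  fixes f :: "complex \<Rightarrow> 'b::{banach, second_countable_topology}"
  assumes [measurable]: "f \<in> borel_measurable borel" and "cos (\<theta> / 2) \<noteq> 0"
  shows "(\<integral>z. f (cis \<theta> * z) \<partial>dA) = (\<integral>z. f z \<partial>dA)"
proof -
  have "(\<integral>z. f z \<partial>lborel) = (\<integral>z. f z \<partial>distr lborel borel (\<lambda>z. cis \<theta> * z))"
    using lborel_distr_rotate[OF assms(2)] by simp
  also have "\<dots> = (\<integral>z. f (cis \<theta> * z) \<partial>lborel)"
    by (rule integral_distr) measurable
  finally show ?thesis by (simp add: integral_dA)
qed

lemma emeasure_dA_cball:
  assumes "0 \<le> r"
  shows "emeasure dA (cball 0 r) = ennreal (r\<^sup>2)"
  using assms
  by (simp add: emeasure_dA emeasure_cball unit_ball_vol_2 ennreal_mult'[symmetric] del: cball_eq_atLeastAtMost)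

text \<open>The disk of radius \<open>sqrt x\<close> has \<open>dA\<close>-measure \<open>x\<close>,
  so the squared modulus is uniformly distributed; the normalisation by \<open>pi\<close> removes
  every constant. It suffices to compare the two measures on half-lines.\<close>

lemma distr_dA_norm_squared:
  assumes "0 \<le> R"
  shows "distr (density dA (indicator (cball 0 R))) borel (\<lambda>z. (cmod z)\<^sup>2) =
         density lborel (indicator {0..R\<^sup>2})" (is "?M = ?N")
proof (rule measure_eqI_lessThan)
  \<comment> \<open>For \<open>x < 0\<close> the removed ball degenerates to the origin, which has
    to be put back; it is a null set.\<close>
  have M: "emeasure ?M {x<..} = emeasure dA (cball 0 R - cball 0 (sqrt (max 0 x)) \<union> (if x < 0 then {0} else {}))" for x
  proof -
    have "emeasure ?M {x<..} = emeasure (density dA (indicator (cball 0 R))) {z. x < (cmod z)\<^sup>2}"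
      by (subst emeasure_distr) (auto simp: vimage_def)
    also have "\<dots> = emeasure dA (cball 0 R \<inter> {z. x < (cmod z)\<^sup>2})"
      by (subst emeasure_density) (auto simp flip: indicator_inter_arith intro!: nn_integral_indicator)
    also have "cball 0 R \<inter> {z. x < (cmod z)\<^sup>2} =
        cball 0 R - cball 0 (sqrt (max 0 x)) \<union> (if x < 0 then {0} else {})"
    proof (cases "x < 0")
      case True
      then have "x < (cmod z)\<^sup>2" for z
        using zero_le_power2[of "cmod z"] by linarith
      then have "{z. x < (cmod z)\<^sup>2} = UNIV" by blast
      moreover have "cball 0 (sqrt (max 0 x)) = {0 :: complex}" "0 \<in> cball (0::complex) R"
        using True assms by (simp_all add: max_def)
      moreover have "A = A - {0} \<union> {0}" if "0 \<in> A" for A :: "complex set"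
        using that by blast
      ultimately show ?thesis using True by (simp only: if_True Int_UNIV_right)
    next
      case False
      have "x < (cmod z)\<^sup>2 \<longleftrightarrow> sqrt x < cmod z" for z
        using real_sqrt_less_iff[of x "(cmod z)\<^sup>2"] by simp
      then have "{z. x < (cmod z)\<^sup>2} = {z. sqrt x < cmod z}" by blast
      also have "\<dots> = - cball 0 (sqrt x)" by auto
      finally have "cball 0 R \<inter> {z. x < (cmod z)\<^sup>2} = cball 0 R - cball 0 (sqrt x)" by blast
      moreover have "max 0 x = x" using False by simp
      ultimately show ?thesis using False by (simp only: if_False Un_empty_right)
    qed
    finally show ?thesis .
  qed
  have point: "emeasure dA {0} = 0" by (simp add: emeasure_dA)
  have M': "emeasure ?M {x<..} = ennreal (R\<^sup>2 - min (R\<^sup>2) (max 0 x))" for x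
  proof -
    have "emeasure ?M {x<..} = emeasure dA (cball 0 R - cball 0 (sqrt (max 0 x)))"
      unfolding M by (cases "x < 0") (simp_all only: if_True if_False Un_empty_right,
        intro emeasure_Un_null_set, auto simp: null_sets_def point)
    also have "\<dots> = ennreal (R\<^sup>2 - min (R\<^sup>2) (max 0 x))"
    proof (cases "sqrt (max 0 x) \<le> R")
      case True
      then have *: "max 0 x \<le> R\<^sup>2" by (rule sqrt_le_D)
      have "emeasure dA (cball 0 R - cball 0 (sqrt (max 0 x))) =
          emeasure dA (cball 0 R) - emeasure dA (cball 0 (sqrt (max 0 x)))"
        using True by (intro emeasure_Diff) (auto simp: emeasure_dA_cball)
      also have "\<dots> = ennreal (R\<^sup>2) - ennreal (max 0 x)"
        using assms by (simp add: emeasure_dA_cball)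
      finally show ?thesis by (simp add: ennreal_minus min.absorb2[OF *])
    next
      case False
      then have "cball 0 R - cball 0 (sqrt (max 0 x)) = ({} :: complex set)" by auto
      moreover have "R\<^sup>2 \<le> max 0 x"
        using False assms by (meson linear real_le_lsqrt not_le less_imp_le sqrt_le_D real_sqrt_le_iff real_sqrt_ge_zero
          max.cobounded1 real_le_rsqrt)
      ultimately show ?thesis by (simp only: emeasure_empty min.absorb1) simp
    qed
    finally show ?thesis .
  qed
  show "emeasure ?M {x<..} < \<infinity>" for x by (simp add: M')
  have N: "emeasure ?N {x<..} = ennreal (R\<^sup>2 - min (R\<^sup>2) (max 0 x))" for x
  proof -
    have "emeasure ?N {x<..} = emeasure lborel ({0..R\<^sup>2} \<inter> {x<..})"
      by (subst emeasure_density) (auto simp flip: indicator_inter_arith intro!: nn_integral_indicator)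
    also have "{0..R\<^sup>2} \<inter> {x<..} = (if x < 0 then {0..R\<^sup>2} else {x<..R\<^sup>2})" by auto
    also have "emeasure lborel \<dots> = ennreal (R\<^sup>2 - min (R\<^sup>2) (max 0 x))"
      by (auto simp: min_def max_def)
    finally show ?thesis .
  qed
  show "emeasure ?M {x<..} = emeasure ?N {x<..}" for x
    by (simp add: M' N)
qed simp_all

section \<open>The weight on the disk and its integrals against monomials\<close>

definition disk_weight :: "real \<Rightarrow> nat \<Rightarrow> complex \<Rightarrow> real" where
  "disk_weight R N \<zeta> = indicator (cball 0 R) \<zeta> * exp (- (real N * (cmod \<zeta>)\<^sup>2))"

text \<open>The integration variable is the squared modulus, so \<open>b\<close> is the square of
  the radius.\<close>

definition disk_moment :: "real \<Rightarrow> nat \<Rightarrow> nat \<Rightarrow> real" where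
  "disk_moment b N n = (\<integral>s. indicator {0..b} s * (s ^ n * exp (- (real N * s))) \<partial>lborel)"

lemma measurable_disk_weight [measurable]: "disk_weight R N \<in> borel_measurable borel"
  unfolding disk_weight_def[abs_def]
  by (intro borel_measurable_times borel_measurable_indicator borel_measurable_continuous_onI continuous_intros) auto

lemma integrable_disk_weight:
  fixes g :: "complex \<Rightarrow> complex"
  assumes "continuous_on UNIV g"
  shows "integrable dA (\<lambda>\<zeta>. g \<zeta> * disk_weight R N \<zeta>)"
proof -
  have [measurable]: "g \<in> borel_measurable borel"
    using assms by (rule borel_measurable_continuous_onI)
  have "compact (g ` cball 0 R)"
    using assms by (intro compact_continuous_image) (auto intro: continuous_on_subset)
  then obtain B where B: "\<And>z. z \<in> cball 0 R \<Longrightarrow> cmod (g z) \<le> B"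
    using compact_imp_bounded bounded_iff by (metis imageI)
  show ?thesis
  proof (rule integrableI_bounded_set[where A = "cball 0 R" and B = B])
    show "AE x in dA. x \<in> cball 0 R \<longrightarrow> cmod (g x * disk_weight R N x) \<le> B"
    proof (intro AE_I2 impI)
      fix x :: complex assume x: "x \<in> cball 0 R"
      have "cmod (g x * disk_weight R N x) \<le> B * 1"
        unfolding norm_mult using x by (intro mult_mono B) (auto simp: disk_weight_def intro: order_trans[OF norm_ge_zero B])
      then show "cmod (g x * disk_weight R N x) \<le> B" by simp
    qed
    show "AE x in dA. x \<notin> cball 0 R \<longrightarrow> g x * disk_weight R N x = 0"
      by (auto simp: disk_weight_def)
    show "emeasure dA (cball 0 R) < \<infinity>"
      by (cases "0 \<le> R") (simp_all add: emeasure_dA_cball)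
  qed auto
qed

text \<open>For \<open>a = b\<close> the integrand depends on the squared modulus only. For
  \<open>a \<noteq> b\<close> the rotation by \<open>pi / (2 * (a - b))\<close> multiplies the
  integrand by \<open>\<i>\<close> and preserves the integral, which is therefore 0; this angle is
  at most a quarter turn, so \<open>cos (\<theta> / 2)\<close> is positive as the rotation lemma
  demands.\<close>

lemma integral_disk_weight_monomial:
  assumes "0 \<le> R"
  shows "(\<integral>\<zeta>. \<zeta> ^ a * cnj \<zeta> ^ b * disk_weight R N \<zeta> \<partial>dA) =
         of_bool (a = b) * complex_of_real (disk_moment (R\<^sup>2) N a)"
proof (cases "a = b")
  case True
  let ?g = "\<lambda>s. s ^ a * exp (- (real N * s))"
  have "\<zeta> ^ a * cnj \<zeta> ^ b * disk_weight R N \<zeta> =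
      complex_of_real (indicator (cball 0 R) \<zeta> * ?g ((cmod \<zeta>)\<^sup>2))" for \<zeta>
    unfolding True[symmetric] power_mult_distrib[symmetric] complex_norm_square[symmetric]
    by (simp add: disk_weight_def)
  then have "(\<integral>\<zeta>. \<zeta> ^ a * cnj \<zeta> ^ b * disk_weight R N \<zeta> \<partial>dA) =
      complex_of_real (\<integral>\<zeta>. indicator (cball 0 R) \<zeta> * ?g ((cmod \<zeta>)\<^sup>2) \<partial>dA)"
    by (simp only: integral_complex_of_real)
  also have "(\<integral>\<zeta>. indicator (cball 0 R) \<zeta> * ?g ((cmod \<zeta>)\<^sup>2) \<partial>dA) =
      (\<integral>\<zeta>. ?g ((cmod \<zeta>)\<^sup>2) \<partial>density dA (indicator (cball 0 R)))"
    using integral_density[of "\<lambda>\<zeta>. ?g ((cmod \<zeta>)\<^sup>2)" dA "indicator (cball 0 R)"]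
    by (simp add: ennreal_indicator)
  also have "\<dots> = (\<integral>s. ?g s \<partial>distr (density dA (indicator (cball 0 R))) borel (\<lambda>z. (cmod z)\<^sup>2))"
    by (rule integral_distr[symmetric]) measurable
  also have "\<dots> = (\<integral>s. ?g s \<partial>density lborel (indicator {0..R\<^sup>2}))"
    unfolding distr_dA_norm_squared[OF assms] ..
  also have "\<dots> = disk_moment (R\<^sup>2) N a"
    using integral_density[of ?g lborel "indicator {0..R\<^sup>2}"]
    by (simp add: disk_moment_def ennreal_indicator)
  finally show ?thesis using True by simp
next
  case False
  let ?f = "\<lambda>\<zeta>. \<zeta> ^ a * cnj \<zeta> ^ b * disk_weight R N \<zeta>"
  define d where "d = real a - real b"
  define \<theta> where "\<theta> = pi / (2 * d)"
  have d: "d \<noteq> 0" "1 \<le> \<bar>d\<bar>" using False by (auto simp: d_def)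
  have [measurable]: "cnj \<in> borel_measurable borel"
    by (intro borel_measurable_continuous_onI continuous_intros)
  have "\<bar>\<theta>\<bar> \<le> pi / 2"
    using d by (simp add: \<theta>_def abs_mult field_simps)
  then have "cos (\<theta> / 2) > 0"
    using pi_gt_zero by (intro cos_gt_zero_pi) linarith+
  then have "(\<integral>\<zeta>. ?f \<zeta> \<partial>dA) = (\<integral>\<zeta>. ?f (cis \<theta> * \<zeta>) \<partial>dA)"
  proof (intro integral_dA_rotate[symmetric])
    show "?f \<in> borel_measurable borel" by measurable
  qed simp
  also have "(\<lambda>\<zeta>. ?f (cis \<theta> * \<zeta>)) = (\<lambda>\<zeta>. \<i> * ?f \<zeta>)"
  proof
    fix \<zeta>
    have "cis \<theta> ^ a * cnj (cis \<theta>) ^ b = cis (d * \<theta>)"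
    proof -
      have "cis \<theta> ^ a = cis (real a * \<theta>)" "cis (- \<theta>) ^ b = cis (real b * - \<theta>)"
        by (rule Complex.DeMoivre)+
      then show ?thesis unfolding cis_cnj by (simp only: cis_mult) (simp add: d_def algebra_simps)
    qed
    also have "\<dots> = \<i>"
      using d by (simp add: \<theta>_def complex_eq_iff)
    finally have "cis \<theta> ^ a * cnj (cis \<theta>) ^ b = \<i>" .
    moreover have "disk_weight R N (cis \<theta> * \<zeta>) = disk_weight R N \<zeta>"
      by (simp add: disk_weight_def norm_mult indicator_def)
    moreover have "?f (cis \<theta> * \<zeta>) = (cis \<theta> ^ a * cnj (cis \<theta>) ^ b) * (\<zeta> ^ a * cnj \<zeta> ^ b * disk_weight R N (cis \<theta> * \<zeta>))"
      by (simp add: power_mult_distrib mult_ac)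
    ultimately show "?f (cis \<theta> * \<zeta>) = \<i> * ?f \<zeta>" by simp
  qed
  also have "(\<integral>\<zeta>. \<i> * ?f \<zeta> \<partial>dA) = \<i> * (\<integral>\<zeta>. ?f \<zeta> \<partial>dA)"
    by (rule integral_mult_right_zero)
  finally have "(1 - \<i>) * (\<integral>\<zeta>. ?f \<zeta> \<partial>dA) = 0" by (simp add: algebra_simps)
  moreover have "1 - \<i> \<noteq> 0" by (simp add: complex_eq_iff)
  ultimately show ?thesis using False by simp
qed

section \<open>Skew-orthogonal polynomials\<close>

text \<open>The solution, normalised to 1 at \<open>l = m\<close>, of the two-term recursion
  \<open>skew_coeff_step\<close>, which expresses skew-orthogonality of \<open>skew_poly h m\<close>
  to the odd monomials of lower degree.\<close>

definition skew_coeff :: "(nat \<Rightarrow> real) \<Rightarrow> nat \<Rightarrow> nat \<Rightarrow> real" where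
  "skew_coeff h m l = (\<Prod>j\<in>{l..<m}. h (2 * j + 2) / h (2 * j + 1))"

definition skew_poly :: "(nat \<Rightarrow> real) \<Rightarrow> nat \<Rightarrow> complex poly" where
  "skew_poly h m = (\<Sum>l\<le>m. monom (complex_of_real (skew_coeff h m l)) (2 * l))"

text \<open>The index is shifted so that it runs over \<open>{1..2*N}\<close> like the positions
  being permuted: entry \<open>a\<close> is monic of degree \<open>a - 1\<close>, and
  \<open>2*m-1\<close>, \<open>2*m\<close> form the pair number \<open>m\<close>.\<close>

definition skew_basis :: "(nat \<Rightarrow> real) \<Rightarrow> nat \<Rightarrow> complex poly" where
  "skew_basis h a = (if odd a then skew_poly h ((a - 1) div 2) else monom 1 (a - 1))"

lemma coeff_skew_poly:
  "coeff (skew_poly h m) i = of_bool (even i \<and> i \<le> 2 * m) * complex_of_real (skew_coeff h m (i div 2))"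
proof -
  have "coeff (skew_poly h m) i = (\<Sum>l\<le>m. if 2 * l = i then complex_of_real (skew_coeff h m l) else 0)"
    by (simp add: skew_poly_def coeff_sum)
  also have "\<dots> = of_bool (even i \<and> i \<le> 2 * m) * complex_of_real (skew_coeff h m (i div 2))"
  proof (cases "even i")
    case True
    then obtain c where "i = 2 * c" by (metis dvdE)
    then show ?thesis by (simp add: sum.delta)
  next
    case False
    then have "2 * l \<noteq> i" for l by auto
    then show ?thesis using False by simp
  qed
  finally show ?thesis .
qed

lemma coeff_skew_poly_top [simp]: "coeff (skew_poly h m) (2 * m) = 1"
  by (simp add: coeff_skew_poly skew_coeff_def)

lemma poly_skew_poly:
  "poly (skew_poly h m) x = (\<Sum>l\<le>m. complex_of_real (skew_coeff h m l) * x ^ (2 * l))"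
  by (simp add: skew_poly_def poly_sum poly_monom)

lemma degree_skew_poly: "degree (skew_poly h m) = 2 * m"
  and lead_coeff_skew_poly: "lead_coeff (skew_poly h m) = 1"
proof -
  have "degree (skew_poly h m) \<le> 2 * m"
    by (intro degree_le) (auto simp: coeff_skew_poly)
  moreover note c = coeff_skew_poly_top[of h m]
  ultimately show "degree (skew_poly h m) = 2 * m"
    by (simp add: le_degree le_antisym)
  then show "lead_coeff (skew_poly h m) = 1" by (simp add: c)
qed

lemma skew_basis_monic:
  assumes "1 \<le> a"
  shows "degree (skew_basis h a) = a - 1" "lead_coeff (skew_basis h a) = 1"
  using assms
  by (auto simp: skew_basis_def degree_skew_poly lead_coeff_skew_poly degree_monom_eq simp del: One_nat_def elim!: oddE)

lemma skew_coeff_step: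
  assumes "l < m" "h (2 * l + 1) \<noteq> 0"
  shows "h (2 * l + 1) * skew_coeff h m l = h (2 * l + 2) * skew_coeff h m (Suc l)"
proof -
  have "{l..<m} = insert l {Suc l..<m}" using assms by auto
  then show ?thesis using assms(2) by (simp add: skew_coeff_def)
qed

lemma continuous_on_poly_cnj [continuous_intros]:
  "continuous_on S (\<lambda>z. poly p (cnj z))" for p :: "complex poly"
  by (rule continuous_on_poly) (intro continuous_intros)

lemma poly_as_sum_upto:
  fixes p :: "complex poly"
  assumes "degree p < D"
  shows "poly p x = (\<Sum>i<D. coeff p i * x ^ i)"
proof -
  have "poly p x = (\<Sum>i\<le>degree p. coeff p i * x ^ i)" by (rule poly_altdef)
  also have "\<dots> = (\<Sum>i<D. coeff p i * x ^ i)"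
    using assms by (intro sum.mono_neutral_left) (auto simp: coeff_eq_0)
  finally show ?thesis .
qed

lemma sum_sum_of_bool_Suc:
  fixes f :: "nat \<Rightarrow> nat \<Rightarrow> 'a::comm_ring_1"
  assumes "\<And>i j. D \<le> j \<Longrightarrow> f i j = 0"
  shows "(\<Sum>i<D. \<Sum>j<D. of_bool (Suc i = j) * f i j) = (\<Sum>i<D. f i (Suc i))"
proof (rule sum.cong[OF refl])
  fix i assume "i \<in> {..<D}"
  have "(\<Sum>j<D. of_bool (Suc i = j) * f i j) = (\<Sum>j<D. if j = Suc i then f i j else 0)"
    by (rule sum.cong) auto
  also have "\<dots> = f i (Suc i)"
    using assms[of "Suc i" i] by (auto simp: sum.delta not_less)
  finally show "(\<Sum>j<D. of_bool (Suc i = j) * f i j) = f i (Suc i)" .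
qed

text \<open>The factor \<open>\<zeta> - cnj \<zeta>\<close> raises one of the two degrees by one and
  radial orthogonality keeps only equal degrees, so just neighbouring coefficients interact. The
  strict degree bounds remove the boundary terms at index \<open>D\<close>.\<close>

lemma integral_skew_product:
  assumes "0 \<le> R" and "degree f < D" "degree g < D"
  shows "(\<integral>\<zeta>. poly f \<zeta> * poly g (cnj \<zeta>) * (\<zeta> - cnj \<zeta>) * disk_weight R N \<zeta> \<partial>dA) =
    (\<Sum>i<D. complex_of_real (disk_moment (R\<^sup>2) N (Suc i)) * (coeff f i * coeff g (Suc i) - coeff f (Suc i) * coeff g i))"
proof -
  let ?w = "disk_weight R N" and ?h = "\<lambda>n. complex_of_real (disk_moment (R\<^sup>2) N n)"
  have hb: "has_bochner_integral dA (\<lambda>\<zeta>. \<zeta> ^ a * cnj \<zeta> ^ b * ?w \<zeta>) (of_bool (a = b) * ?h a)" for a b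
    unfolding has_bochner_integral_iff
    by (intro conjI integral_disk_weight_monomial[OF assms(1)] integrable_disk_weight continuous_intros)
  have "poly f \<zeta> * poly g (cnj \<zeta>) * (\<zeta> - cnj \<zeta>) * ?w \<zeta> =
      (\<Sum>i<D. \<Sum>j<D. coeff f i * coeff g j *
        (\<zeta> ^ Suc i * cnj \<zeta> ^ j * ?w \<zeta> - \<zeta> ^ i * cnj \<zeta> ^ Suc j * ?w \<zeta>))" for \<zeta>
  proof -
    have "poly f \<zeta> * poly g (cnj \<zeta>) * (\<zeta> - cnj \<zeta>) * ?w \<zeta> =
       (\<Sum>i<D. \<Sum>j<D. (coeff f i * \<zeta> ^ i) * (coeff g j * cnj \<zeta> ^ j)) * (\<zeta> - cnj \<zeta>) * ?w \<zeta>"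
      unfolding poly_as_sum_upto[OF assms(2)] poly_as_sum_upto[OF assms(3)] sum_product ..
    also have "\<dots> = (\<Sum>i<D. \<Sum>j<D. (coeff f i * \<zeta> ^ i) * (coeff g j * cnj \<zeta> ^ j) * (\<zeta> - cnj \<zeta>) * ?w \<zeta>)"
      by (simp only: sum_distrib_right)
    also have "\<dots> = (\<Sum>i<D. \<Sum>j<D. coeff f i * coeff g j *
        (\<zeta> ^ Suc i * cnj \<zeta> ^ j * ?w \<zeta> - \<zeta> ^ i * cnj \<zeta> ^ Suc j * ?w \<zeta>))"
      by (intro sum.cong refl) (simp add: algebra_simps)
    finally show ?thesis .
  qed
  moreover have "has_bochner_integral dA (\<lambda>\<zeta>. \<Sum>i<D. \<Sum>j<D. coeff f i * coeff g j *
        (\<zeta> ^ Suc i * cnj \<zeta> ^ j * ?w \<zeta> - \<zeta> ^ i * cnj \<zeta> ^ Suc j * ?w \<zeta>))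
      (\<Sum>i<D. \<Sum>j<D. coeff f i * coeff g j *
        (of_bool (Suc i = j) * ?h (Suc i) - of_bool (i = Suc j) * ?h i))"
    by (intro has_bochner_integral_sum has_bochner_integral_mult_right has_bochner_integral_diff hb)
  ultimately have "(\<integral>\<zeta>. poly f \<zeta> * poly g (cnj \<zeta>) * (\<zeta> - cnj \<zeta>) * ?w \<zeta> \<partial>dA) =
      (\<Sum>i<D. \<Sum>j<D. coeff f i * coeff g j *
        (of_bool (Suc i = j) * ?h (Suc i) - of_bool (i = Suc j) * ?h i))"
    by (simp only: has_bochner_integral_integral_eq)
  also have "\<dots> = (\<Sum>i<D. \<Sum>j<D. of_bool (Suc i = j) * (coeff f i * coeff g j * ?h (Suc i)))
       - (\<Sum>i<D. \<Sum>j<D. of_bool (i = Suc j) * (coeff f i * coeff g j * ?h i))"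
    unfolding sum_subtractf[symmetric] by (intro sum.cong refl) (simp add: algebra_simps)
  also have "(\<Sum>i<D. \<Sum>j<D. of_bool (i = Suc j) * (coeff f i * coeff g j * ?h i)) =
      (\<Sum>j<D. \<Sum>i<D. of_bool (Suc j = i) * (coeff f i * coeff g j * ?h i))"
    by (subst sum.swap) (simp add: eq_commute)
  also have "\<dots> = (\<Sum>j<D. coeff f (Suc j) * coeff g j * ?h (Suc j))"
    using assms by (intro sum_sum_of_bool_Suc) (simp add: coeff_eq_0)
  also have "(\<Sum>i<D. \<Sum>j<D. of_bool (Suc i = j) * (coeff f i * coeff g j * ?h (Suc i))) =
      (\<Sum>i<D. coeff f i * coeff g (Suc i) * ?h (Suc i))"
    using assms by (intro sum_sum_of_bool_Suc) (simp add: coeff_eq_0)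
  finally show ?thesis
    by (simp add: sum_subtractf[symmetric] algebra_simps)
qed

text \<open>With \<open>c\<close> the coefficients of \<open>skew_poly h m\<close>, only
  \<open>h (2*n+1) * c (2*n) - h (2*n+2) * c (2*n+2)\<close> is left. It vanishes for
  \<open>n < m\<close> by \<open>skew_coeff_step\<close>, reduces to the leading coefficient for
  \<open>n = m\<close>, and for \<open>n > m\<close> both coefficients lie above the degree.\<close>

lemma skew_poly_monom_product:
  fixes h :: "nat \<Rightarrow> real"
  assumes h: "\<And>n. h n \<noteq> 0" and "2 * m < D" "2 * n + 1 < D"
  shows "(\<Sum>i<D. complex_of_real (h (Suc i)) *
      (coeff (skew_poly h m) i * coeff (monom 1 (2*n+1)) (Suc i) - coeff (skew_poly h m) (Suc i) * coeff (monom 1 (2*n+1)) i)) =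
    of_bool (m = n) * complex_of_real (h (2 * m + 1))"
proof -
  let ?c = "coeff (skew_poly h m)"
  have "(\<Sum>i<D. complex_of_real (h (Suc i)) *
      (?c i * coeff (monom 1 (2*n+1)) (Suc i) - ?c (Suc i) * coeff (monom 1 (2*n+1)) i)) =
     (\<Sum>i<D. (if i = 2*n then complex_of_real (h (2*n+1)) * ?c (2*n) else 0) -
       (if i = 2*n+1 then complex_of_real (h (2*n+2)) * ?c (2*n+2) else 0))"
    by (intro sum.cong refl) auto
  also have "\<dots> = complex_of_real (h (2*n+1)) * ?c (2*n) - complex_of_real (h (2*n+2)) * ?c (2*n+2)"
    using assms(2,3) by (simp add: sum_subtractf sum.delta)
  also have "\<dots> = of_bool (m = n) * complex_of_real (h (2 * m + 1))"
  proof (cases n m rule: linorder_cases)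
    case less
    then show ?thesis
      using skew_coeff_step[of n m h] h by (simp add: coeff_skew_poly flip: of_real_mult)
  next
    case equal
    then show ?thesis by (simp add: coeff_skew_poly skew_coeff_def)
  next
    case greater
    then show ?thesis by (simp add: coeff_skew_poly)
  qed
  finally show ?thesis .
qed

text \<open>The form \<open>J\<close> couples coefficients of opposite parity only, so two even or
  two odd polynomials are orthogonal; the mixed products are given by
  \<open>skew_poly_monom_product\<close> and, by skew symmetry, its negative.\<close>

lemma integral_skew_basis:
  assumes "0 \<le> R" and h: "\<And>n. disk_moment (R\<^sup>2) N n \<noteq> 0"
    and "a \<in> {1..2*M}" "b \<in> {1..2*M}"
  shows "(\<integral>\<zeta>. poly (skew_basis (disk_moment (R\<^sup>2) N) a) \<zeta> * poly (skew_basis (disk_moment (R\<^sup>2) N) b) (cnj \<zeta>) *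
             (\<zeta> - cnj \<zeta>) * disk_weight R N \<zeta> \<partial>dA) =
    (\<Sum>m=1..M. complex_of_real (disk_moment (R\<^sup>2) N (2 * m - 1)) *
       (of_bool (a = 2*m-1 \<and> b = 2*m) - of_bool (b = 2*m-1 \<and> a = 2*m)))" (is "?I a b = ?S a b")
proof -
  define h where "h = disk_moment (R\<^sup>2) N"
  let ?D = "2 * M + 1"
  have deg: "degree (skew_basis h c) < ?D" if "c \<in> {1..2*M}" for c
    using skew_basis_monic(1)[of c h] that by auto
  define J where "J f g = (\<Sum>i<?D. complex_of_real (h (Suc i)) *
      (coeff f i * coeff g (Suc i) - coeff f (Suc i) * coeff g i))" for f g
  have J_swap: "J f g = - J g f" for f g
    unfolding J_def sum_negf[symmetric] by (intro sum.cong refl) (simp add: algebra_simps)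
  have I: "?I a b = J (skew_basis h a) (skew_basis h b)"
    unfolding J_def h_def
    using assms deg[unfolded h_def] by (intro integral_skew_product) auto
  have eo: "J (skew_poly h m) (monom 1 (2*n+1)) = of_bool (m = n) * complex_of_real (h (2 * m + 1))"
    if "m < M" "n < M" for m n
    unfolding J_def using h that by (intro skew_poly_monom_product) (auto simp: h_def)
  have ee: "J (skew_poly h m) (skew_poly h n) = 0" for m n
    unfolding J_def by (intro sum.neutral) (simp add: coeff_skew_poly)
  have oo: "J (monom 1 (2*m+1)) (monom 1 (2*n+1)) = 0" for m n
    unfolding J_def by (intro sum.neutral) (auto; presburger)
  have cases: "\<exists>m<M. c = 2*m+1 \<and> skew_basis h c = skew_poly h m \<or> c = 2*m+2 \<and> skew_basis h c = monom 1 (2*m+1)"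
    if c: "c \<in> {1..2*M}" for c
  proof (cases "odd c")
    case True
    then obtain m where "c = 2*m+1" by (elim oddE)
    then show ?thesis using that by (auto simp: skew_basis_def intro!: exI[of _ m])
  next
    case False
    then obtain m' where "c = 2*m'" by (metis dvdE)
    then obtain m where "c = 2*m+2" using c by (cases m') auto
    then show ?thesis using that by (auto simp: skew_basis_def intro!: exI[of _ m])
  qed
  obtain m where m: "m < M" "a = 2*m+1 \<and> skew_basis h a = skew_poly h m \<or> a = 2*m+2 \<and> skew_basis h a = monom 1 (2*m+1)"
    using cases[OF assms(3)] by blast
  obtain n where n: "n < M" "b = 2*n+1 \<and> skew_basis h b = skew_poly h n \<or> b = 2*n+2 \<and> skew_basis h b = monom 1 (2*n+1)"
    using cases[OF assms(4)] by blast
  have S: "?S a b = (\<Sum>l<M. complex_of_real (h (2*l+1)) *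
       (of_bool (a = 2*l+1 \<and> b = 2*l+2) - of_bool (b = 2*l+1 \<and> a = 2*l+2)))"
    unfolding h_def
    by (simp only: One_nat_def sum.atLeast1_atMost_eq) (intro sum.cong refl, simp)
  \<comment> \<open>The single norm is written as a sum over \<open>l\<close> so that it can be
    matched with \<open>?S a b\<close> term by term.\<close>
  have J_delta: "of_bool (m = n) * complex_of_real (h (2 * m + 1)) =
      (\<Sum>l<M. if l = m then of_bool (m = n) * complex_of_real (h (2 * l + 1)) else 0)"
    using m(1) by simp
  have par: "2*l+1 \<noteq> 2*l'+2" "2*l'+2 \<noteq> 2*l+1" for l l' :: nat by presburger+
  from m(2) n(2) show ?thesis
  proof (elim disjE conjE)
    assume ab: "a = 2*m+1" "skew_basis h a = skew_poly h m" "b = 2*n+1" "skew_basis h b = skew_poly h n"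
    show ?thesis unfolding I S unfolding ab(2,4) ee unfolding ab(1,3)
      by (rule sum.neutral[symmetric]) (auto simp: Suc_double_not_eq_double double_not_eq_Suc_double)
  next
    assume ab: "a = 2*m+1" "skew_basis h a = skew_poly h m" "b = 2*n+2" "skew_basis h b = monom 1 (2*n+1)"
    show ?thesis unfolding I S unfolding ab(2,4) eo[OF m(1) n(1)] J_delta unfolding ab(1,3)
      by (intro sum.cong refl) (auto simp: par)
  next
    assume ab: "a = 2*m+2" "skew_basis h a = monom 1 (2*m+1)" "b = 2*n+1" "skew_basis h b = skew_poly h n"
    have "J (monom 1 (2*m+1)) (skew_poly h n) = - (of_bool (m = n) * complex_of_real (h (2 * m + 1)))"
      unfolding J_swap[of "monom 1 (2*m+1)"] eo[OF n(1) m(1)] by auto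
    also have "\<dots> = (\<Sum>l<M. - (if l = m then of_bool (m = n) * complex_of_real (h (2 * l + 1)) else 0))"
      unfolding sum_negf J_delta ..
    finally have Jmn: "J (monom 1 (2*m+1)) (skew_poly h n) = \<dots>" .
    show ?thesis unfolding I S unfolding ab(2,4) Jmn unfolding ab(1,3)
      by (intro sum.cong refl) (auto simp: par)
  next
    assume ab: "a = 2*m+2" "skew_basis h a = monom 1 (2*m+1)" "b = 2*n+2" "skew_basis h b = monom 1 (2*n+1)"
    show ?thesis unfolding I S unfolding ab(2,4) oo unfolding ab(1,3)
      by (rule sum.neutral[symmetric]) (auto simp: Suc_double_not_eq_double double_not_eq_Suc_double)
  qed
qed

section \<open>Correlation functions as Pfaffians\<close>

lemma symplectic_weight_expand:
  assumes Q: "\<And>\<zeta>. boltzmann N (Q \<zeta>) = disk_weight R N \<zeta>"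
  shows "complex_of_real (symplectic_weight Q N \<zeta>) =
    (\<Sum>p | p permutes {1..2*N}. of_int (sign p) *
       (\<Prod>j=1..N. poly (skew_basis h (p (2*j-1))) (\<zeta> j) * poly (skew_basis h (p (2*j))) (cnj (\<zeta> j)) *
          (\<zeta> j - cnj (\<zeta> j)) * disk_weight R N (\<zeta> j)))"
proof -
  have "complex_of_real (symplectic_weight Q N \<zeta>) =
     (\<Prod>j=1..N. (\<zeta> j - cnj (\<zeta> j)) * disk_weight R N (\<zeta> j)) *
     (\<Sum>p | p permutes {1..2*N}. of_int (sign p) * (\<Prod>i=1..2*N. poly (skew_basis h (p i)) (doubled \<zeta> i)))"
    unfolding symplectic_weight_eq_vandermonde Q
    by (subst vandermonde_monic) (use skew_basis_monic in auto)
  also have "\<dots> = (\<Sum>p | p permutes {1..2*N}. of_int (sign p) *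
       ((\<Prod>j=1..N. (\<zeta> j - cnj (\<zeta> j)) * disk_weight R N (\<zeta> j)) *
        (\<Prod>j=1..N. poly (skew_basis h (p (2*j-1))) (\<zeta> j) * poly (skew_basis h (p (2*j))) (cnj (\<zeta> j)))))"
    unfolding prod_doubled_interval sum_distrib_left
  proof (intro sum.cong refl)
    fix p
    have "(\<Prod>j=1..N. poly (skew_basis h (p (2*j-1))) (doubled \<zeta> (2*j-1)) * poly (skew_basis h (p (2*j))) (doubled \<zeta> (2*j))) =
        (\<Prod>j=1..N. poly (skew_basis h (p (2*j-1))) (\<zeta> j) * poly (skew_basis h (p (2*j))) (cnj (\<zeta> j)))"
      by (intro prod.cong refl) (simp only: doubled_odd doubled_even atLeastAtMost_iff)
    then show "(\<Prod>j=1..N. (\<zeta> j - cnj (\<zeta> j)) * disk_weight R N (\<zeta> j)) *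
        (of_int (sign p) * (\<Prod>j=1..N. poly (skew_basis h (p (2*j-1))) (doubled \<zeta> (2*j-1)) * poly (skew_basis h (p (2*j))) (doubled \<zeta> (2*j)))) =
        of_int (sign p) * ((\<Prod>j=1..N. (\<zeta> j - cnj (\<zeta> j)) * disk_weight R N (\<zeta> j)) *
        (\<Prod>j=1..N. poly (skew_basis h (p (2*j-1))) (\<zeta> j) * poly (skew_basis h (p (2*j))) (cnj (\<zeta> j))))"
      by (simp only: mult_ac)
  qed
  finally show ?thesis
    unfolding prod.distrib[symmetric] by (simp only: mult_ac)
qed

text \<open>Every term is a product of functions of single particles, so its integral over the
  product measure factorises.\<close>

lemma integral_PiM_permutation_sum:
  fixes u :: "nat \<Rightarrow> nat \<Rightarrow> complex \<Rightarrow> complex"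
  assumes "finite (T :: nat set)" and "\<And>a b. integrable dA (u a b)"
  shows "has_bochner_integral (Pi\<^sub>M T (\<lambda>_. dA))
    (\<lambda>\<eta>. \<Sum>p\<in>P. c p * (\<Prod>j\<in>T. u (p (2*j-1)) (p (2*j)) (\<eta> j)))
    (\<Sum>p\<in>P. c p * (\<Prod>j\<in>T. \<integral>z. u (p (2*j-1)) (p (2*j)) z \<partial>dA))"
proof -
  interpret product_sigma_finite "\<lambda>_::nat. dA"
    by (simp add: product_sigma_finite_def sigma_finite_dA)
  show ?thesis
    using assms
    by (intro has_bochner_integral_sum has_bochner_integral_mult_right)
      (auto simp: has_bochner_integral_iff intro!: product_integrable_prod product_integral_prod)
qed

text \<open>Numerator and partition function are the same contracted sum, with \<open>k\<close>
  retained particles and with none. In the quotient the product of all norms and the factorials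
  cancel, and \<open>2 ^ (N - k) / 2 ^ N\<close> leaves the division by 2 for each retained
  particle.\<close>

theorem correlation_eq_pfaffian:
  fixes Q :: "complex \<Rightarrow> ereal" and N :: nat and R :: real
  defines "h \<equiv> disk_moment (R\<^sup>2) N"
  assumes "0 \<le> R" and "k \<le> N" and h: "\<And>n. h n \<noteq> 0"
    and Q: "\<And>\<zeta>. boltzmann N (Q \<zeta>) = disk_weight R N \<zeta>"
  shows "complex_of_real (correlation Q N k \<zeta>) =
    (\<Prod>j=1..k. (\<zeta> j - cnj (\<zeta> j)) * disk_weight R N (\<zeta> j) / 2) *
    pfaffian k (\<lambda>i i'. \<Sum>m=1..N.
      (poly (skew_basis h (2*m-1)) (doubled \<zeta> i) * poly (skew_basis h (2*m)) (doubled \<zeta> i') -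
       poly (skew_basis h (2*m)) (doubled \<zeta> i) * poly (skew_basis h (2*m-1)) (doubled \<zeta> i')) / h (2*m-1))"
proof -
  define u where "u a b z = poly (skew_basis h a) z * poly (skew_basis h b) (cnj z) * (z - cnj z) * disk_weight R N z" for a b z
  define I where "I a b = (\<integral>z. u a b z \<partial>dA)" for a b
  define X where "X i a = poly (skew_basis h a) (doubled \<zeta> i)" for i a
  define Pf where "Pf = pfaffian k (\<lambda>i i'. \<Sum>m=1..N. (X i (2*m-1) * X i' (2*m) - X i (2*m) * X i' (2*m-1)) / h (2*m-1))"
  define w where "w = (\<Prod>j=1..k. (\<zeta> j - cnj (\<zeta> j)) * disk_weight R N (\<zeta> j))"
  define r where "r = (\<Prod>m=1..N. complex_of_real (h (2*m-1)))"
  let ?P = "{p. p permutes {1..2*N}}"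
  have r: "r \<noteq> 0" unfolding r_def using h by (simp add: prod_zero_iff)
  have int: "integrable dA (u a b)" for a b
    unfolding u_def by (intro integrable_disk_weight continuous_intros)
  have W: "complex_of_real (symplectic_weight Q N \<eta>) =
      (\<Sum>p\<in>?P. of_int (sign p) * (\<Prod>j=1..N. u (p (2*j-1)) (p (2*j)) (\<eta> j)))" for \<eta>
    unfolding u_def by (rule symplectic_weight_expand[OF Q])
  have contract: "(\<Sum>p\<in>?P. of_int (sign p) * ((\<Prod>j=1..k'. Y (2*j-1) (p (2*j-1)) * Y (2*j) (p (2*j))) *
             (\<Prod>j=k'+1..N. I (p (2*j-1)) (p (2*j))))) =
         2 ^ (N - k') * fact (N - k') * r *
         pfaffian k' (\<lambda>i i'. \<Sum>m=1..N. (Y i (2*m-1) * Y i' (2*m) - Y i (2*m) * Y i' (2*m-1)) / h (2*m-1))"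
    if "k' \<le> N" for k' and Y :: "nat \<Rightarrow> nat \<Rightarrow> complex"
    unfolding r_def
  proof (rule sum_permutes_contraction)
    show "I a b = (\<Sum>m=1..N. complex_of_real (h (2*m-1)) *
        (of_bool (a = 2*m-1 \<and> b = 2*m) - of_bool (b = 2*m-1 \<and> a = 2*m)))"
      if "a \<in> {1..2*N}" "b \<in> {1..2*N}" for a b
      unfolding I_def u_def h_def
      by (rule integral_skew_basis) (use assms that in auto)
  qed (use that h in auto)
  have Z: "complex_of_real (partition_function Q N) = 2 ^ N * fact N * r"
  proof -
    have "complex_of_real (partition_function Q N) =
        (\<integral>\<eta>. (\<Sum>p\<in>?P. of_int (sign p) * (\<Prod>j=1..N. u (p (2*j-1)) (p (2*j)) (\<eta> j))) \<partial>Pi\<^sub>M {1..N} (\<lambda>_. dA))"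
      unfolding partition_function_def W[symmetric] by (rule integral_complex_of_real[symmetric])
    also have "\<dots> = (\<Sum>p\<in>?P. of_int (sign p) * (\<Prod>j=1..N. I (p (2*j-1)) (p (2*j))))"
      unfolding I_def using int
      by (intro has_bochner_integral_integral_eq integral_PiM_permutation_sum) auto
    also have "\<dots> = 2 ^ N * fact N * r"
      using contract[of 0] by (simp add: pfaffian_def)
    finally show ?thesis .
  qed
  have "complex_of_real (\<integral>\<eta>. symplectic_weight Q N (merge {1..k} {k+1..N} (\<zeta>, \<eta>)) \<partial>Pi\<^sub>M {k+1..N} (\<lambda>_. dA)) =
      (\<integral>\<eta>. (\<Sum>p\<in>?P. (of_int (sign p) * (\<Prod>j=1..k. u (p (2*j-1)) (p (2*j)) (\<zeta> j))) *
          (\<Prod>j=k+1..N. u (p (2*j-1)) (p (2*j)) (\<eta> j))) \<partial>Pi\<^sub>M {k+1..N} (\<lambda>_. dA))"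
  proof -
    have "complex_of_real (symplectic_weight Q N (merge {1..k} {k+1..N} (\<zeta>, \<eta>))) =
       (\<Sum>p\<in>?P. (of_int (sign p) * (\<Prod>j=1..k. u (p (2*j-1)) (p (2*j)) (\<zeta> j))) *
          (\<Prod>j=k+1..N. u (p (2*j-1)) (p (2*j)) (\<eta> j)))" for \<eta>
      unfolding W
    proof (intro sum.cong refl)
      fix p
      let ?f = "\<lambda>j. u (p (2*j-1)) (p (2*j)) (merge {1..k} {k+1..N} (\<zeta>, \<eta>) j)"
      have "(\<Prod>j=1..N. ?f j) = (\<Prod>j\<in>{1..k} \<union> {k+1..N}. ?f j)"
        using assms(3) by (intro prod.cong) auto
      also have "\<dots> = (\<Prod>j=1..k. ?f j) * (\<Prod>j=k+1..N. ?f j)"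
        by (rule prod.union_disjoint) auto
      also have "\<dots> = (\<Prod>j=1..k. u (p (2*j-1)) (p (2*j)) (\<zeta> j)) * (\<Prod>j=k+1..N. u (p (2*j-1)) (p (2*j)) (\<eta> j))"
        by (intro arg_cong2[where f = "(*)"] prod.cong) (auto simp: merge_def)
      finally show "of_int (sign p) * (\<Prod>j=1..N. ?f j) =
          (of_int (sign p) * (\<Prod>j=1..k. u (p (2*j-1)) (p (2*j)) (\<zeta> j))) *
          (\<Prod>j=k+1..N. u (p (2*j-1)) (p (2*j)) (\<eta> j))"
        by (simp only: mult.assoc)
    qed
    then show ?thesis by (simp only: integral_complex_of_real[symmetric])
  qed
  also have "\<dots> = (\<Sum>p\<in>?P. (of_int (sign p) * (\<Prod>j=1..k. u (p (2*j-1)) (p (2*j)) (\<zeta> j))) *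
          (\<Prod>j=k+1..N. I (p (2*j-1)) (p (2*j))))"
    unfolding I_def using int
    by (intro has_bochner_integral_integral_eq integral_PiM_permutation_sum) auto
  also have "\<dots> = w * (\<Sum>p\<in>?P. of_int (sign p) * ((\<Prod>j=1..k. X (2*j-1) (p (2*j-1)) * X (2*j) (p (2*j))) *
          (\<Prod>j=k+1..N. I (p (2*j-1)) (p (2*j)))))"
    unfolding sum_distrib_left
  proof (intro sum.cong refl)
    fix p
    have "(\<Prod>j=1..k. u (p (2*j-1)) (p (2*j)) (\<zeta> j)) =
        w * (\<Prod>j=1..k. X (2*j-1) (p (2*j-1)) * X (2*j) (p (2*j)))"
      unfolding w_def prod.distrib[symmetric] u_def X_def
      by (intro prod.cong refl) (simp only: doubled_odd doubled_even atLeastAtMost_iff, simp only: mult_ac)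
    then show "(of_int (sign p) * (\<Prod>j=1..k. u (p (2*j-1)) (p (2*j)) (\<zeta> j))) *
          (\<Prod>j=k+1..N. I (p (2*j-1)) (p (2*j))) =
        w * (of_int (sign p) * ((\<Prod>j=1..k. X (2*j-1) (p (2*j-1)) * X (2*j) (p (2*j))) *
          (\<Prod>j=k+1..N. I (p (2*j-1)) (p (2*j)))))"
      by (simp only: mult_ac)
  qed
  also have "\<dots> = w * (2 ^ (N - k) * fact (N - k) * r * Pf)"
    unfolding contract[OF assms(3)] Pf_def ..
  finally have "complex_of_real (correlation Q N k \<zeta>) =
      fact N / fact (N - k) * (w * (2 ^ (N - k) * fact (N - k) * r * Pf) / (2 ^ N * fact N * r))"
    unfolding correlation_def symplectic_density_def
    by (simp add: Z del: of_real_prod)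
  also have "\<dots> = w / 2 ^ k * Pf"
  proof -
    have "(2::complex) ^ N = 2 ^ (N - k) * 2 ^ k"
      using assms(3) by (simp flip: power_add)
    then show ?thesis using r by (simp add: field_simps)
  qed
  also have "w / 2 ^ k = (\<Prod>j=1..k. (\<zeta> j - cnj (\<zeta> j)) * disk_weight R N (\<zeta> j) / 2)"
    unfolding w_def prod_dividef by simp
  finally show ?thesis unfolding Pf_def X_def .
qed

section \<open>Moments at the hard edge\<close>

text \<open>The powers of \<open>1 + w\<close> and \<open>exp w\<close> differ by about
  \<open>n\<close> times the difference of the bases, which is quadratic in \<open>w\<close>. Since
  \<open>n * w\<close> stays bounded and \<open>w\<close> tends to 0, this error vanishes.\<close>

lemma power_tendsto_exp:
  fixes w :: "nat \<Rightarrow> complex" and n :: "nat \<Rightarrow> nat"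
  assumes w: "w \<longlonglongrightarrow> 0" and nw: "(\<lambda>i. of_nat (n i) * w i) \<longlonglongrightarrow> L"
  shows "(\<lambda>i. (1 + w i) ^ n i) \<longlonglongrightarrow> exp L"
proof -
  have bound: "cmod ((1 + w) ^ n - exp (of_nat n * w)) \<le> real n * (cmod w)\<^sup>2 * exp (cmod w) * exp (real n * cmod w)" for w n
  proof (cases n)
    case (Suc k)
    \<comment> \<open>Division by \<open>r\<close> brings both bases into the closed unit disk,
      where \<open>norm_power_diff\<close> applies.\<close>
    define r where "r = exp (cmod w)"
    have r: "r > 0" "1 \<le> r" by (simp_all add: r_def)
    have "cmod (1 + w) \<le> 1 + cmod w" by (metis norm_one norm_triangle_ineq)
    also have "\<dots> \<le> r" unfolding r_def by (rule exp_ge_add_one_self)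
    finally have a: "cmod ((1 + w) / of_real r) \<le> 1" using r by (simp add: norm_divide)
    have "cmod (exp w) \<le> r" unfolding r_def by (rule norm_exp)
    then have b: "cmod (exp w / of_real r) \<le> 1" using r by (simp add: norm_divide del: norm_exp_eq_Re)
    have "cmod (((1 + w) / of_real r) ^ n - (exp w / of_real r) ^ n) \<le> real n * cmod ((1 + w) / of_real r - exp w / of_real r)"
      by (rule norm_power_diff[OF a b])
    also have "(1 + w) / of_real r - exp w / of_real r = (1 + w - exp w) / of_real r" by (simp add: diff_divide_distrib)
    also have "((1 + w) / of_real r) ^ n - (exp w / of_real r) ^ n = ((1 + w) ^ n - exp w ^ n) / of_real r ^ n"
      by (simp add: power_divide diff_divide_distrib)
    finally have "cmod ((1 + w) ^ n - exp w ^ n) / r ^ n \<le> real n * (cmod (1 + w - exp w) / r)"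
      using r by (simp add: norm_divide norm_power)
    then have "cmod ((1 + w) ^ n - exp w ^ n) \<le> real n * cmod (1 + w - exp w) * (r ^ n / r)"
      using r by (simp add: field_simps)
    also have "\<dots> \<le> real n * (r * (cmod w)\<^sup>2) * r ^ n"
    proof (intro mult_mono)
      show "cmod (1 + w - exp w) \<le> r * (cmod w)\<^sup>2"
        using Taylor_exp_field[of w 1] by (simp add: r_def norm_minus_commute numeral_2_eq_2 mult_ac)
      show "r ^ n / r \<le> r ^ n" using r by (simp add: divide_le_eq)
    qed (use r in auto)
    also have "r ^ n = exp (real n * cmod w)" by (simp add: r_def exp_of_nat_mult)
    also have "exp w ^ n = exp (of_nat n * w)" by (rule exp_of_nat_mult[symmetric])
    finally show ?thesis by (simp only: r_def mult_ac)
  qed simp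
  have "(\<lambda>i. (1 + w i) ^ n i - exp (of_nat (n i) * w i)) \<longlonglongrightarrow> 0"
  proof (rule Lim_null_comparison)
    show "\<forall>\<^sub>F i in sequentially. cmod ((1 + w i) ^ n i - exp (of_nat (n i) * w i)) \<le>
        cmod (of_nat (n i) * w i) * cmod (w i) * exp (cmod (w i)) * exp (cmod (of_nat (n i) * w i))"
      using bound by (intro always_eventually allI) (simp add: norm_mult power2_eq_square mult_ac)
    have "(\<lambda>i. cmod (of_nat (n i) * w i) * cmod (w i) * exp (cmod (w i)) * exp (cmod (of_nat (n i) * w i)))
        \<longlonglongrightarrow> cmod L * cmod 0 * exp (cmod 0) * exp (cmod L)"
      by (intro tendsto_intros w nw)
    then show "(\<lambda>i. cmod (of_nat (n i) * w i) * cmod (w i) * exp (cmod (w i)) * exp (cmod (of_nat (n i) * w i))) \<longlonglongrightarrow> 0"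
      by simp
  qed
  then have "(\<lambda>i. ((1 + w i) ^ n i - exp (of_nat (n i) * w i)) + exp (of_nat (n i) * w i)) \<longlonglongrightarrow> 0 + exp L"
    by (intro tendsto_add tendsto_exp nw)
  then show ?thesis by simp
qed

lemma power_tendsto_exp_real:
  fixes w :: "nat \<Rightarrow> real" and n :: "nat \<Rightarrow> nat"
  assumes "w \<longlonglongrightarrow> 0" and "(\<lambda>i. real (n i) * w i) \<longlonglongrightarrow> L"
  shows "(\<lambda>i. (1 + w i) ^ n i) \<longlonglongrightarrow> exp L"
proof -
  have "(\<lambda>i. (1 + complex_of_real (w i)) ^ n i) \<longlonglongrightarrow> exp (complex_of_real L)"
    using tendsto_of_real[OF assms(1), where 'a = complex] tendsto_of_real[OF assms(2), where 'a = complex]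
    by (intro power_tendsto_exp) simp_all
  then have "(\<lambda>i. complex_of_real ((1 + w i) ^ n i)) \<longlonglongrightarrow> complex_of_real (exp L)"
    by (simp add: exp_of_real)
  then show ?thesis by (simp only: tendsto_of_real_iff)
qed

lemma one_over_filterlim_at_top:
  assumes "filterlim N at_top sequentially"
  shows "(\<lambda>i. 1 / real (N i)) \<longlonglongrightarrow> 0"
  by (intro tendsto_divide_0[OF tendsto_const] filterlim_at_top_imp_at_infinity
      filterlim_compose[OF filterlim_real_sequentially assms])

text \<open>The moments of \<open>exp (- N s)\<close> on \<open>{0..b}\<close>, normalised by the size of the integrand at the
  hard edge \<open>s = b\<close>.\<close>

definition edge_moment :: "real \<Rightarrow> nat \<Rightarrow> nat \<Rightarrow> real" where
  "edge_moment b N n = (\<integral>v. indicator {0..1} v * ((1 - v) ^ n * exp (real N * b * v)) \<partial>lborel)"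

lemma integrable_indicator_continuous:
  fixes f :: "real \<Rightarrow> 'a::{banach, second_countable_topology}"
  assumes "continuous_on {a..b} f"
  shows "integrable lborel (\<lambda>x. indicator {a..b} x *\<^sub>R f x)"
  using borel_integrable_compact[OF compact_Icc assms] by (simp add: indicator_scaleR_eq_if)

lemma integrable_edge_moment:
  "integrable lborel (\<lambda>v. indicator {0..1} v * ((1 - v) ^ n * exp (real N * b * v)))"
  using integrable_indicator_continuous[of 0 1 "\<lambda>v. (1 - v) ^ n * exp (real N * b * v)"]
  by (simp add: continuous_intros)

lemma disk_moment_eq_edge_moment:
  assumes "b > 0"
  shows "disk_moment b N n = b ^ (n + 1) * exp (- (real N * b)) * edge_moment b N n"
proof -
  let ?g = "\<lambda>v. indicator {0..b} (b + (- b) * v) * ((b + (- b) * v) ^ n * exp (- (real N * (b + (- b) * v))))"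
  let ?k = "\<lambda>v. (b ^ n * exp (- (real N * b))) * (indicator {0..1} v * ((1 - v) ^ n * exp (real N * b * v)))"
  have "disk_moment b N n = \<bar>- b\<bar> *\<^sub>R (\<integral>v. ?g v \<partial>lborel)"
    unfolding disk_moment_def by (rule lborel_integral_real_affine) (use assms in simp)
  also have "(\<lambda>v. ?g v) = (\<lambda>v. ?k v)"
  proof
    fix v
    have "b + (- b) * v = b * (1 - v)" by (simp add: algebra_simps)
    moreover have "indicator {0..b} (b * (1 - v)) = (indicator {0..1} v :: real)"
      using assms by (auto simp: indicator_def mult_le_cancel_left zero_le_mult_iff)
    moreover have "exp (- (real N * (b * (1 - v)))) = exp (- (real N * b)) * exp (real N * b * v)"
      by (simp add: algebra_simps flip: exp_add)
    ultimately show "?g v = ?k v"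
      by (simp add: power_mult_distrib)
  qed
  also have "(\<integral>v. ?k v \<partial>lborel) =
      (b ^ n * exp (- (real N * b))) * edge_moment b N n"
    unfolding edge_moment_def by (rule integral_mult_right_zero)
  finally show ?thesis using assms by simp
qed

text \<open>Dropping the exponential, which is at least 1 on the interval, leaves an elementary
  integral.\<close>

lemma edge_moment_ge:
  assumes "b \<ge> 0"
  shows "1 / (real n + 1) \<le> edge_moment b N n"
proof -
  have "((\<lambda>v::real. (1 - v) ^ n) has_integral 1 / (real n + 1)) {0..1}"
  proof -
    have "((\<lambda>v. - ((1 - v) ^ Suc n / real (Suc n))) has_vector_derivative (1 - v) ^ n) (at v within {0..1})" for v
      unfolding has_real_derivative_iff_has_vector_derivative[symmetric]
      by (rule derivative_eq_intros refl | simp del: power_Suc of_nat_Suc)+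
    then have "((\<lambda>v::real. (1 - v) ^ n) has_integral
        (- ((1 - 1) ^ Suc n / real (Suc n))) - (- ((1 - 0) ^ Suc n / real (Suc n)))) {0..1}"
      by (intro fundamental_theorem_of_calculus) auto
    then show ?thesis by (simp add: add.commute)
  qed
  moreover have "((\<lambda>v. (1 - v) ^ n * exp (real N * b * v)) has_integral edge_moment b N n) {0..1}"
  proof -
    have "(\<lambda>v. indicator {0..1} v * ((1 - v) ^ n * exp (real N * b * v))) =
        (\<lambda>v. if v \<in> {0..1} then (1 - v) ^ n * exp (real N * b * v) else 0)"
      by (auto simp: fun_eq_iff)
    then show ?thesis
      using has_integral_integral_lborel[OF integrable_edge_moment, of n N b]
      unfolding edge_moment_def[symmetric] by (simp only: has_integral_restrict_UNIV)
  qed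
  ultimately show ?thesis
  proof (rule has_integral_le)
    fix v :: real assume v: "v \<in> {0..1}"
    then have "1 \<le> exp (real N * b * v)" using assms by simp
    then show "(1 - v) ^ n \<le> (1 - v) ^ n * exp (real N * b * v)"
      using v by (intro mult_le_cancel_left1[THEN iffD2]) auto
  qed
qed

lemma edge_moment_pos:
  assumes "b \<ge> 0"
  shows "edge_moment b N n > 0"
  by (rule less_le_trans[OF _ edge_moment_ge[OF assms]]) simp

lemma edge_moment_decreasing:
  assumes "n \<le> m"
  shows "edge_moment b N m \<le> edge_moment b N n"
  unfolding edge_moment_def
proof (rule integral_mono[OF integrable_edge_moment integrable_edge_moment])
  fix v :: real
  show "indicator {0..1} v * ((1 - v) ^ m * exp (real N * b * v)) \<le> indicator {0..1} v * ((1 - v) ^ n * exp (real N * b * v))"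
    using assms by (auto simp: indicator_def intro!: mult_right_mono power_decreasing)
qed

text \<open>Cauchy-Schwarz: the integral of the weight of \<open>edge_moment b N n\<close> against
  \<open>(x - (1 - v))\<^sup>2\<close> is nonnegative for every \<open>x\<close>, and the chosen
  quotient of consecutive moments is the minimiser of this quadratic.\<close>

lemma edge_moment_log_convex:
  assumes "b \<ge> 0"
  shows "(edge_moment b N (Suc n))\<^sup>2 \<le> edge_moment b N n * edge_moment b N (Suc (Suc n))"
proof -
  let ?f = "\<lambda>n v. indicator {0..1} v * ((1 - v) ^ n * exp (real N * b * v))"
  let ?H = "edge_moment b N"
  define x where "x = ?H (Suc n) / ?H n"
  have pos: "?H n > 0" using edge_moment_pos[OF assms] .
  have "0 \<le> (\<integral>v. (x\<^sup>2 * ?f n v - 2 * x * ?f (Suc n) v) + ?f (Suc (Suc n)) v \<partial>lborel)"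
  proof (rule integral_nonneg_AE, intro AE_I2)
    fix v :: real
    have "(x\<^sup>2 * ?f n v - 2 * x * ?f (Suc n) v) + ?f (Suc (Suc n)) v = ?f n v * (x - (1 - v))\<^sup>2"
      by (simp add: power2_eq_square algebra_simps)
    also have "\<dots> \<ge> 0" by (auto simp: indicator_def)
    finally show "0 \<le> (x\<^sup>2 * ?f n v - 2 * x * ?f (Suc n) v) + ?f (Suc (Suc n)) v" .
  qed
  also have "\<dots> = (x\<^sup>2 * ?H n - 2 * x * ?H (Suc n)) + ?H (Suc (Suc n))"
  proof (rule has_bochner_integral_integral_eq)
    have hb: "has_bochner_integral lborel (?f m) (?H m)" for m
      unfolding edge_moment_def using integrable_edge_moment by (rule has_bochner_integral_integrable)
    show "has_bochner_integral lborel (\<lambda>v. (x\<^sup>2 * ?f n v - 2 * x * ?f (Suc n) v) + ?f (Suc (Suc n)) v)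
        ((x\<^sup>2 * ?H n - 2 * x * ?H (Suc n)) + ?H (Suc (Suc n)))"
      by (intro has_bochner_integral_add has_bochner_integral_diff has_bochner_integral_mult_right hb)
  qed
  finally have "0 \<le> (x\<^sup>2 * ?H n - 2 * x * ?H (Suc n) + ?H (Suc (Suc n))) * ?H n"
    using pos by simp
  also have "\<dots> = ?H n * ?H (Suc (Suc n)) - (?H (Suc n))\<^sup>2"
    using pos by (simp add: x_def power2_eq_square field_simps)
  finally show ?thesis by simp
qed

lemma edge_moment_scaled:
  assumes "N > 0"
  shows "real N * edge_moment b N n = (\<integral>v. indicator {0..real N} v * ((1 - v / real N) ^ n * exp (b * v)) \<partial>lborel)"
proof -
  have "(\<integral>v. indicator {0..real N} v * ((1 - v / real N) ^ n * exp (b * v)) \<partial>lborel) =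
     \<bar>real N\<bar> *\<^sub>R (\<integral>v. indicator {0..real N} (0 + real N * v) * ((1 - (0 + real N * v) / real N) ^ n * exp (b * (0 + real N * v))) \<partial>lborel)"
    by (rule lborel_integral_real_affine) (use assms in simp)
  also have "(\<lambda>v. indicator {0..real N} (0 + real N * v) * ((1 - (0 + real N * v) / real N) ^ n * exp (b * (0 + real N * v)))) =
     (\<lambda>v. indicator {0..1} v * ((1 - v) ^ n * exp (real N * b * v)))"
    using assms by (auto simp: fun_eq_iff indicator_def zero_le_mult_iff mult_ac)
  finally show ?thesis by (simp add: edge_moment_def)
qed

text \<open>On the scale \<open>1 / N\<close> at the boundary the integrand converges to
  \<open>exp (- ((\<tau> - b) * v))\<close> on the half-line. The bound
  \<open>1 - x \<le> exp (- x)\<close> dominates it by \<open>exp (- (c * v))\<close> as soon as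
  \<open>n / N\<close> exceeds \<open>b + c\<close>; half the gap serves as
  \<open>c\<close>.\<close>

lemma edge_moment_limit_above:
  assumes N: "filterlim N at_top sequentially" and n: "(\<lambda>i. real (n i) / real (N i)) \<longlonglongrightarrow> \<tau>" and "b < \<tau>"
  shows "(\<lambda>i. real (N i) * edge_moment b (N i) (n i)) \<longlonglongrightarrow> 1 / (\<tau> - b)"
proof -
  define c where "c = (\<tau> - b) / 2"
  have c: "c > 0" "b + c < \<tau>" using assms(3) by (auto simp: c_def field_simps)
  have "\<forall>\<^sub>F i in sequentially. b + c < real (n i) / real (N i) \<and> N i > 0"
    using order_tendstoD(1)[OF n c(2)] eventually_compose_filterlim[OF eventually_gt_at_top[of 0] N] by eventually_elim auto
  then obtain i0 where i0: "\<And>i. i \<ge> i0 \<Longrightarrow> b + c < real (n i) / real (N i) \<and> N i > 0"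
    by (auto simp: eventually_sequentially)
  define s where "s i v = indicator {0..real (N i)} v * ((1 - v / real (N i)) ^ n i * exp (b * v))" for i v
  define f where "f a v = indicator {0..} v * exp (- (a * v))" for a v :: real
  have f_hb: "has_bochner_integral lborel (f a) (1 / a)" if "a > 0" for a
  proof -
    have "((\<lambda>x. if x \<in> {0..} then exp (- (a * x)) else 0) has_integral 1 / a) UNIV"
      unfolding has_integral_restrict_UNIV
      using has_integral_exp_minus_to_infinity[OF that, of 0] by simp
    moreover have "f a = (\<lambda>x. if x \<in> {0..} then exp (- (a * x)) else 0)"
      by (auto simp: f_def fun_eq_iff)
    ultimately have I: "(f a has_integral 1 / a) UNIV" by (simp only:)
    have [measurable]: "f a \<in> borel_measurable borel" by (simp add: f_def[abs_def])
    have "(\<integral>\<^sup>+x. ennreal (f a x) \<partial>lborel) = ennreal (1 / a)"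
      by (rule nn_integral_has_integral_lborel[OF _ _ I]) (auto simp: f_def)
    then show ?thesis
      using that by (intro has_bochner_integral_nn_integral) (auto simp: f_def)
  qed
  have "(\<lambda>i. \<integral>v. s (i + i0) v \<partial>lborel) \<longlonglongrightarrow> (\<integral>v. f (\<tau> - b) v \<partial>lborel)"
  proof (rule integral_dominated_convergence[where w = "f c"])
    show "f (\<tau> - b) \<in> borel_measurable lborel" by (simp add: f_def[abs_def])
    show "s (i + i0) \<in> borel_measurable lborel" for i by (simp add: s_def[abs_def])
    show "integrable lborel (f c)" using f_hb[OF c(1)] by (auto simp: has_bochner_integral_iff)
    show "AE v in lborel. (\<lambda>i. s (i + i0) v) \<longlonglongrightarrow> f (\<tau> - b) v"
    proof (intro AE_I2)
      fix v :: real
      have inv: "(\<lambda>i. v / real (N i)) \<longlonglongrightarrow> 0"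
        using N by (intro tendsto_divide_0[OF tendsto_const] filterlim_at_top_imp_at_infinity
            filterlim_compose[OF filterlim_real_sequentially])
      show "(\<lambda>i. s (i + i0) v) \<longlonglongrightarrow> f (\<tau> - b) v"
      proof (cases "v \<ge> 0")
        case True
        have "(\<lambda>i. real (n i) * (- (v / real (N i)))) \<longlonglongrightarrow> - (v * \<tau>)"
          using tendsto_minus[OF tendsto_mult_left[OF n, of v]] by (simp add: mult_ac)
        then have "(\<lambda>i. (1 + (- (v / real (N i)))) ^ n i) \<longlonglongrightarrow> exp (- (v * \<tau>))"
          using tendsto_minus[OF inv] by (intro power_tendsto_exp_real) auto
        then have "(\<lambda>i. (1 - v / real (N i)) ^ n i * exp (b * v)) \<longlonglongrightarrow> exp (- (v * \<tau>)) * exp (b * v)"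
          by (intro tendsto_intros) simp
        moreover have "\<forall>\<^sub>F i in sequentially. (1 - v / real (N i)) ^ n i * exp (b * v) = s i v"
          using filterlim_compose[OF filterlim_real_sequentially N, THEN filterlim_at_top[THEN iffD1], rule_format, of v]
          by eventually_elim (use True in \<open>simp add: s_def indicator_def\<close>)
        ultimately have "(\<lambda>i. s i v) \<longlonglongrightarrow> exp (- (v * \<tau>)) * exp (b * v)"
          by (rule Lim_transform_eventually)
        moreover have "exp (- (v * \<tau>)) * exp (b * v) = f (\<tau> - b) v"
          using True by (simp add: f_def algebra_simps flip: exp_add)
        ultimately have "(\<lambda>i. s i v) \<longlonglongrightarrow> f (\<tau> - b) v" by simp
        then show ?thesis by (rule LIMSEQ_ignore_initial_segment)
      next
        case False
        then show ?thesis by (simp add: s_def f_def)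
      qed
    qed
    show "AE v in lborel. norm (s (i + i0) v) \<le> f c v" for i
    proof (intro AE_I2)
      fix v :: real
      let ?N = "real (N (i + i0))" and ?n = "n (i + i0)"
      have i: "b + c < real ?n / ?N" "?N > 0" using i0[of "i + i0"] by auto
      show "norm (s (i + i0) v) \<le> f c v"
      proof (cases "v \<in> {0..?N}")
        case True
        then have v: "0 \<le> v" "0 \<le> 1 - v / ?N" using i by (auto simp: field_simps)
        have "1 - v / ?N \<le> exp (- (v / ?N))" using exp_ge_add_one_self[of "- (v / ?N)"] by simp
        then have "(1 - v / ?N) ^ ?n \<le> exp (- (v / ?N)) ^ ?n" using v by (intro power_mono)
        also have "\<dots> = exp (- (real ?n / ?N * v))" by (simp add: exp_of_nat_mult[symmetric] mult_ac)
        also have "\<dots> \<le> exp (- ((b + c) * v))"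
        proof -
          have "(b + c) * v \<le> real ?n / ?N * v" using i v by (intro mult_right_mono) auto
          then show ?thesis by simp
        qed
        finally have "(1 - v / ?N) ^ ?n * exp (b * v) \<le> exp (- ((b + c) * v)) * exp (b * v)"
          by (rule mult_right_mono) simp
        also have "\<dots> = exp (- (c * v))" by (simp add: algebra_simps flip: exp_add)
        finally show ?thesis using True v by (simp add: s_def f_def abs_mult)
      next
        case False
        then show ?thesis by (simp add: s_def f_def)
      qed
    qed
  qed
  moreover have "(\<integral>v. s (i + i0) v \<partial>lborel) = real (N (i + i0)) * edge_moment b (N (i + i0)) (n (i + i0))" for i
    unfolding s_def using i0[of "i + i0"] by (simp add: edge_moment_scaled)
  moreover have "(\<integral>v. f (\<tau> - b) v \<partial>lborel) = 1 / (\<tau> - b)"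
    using f_hb[of "\<tau> - b"] assms(3) by (auto simp: has_bochner_integral_iff)
  ultimately show ?thesis
    using LIMSEQ_offset[of "\<lambda>i. real (N i) * edge_moment b (N i) (n i)" i0] by simp
qed

text \<open>At or below the threshold no asymptotics are needed. The moments decrease in
  \<open>n\<close>, so the reciprocal is bounded by the one at the larger index \<open>n'\<close>
  near \<open>(b + e / 2) * N\<close>, which lies above the threshold and has the limit
  \<open>e / 2\<close>.\<close>

lemma inverse_edge_moment_limit:
  assumes N: "filterlim N at_top sequentially" and n: "(\<lambda>i. real (n i) / real (N i)) \<longlonglongrightarrow> \<tau>" and "0 \<le> b"
  shows "(\<lambda>i. 1 / (real (N i) * edge_moment b (N i) (n i))) \<longlonglongrightarrow> max 0 (\<tau> - b)"
proof (cases "b < \<tau>")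
  case True
  then show ?thesis
    using tendsto_inverse[OF edge_moment_limit_above[OF N n True]] by (simp add: inverse_eq_divide)
next
  case False
  have "(\<lambda>i. 1 / (real (N i) * edge_moment b (N i) (n i))) \<longlonglongrightarrow> 0"
  proof (rule order_tendstoI)
    fix e :: real assume "e < 0"
    have "0 \<le> 1 / (real (N i) * edge_moment b (N i) (n i))" for i
      using edge_moment_pos[OF assms(3), of "N i" "n i"] by simp
    then show "\<forall>\<^sub>F i in sequentially. e < 1 / (real (N i) * edge_moment b (N i) (n i))"
      using \<open>e < 0\<close> by (intro always_eventually allI) (meson less_le_trans)
  next
    fix e :: real assume e: "0 < e"
    define \<tau>' where "\<tau>' = b + e / 2"
    define n' where "n' i = nat \<lceil>\<tau>' * real (N i)\<rceil>" for i
    have N0: "\<forall>\<^sub>F i in sequentially. real (N i) > 0"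
      using eventually_compose_filterlim[OF eventually_gt_at_top[of 0] N] by simp
    have \<tau>': "0 \<le> \<tau>'" "b < \<tau>'" using assms(3) e by (auto simp: \<tau>'_def)
    have "(\<lambda>i. real (n' i) / real (N i)) \<longlonglongrightarrow> \<tau>'"
    proof (rule tendsto_sandwich[of "\<lambda>_. \<tau>'" _ _ "\<lambda>i. \<tau>' + 1 / real (N i)"])
      show "\<forall>\<^sub>F i in sequentially. \<tau>' \<le> real (n' i) / real (N i)"
        using N0 by eventually_elim (simp add: n'_def field_simps, linarith)
      show "\<forall>\<^sub>F i in sequentially. real (n' i) / real (N i) \<le> \<tau>' + 1 / real (N i)"
        using N0
      proof eventually_elim
        case (elim i)
        have "real (n' i) \<le> \<tau>' * real (N i) + 1"
          using \<tau>'(1) elim of_int_ceiling_le_add_one[of "\<tau>' * real (N i)"] by (simp add: n'_def)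
        with elim show ?case by (simp add: field_simps)
      qed
      have "(\<lambda>i. 1 / real (N i)) \<longlonglongrightarrow> 0" by (rule one_over_filterlim_at_top[OF N])
      then show "(\<lambda>i. \<tau>' + 1 / real (N i)) \<longlonglongrightarrow> \<tau>'"
        using tendsto_add[OF tendsto_const[of \<tau>']] by fastforce
    qed simp
    from tendsto_inverse[OF edge_moment_limit_above[OF N this \<tau>'(2)]]
    have "(\<lambda>i. 1 / (real (N i) * edge_moment b (N i) (n' i))) \<longlonglongrightarrow> e / 2"
      using e by (simp add: inverse_eq_divide \<tau>'_def)
    then have "\<forall>\<^sub>F i in sequentially. 1 / (real (N i) * edge_moment b (N i) (n' i)) < e"
      by (rule order_tendstoD(2)) (use e in simp)
    moreover have "\<forall>\<^sub>F i in sequentially. real (n i) / real (N i) < \<tau>'"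
      using False \<tau>' by (intro order_tendstoD(2)[OF n]) auto
    ultimately show "\<forall>\<^sub>F i in sequentially. 1 / (real (N i) * edge_moment b (N i) (n i)) < e"
      using N0
    proof eventually_elim
      case (elim i)
      have "real (n i) < \<tau>' * real (N i)" using elim by (simp add: field_simps)
      then have "n i \<le> n' i" unfolding n'_def by linarith
      then have "edge_moment b (N i) (n' i) \<le> edge_moment b (N i) (n i)"
        by (rule edge_moment_decreasing)
      then have "1 / (real (N i) * edge_moment b (N i) (n i)) \<le> 1 / (real (N i) * edge_moment b (N i) (n' i))"
        using elim edge_moment_pos[OF assms(3)] by (intro divide_left_mono mult_left_mono mult_pos_pos) auto
      with elim show ?case by linarith
    qed
  qed
  then show ?thesis using False by simp
qed

section \<open>Coefficients of the kernel at the hard edge\<close>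

text \<open>With \<open>H\<close> the moments, log-convexity puts the square of
  \<open>H (2*j+2) / H (2*j+1)\<close> between \<open>H (2*j+2) / H (2*j)\<close> and
  \<open>H (2*j+3) / H (2*j+1)\<close>, and both bounds telescope along the product.\<close>

lemma skew_coeff_edge_moment_bounds:
  assumes "b \<ge> 0" "l \<le> m"
  shows "edge_moment b N (2*m) / edge_moment b N (2*l) \<le> (skew_coeff (edge_moment b N) m l)\<^sup>2"
    and "(skew_coeff (edge_moment b N) m l)\<^sup>2 \<le> edge_moment b N (2*m+1) / edge_moment b N (2*l+1)"
proof -
  let ?H = "edge_moment b N"
  have pos: "?H n > 0" for n using edge_moment_pos[OF assms(1)] .
  have conv: "(?H (Suc n))\<^sup>2 \<le> ?H n * ?H (Suc (Suc n))" for n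
    by (rule edge_moment_log_convex[OF assms(1)])
  have "?H (2*m) / ?H (2*l) \<le> (skew_coeff ?H m l)\<^sup>2 \<and> (skew_coeff ?H m l)\<^sup>2 \<le> ?H (2*m+1) / ?H (2*l+1)"
    using assms(2)
  proof (induction m rule: dec_induct)
    case base
    then show ?case using pos[of "2*l"] pos[of "2*l+1"] by (simp add: skew_coeff_def)
  next
    case (step m)
    let ?q = "?H (2*m+2) / ?H (2*m+1)"
    have S: "(skew_coeff ?H (Suc m) l)\<^sup>2 = (skew_coeff ?H m l)\<^sup>2 * ?q\<^sup>2"
    proof -
      have "skew_coeff ?H (Suc m) l = skew_coeff ?H m l * ?q"
        using step.hyps by (simp add: skew_coeff_def)
      then show ?thesis by (simp only: power_mult_distrib)
    qed
    have q1: "?H (2*m+2) / ?H (2*m) \<le> ?q\<^sup>2"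
    proof -
      have "?H (2*m+2) * (?H (2*m+1))\<^sup>2 \<le> ?H (2*m+2) * (?H (2*m) * ?H (2*m+2))"
        using conv[of "2*m"] pos[of "2*m+2"] by (intro mult_left_mono) auto
      then show ?thesis
        using pos[of "2*m"] pos[of "2*m+1"] by (simp add: field_simps power2_eq_square)
    qed
    have q2: "?q\<^sup>2 \<le> ?H (2*m+3) / ?H (2*m+1)"
    proof -
      have "(?H (2*m+2))\<^sup>2 \<le> ?H (2*m+1) * ?H (2*m+3)"
        using conv[of "2*m+1"] by (simp add: numeral_3_eq_3)
      then have "(?H (2*m+2))\<^sup>2 / (?H (2*m+1))\<^sup>2 \<le> (?H (2*m+1) * ?H (2*m+3)) / (?H (2*m+1))\<^sup>2"
        by (rule divide_right_mono) simp
      also have "\<dots> = ?H (2*m+3) / ?H (2*m+1)"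
        using pos[of "2*m+1"] by (simp add: power2_eq_square)
      finally show ?thesis by (simp add: power_divide)
    qed
    have "?H (2*m+2) / ?H (2*l) = (?H (2*m) / ?H (2*l)) * (?H (2*m+2) / ?H (2*m))"
      using pos[of "2*m"] by simp
    also have "\<dots> \<le> (skew_coeff ?H m l)\<^sup>2 * ?q\<^sup>2"
      using step.IH q1 pos[of "2*m+2"] pos[of "2*m"] by (intro mult_mono) auto
    finally have low: "?H (2*m+2) / ?H (2*l) \<le> (skew_coeff ?H m l)\<^sup>2 * ?q\<^sup>2" .
    have "(skew_coeff ?H m l)\<^sup>2 * ?q\<^sup>2 \<le> (?H (2*m+1) / ?H (2*l+1)) * (?H (2*m+3) / ?H (2*m+1))"
      using step.IH q2 pos[of "2*m+1"] pos[of "2*l+1"] by (intro mult_mono) auto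
    also have "\<dots> = ?H (2*m+3) / ?H (2*l+1)" using pos[of "2*m+1"] by simp
    finally show ?case using low by (simp add: S numeral_3_eq_3)
  qed
  then show "?H (2*m) / ?H (2*l) \<le> (skew_coeff ?H m l)\<^sup>2"
    and "(skew_coeff ?H m l)\<^sup>2 \<le> ?H (2*m+1) / ?H (2*l+1)" by auto
qed

lemma double_fraction_limit:
  assumes N: "filterlim N at_top sequentially" and c: "(\<lambda>i. real (c i) / real (N i)) \<longlonglongrightarrow> u"
  shows "(\<lambda>i. real (2 * c i) / real (N i)) \<longlonglongrightarrow> 2 * u"
    and "(\<lambda>i. real (2 * c i + 1) / real (N i)) \<longlonglongrightarrow> 2 * u"
proof -
  note inv = one_over_filterlim_at_top[OF N]
  show *: "(\<lambda>i. real (2 * c i) / real (N i)) \<longlonglongrightarrow> 2 * u"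
    using tendsto_mult_left[OF c, of 2] by simp
  show "(\<lambda>i. real (2 * c i + 1) / real (N i)) \<longlonglongrightarrow> 2 * u"
    using tendsto_add[OF * inv] by (simp add: add_divide_distrib add.commute)
qed

text \<open>What is left of the quotient of \<open>skew_coeff\<close> and the moment of order
  \<open>2*m+1\<close> once powers of the radius and an exponential are split off; the factor
  \<open>N\<close> makes it of order 1.\<close>

definition edge_coeff :: "real \<Rightarrow> nat \<Rightarrow> nat \<Rightarrow> nat \<Rightarrow> real" where
  "edge_coeff b N m l = skew_coeff (edge_moment b N) m l / (real N * edge_moment b N (2*m+1))"

lemma edge_coeff_nonneg:
  assumes "b \<ge> 0"
  shows "0 \<le> edge_coeff b N m l"
  unfolding edge_coeff_def skew_coeff_def
  using edge_moment_pos[OF assms] by (intro divide_nonneg_nonneg prod_nonneg mult_nonneg_nonneg) (auto intro: less_imp_le)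

text \<open>The coefficient \<open>skew_coeff\<close> is at most 1, and \<open>N\<close> times the
  moment is at least \<open>N / (2*m+2)\<close>, hence at least 1/2 because \<open>m < N\<close>.
  Uniformity in all indices is what dominated convergence requires.\<close>

lemma edge_coeff_le:
  assumes "b \<ge> 0" "l \<le> m" "m < N"
  shows "edge_coeff b N m l \<le> 2"
proof -
  let ?H = "edge_moment b N"
  have pos: "?H n > 0" for n using edge_moment_pos[OF assms(1)] .
  have "(skew_coeff ?H m l)\<^sup>2 \<le> ?H (2*m+1) / ?H (2*l+1)"
    by (rule skew_coeff_edge_moment_bounds(2)[OF assms(1,2)])
  also have "\<dots> \<le> 1"
    using assms(2) pos[of "2*l+1"] by (simp add: edge_moment_decreasing)
  finally have "skew_coeff ?H m l \<le> 1" by (simp add: power2_le_imp_le[of _ 1] flip: abs_square_le_1)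
  then have "edge_coeff b N m l \<le> 1 / (real N * ?H (2*m+1))"
    unfolding edge_coeff_def using pos[of "2*m+1"] assms(3) by (intro divide_right_mono) auto
  also have "\<dots> \<le> 2"
  proof -
    have "1 / (real (2*m+1) + 1) \<le> ?H (2*m+1)" by (rule edge_moment_ge[OF assms(1)])
    then have "real N * (1 / (real (2*m+1) + 1)) \<le> real N * ?H (2*m+1)"
      by (rule mult_left_mono) simp
    moreover have "1 / 2 \<le> real N * (1 / (real (2*m+1) + 1))"
      using assms(3) by (simp add: field_simps)
    ultimately have "1 / 2 \<le> real N * ?H (2*m+1)" by linarith
    then show ?thesis by (simp add: field_simps)
  qed
  finally show ?thesis .
qed

text \<open>Multiplied by the square of \<open>g i (2 * m i + 1)\<close>, the two quotients of
  moments that enclose the squared \<open>skew_coeff\<close> turn into products of two values of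
  \<open>g\<close>. These converge even where the limit is 0 and the quotients alone are not
  controlled, so the squared coefficient is squeezed.\<close>

lemma edge_coeff_limit:
  assumes "b \<ge> 0" and N: "filterlim N at_top sequentially"
    and m: "(\<lambda>i. real (m i) / real (N i)) \<longlonglongrightarrow> t" and l: "(\<lambda>i. real (l i) / real (N i)) \<longlonglongrightarrow> s"
    and le: "\<forall>\<^sub>F i in sequentially. l i \<le> m i"
  shows "(\<lambda>i. edge_coeff b (N i) (m i) (l i)) \<longlonglongrightarrow> sqrt (max 0 (2 * t - b)) * sqrt (max 0 (2 * s - b))"
proof -
  define g where "g i n = 1 / (real (N i) * edge_moment b (N i) n)" for i n
  have pos: "edge_moment b K n > 0" for n K using edge_moment_pos[OF assms(1)] .
  note lim = inverse_edge_moment_limit[OF N _ assms(1), folded g_def]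
  have "(\<lambda>i. (edge_coeff b (N i) (m i) (l i))\<^sup>2) \<longlonglongrightarrow> max 0 (2 * t - b) * max 0 (2 * s - b)"
  proof (rule tendsto_sandwich)
    have Npos: "\<forall>\<^sub>F i in sequentially. N i > 0" by (rule eventually_compose_filterlim[OF eventually_gt_at_top N])
    have sq: "(edge_coeff b (N i) (m i) (l i))\<^sup>2 = (skew_coeff (edge_moment b (N i)) (m i) (l i))\<^sup>2 * (g i (2 * m i + 1))\<^sup>2" for i
      by (simp add: edge_coeff_def g_def power_divide)
    show "\<forall>\<^sub>F i in sequentially. g i (2 * m i + 1) * g i (2 * l i) \<le> (edge_coeff b (N i) (m i) (l i))\<^sup>2"
      using le Npos
    proof eventually_elim
      case (elim i)
      let ?H = "edge_moment b (N i)"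
      have "g i (2 * m i + 1) * g i (2 * l i) = (?H (2 * m i + 1) / ?H (2 * l i)) * (g i (2 * m i + 1))\<^sup>2"
        using pos[of "N i" "2 * m i + 1"] elim by (simp add: g_def power2_eq_square)
      \<comment> \<open>The lower bound offers the moment of order \<open>2 * m i\<close>, whereas
        \<open>edge_coeff\<close> contains that of order \<open>2 * m i + 1\<close>; monotonicity
        bridges the difference.\<close>
      also have "\<dots> \<le> (?H (2 * m i) / ?H (2 * l i)) * (g i (2 * m i + 1))\<^sup>2"
        using pos[of "N i" "2 * l i"] by (intro mult_right_mono divide_right_mono edge_moment_decreasing) auto
      also have "\<dots> \<le> (edge_coeff b (N i) (m i) (l i))\<^sup>2"
        unfolding sq by (intro mult_right_mono skew_coeff_edge_moment_bounds assms elim) simp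
      finally show ?case .
    qed
    show "\<forall>\<^sub>F i in sequentially. (edge_coeff b (N i) (m i) (l i))\<^sup>2 \<le> g i (2 * m i + 1) * g i (2 * l i + 1)"
      using le Npos
    proof eventually_elim
      case (elim i)
      let ?H = "edge_moment b (N i)"
      have "(edge_coeff b (N i) (m i) (l i))\<^sup>2 \<le> (?H (2 * m i + 1) / ?H (2 * l i + 1)) * (g i (2 * m i + 1))\<^sup>2"
        unfolding sq by (intro mult_right_mono skew_coeff_edge_moment_bounds assms elim) simp
      also have "\<dots> = g i (2 * m i + 1) * g i (2 * l i + 1)"
        using pos[of "N i" "2 * m i + 1"] elim by (simp add: g_def power2_eq_square)
      finally show ?case .
    qed
    show "(\<lambda>i. g i (2 * m i + 1) * g i (2 * l i)) \<longlonglongrightarrow> max 0 (2 * t - b) * max 0 (2 * s - b)"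
      by (intro tendsto_mult lim double_fraction_limit N m l)
    show "(\<lambda>i. g i (2 * m i + 1) * g i (2 * l i + 1)) \<longlonglongrightarrow> max 0 (2 * t - b) * max 0 (2 * s - b)"
      by (intro tendsto_mult lim double_fraction_limit N m l)
  qed
  from tendsto_real_sqrt[OF this] show ?thesis
    using edge_coeff_nonneg[OF assms(1)] by (simp add: real_sqrt_mult)
qed

section \<open>Convergence of the kernel sums\<close>

text \<open>The step function is constant on intervals of length \<open>1 / N\<close>, so there is
  no quadrature error, and only limits of the summands at a fixed \<open>t\<close> remain to be
  found.\<close>

lemma sum_eq_integral_floor:
  fixes F :: "nat \<Rightarrow> complex"
  assumes "N > 0"
  shows "has_bochner_integral lborel (\<lambda>t. indicator {0..<1} t *\<^sub>R F (nat \<lfloor>real N * t\<rfloor>)) ((\<Sum>m<N. F m) / of_nat N)"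
proof -
  have eq: "indicator {0..<1} t *\<^sub>R F (nat \<lfloor>real N * t\<rfloor>) =
      (\<Sum>m<N. indicator {real m / real N..<real (Suc m) / real N} t *\<^sub>R F m)" for t
  proof (cases "0 \<le> t \<and> t < 1")
    case True
    define k where "k = nat \<lfloor>real N * t\<rfloor>"
    have "real N * t < real N * 1" using True assms by (intro mult_strict_left_mono) auto
    then have k: "k < N" using True by (simp add: k_def nat_less_iff floor_less_iff)
    have iff: "t \<in> {real m / real N..<real (Suc m) / real N} \<longleftrightarrow> m = k" for m
    proof -
      have "t \<in> {real m / real N..<real (Suc m) / real N} \<longleftrightarrow> real m \<le> real N * t \<and> real N * t < real m + 1"
        using assms by (auto simp: field_simps)
      also have "\<dots> \<longleftrightarrow> \<lfloor>real N * t\<rfloor> = int m" by (simp add: floor_eq_iff)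
      also have "\<dots> \<longleftrightarrow> m = k" using True by (auto simp: k_def)
      finally show ?thesis .
    qed
    have "(\<Sum>m<N. indicator {real m / real N..<real (Suc m) / real N} t *\<^sub>R F m) = (\<Sum>m<N. if m = k then F m else 0)"
      by (intro sum.cong refl) (simp only: indicator_def iff, simp)
    also have "\<dots> = F k" using k by simp
    finally show ?thesis using True by (simp add: k_def)
  next
    case False
    have "t \<notin> {real m / real N..<real (Suc m) / real N}" if "m < N" for m
    proof
      assume t: "t \<in> {real m / real N..<real (Suc m) / real N}"
      have "0 \<le> real m / real N" "real (Suc m) / real N \<le> 1" using that by auto
      with t False show False by (meson atLeastLessThan_iff less_le_trans order_trans)
    qed
    then have "(\<Sum>m<N. indicator {real m / real N..<real (Suc m) / real N} t *\<^sub>R F m) = 0"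
    proof (intro sum.neutral ballI)
      fix m assume "m \<in> {..<N}"
      then have "t \<notin> {real m / real N..<real (Suc m) / real N}"
        using \<open>\<And>m. m < N \<Longrightarrow> t \<notin> _\<close> by blast
      then show "indicator {real m / real N..<real (Suc m) / real N} t *\<^sub>R F m = 0"
        by (metis indicator_simps(2) scaleR_zero_left)
    qed
    with False show ?thesis by auto
  qed
  have "has_bochner_integral lborel (\<lambda>t. \<Sum>m<N. indicator {real m / real N..<real (Suc m) / real N} t *\<^sub>R F m)
      (\<Sum>m<N. (1 / real N) *\<^sub>R F m)"
  proof (intro has_bochner_integral_sum)
    fix m
    have "real m / real N \<le> real (Suc m) / real N" by (rule divide_right_mono) auto
    then have "emeasure lborel {real m / real N..<real (Suc m) / real N} < \<infinity>"
      by (simp only: emeasure_lborel_Ico) simp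
    then have "has_bochner_integral lborel (indicator {real m / real N..<real (Suc m) / real N} :: real \<Rightarrow> real)
        (measure lborel {real m / real N..<real (Suc m) / real N})"
      by (intro has_bochner_integral_real_indicator) auto
    moreover have "measure lborel {real m / real N..<real (Suc m) / real N} = 1 / real N"
      using assms by (simp add: divide_right_mono diff_divide_distrib[symmetric])
    ultimately show "has_bochner_integral lborel (\<lambda>t. indicator {real m / real N..<real (Suc m) / real N} t *\<^sub>R F m) ((1 / real N) *\<^sub>R F m)"
      by (intro has_bochner_integral_scaleR_left) simp
  qed
  moreover have "(\<Sum>m<N. (1 / real N) *\<^sub>R F m) = (\<Sum>m<N. F m) / of_nat N"
    by (simp add: sum_divide_distrib scaleR_conv_of_real)
  ultimately show ?thesis by (simp only: eq)
qed

text \<open>The power is the monomial of degree \<open>n\<close> at the rescaled point with the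
  radius divided out. The exponential is the share of one node in that part of the logarithm of the
  weight that is linear in the rescaled variable and its conjugate.\<close>

definition edge_factor :: "real \<Rightarrow> real \<Rightarrow> nat \<Rightarrow> complex \<Rightarrow> nat \<Rightarrow> complex" where
  "edge_factor b \<kappa> N z n = exp (- (of_real b * z / of_real \<kappa>)) * (1 + z / of_real (real N * \<kappa>)) ^ n"

text \<open>The limit of \<open>edge_factor\<close> times one of the two square roots in the limit
  of \<open>edge_coeff\<close>; in the limit the summand factorises into two profiles.\<close>

definition edge_profile :: "real \<Rightarrow> real \<Rightarrow> complex \<Rightarrow> real \<Rightarrow> complex" where
  "edge_profile b \<kappa> z t = of_real (sqrt (max 0 (2 * t - b))) * exp (z * of_real ((2 * t - b) / \<kappa>))"

definition edge_sum :: "real \<Rightarrow> real \<Rightarrow> nat \<Rightarrow> complex \<Rightarrow> complex \<Rightarrow> complex" where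
  "edge_sum b \<kappa> N z w = (\<Sum>m<N. \<Sum>l\<le>m. of_real (edge_coeff b N m l) *
      edge_factor b \<kappa> N z (2 * m + 1) * edge_factor b \<kappa> N w (2 * l)) / of_nat N ^ 2"

lemma norm_edge_factor_le:
  assumes "0 \<le> b" "0 < \<kappa>" "n \<le> 2 * N" "cmod z \<le> M"
  shows "cmod (edge_factor b \<kappa> N z n) \<le> exp ((2 + b) * M / \<kappa>)"
\<comment> \<open>For \<open>N = 0\<close> also \<open>n = 0\<close> and the power is 1; the general
  estimate has to divide by \<open>N\<close>.\<close>
proof (cases "N = 0")
  case True
  have "cmod (edge_factor b \<kappa> N z n) \<le> exp (b * cmod z / \<kappa>)"
    using True assms norm_exp[of "- (of_real b * z / of_real \<kappa>)"]
    by (simp add: edge_factor_def norm_mult norm_divide)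
  also have "\<dots> \<le> exp ((2 + b) * M / \<kappa>)"
  proof -
    have "b * cmod z \<le> (2 + b) * M" using assms by (intro mult_mono) auto
    then show ?thesis using assms(2) by (simp add: divide_right_mono)
  qed
  finally show ?thesis .
next
  case False
  define x where "x = cmod z / (real N * \<kappa>)"
  have x: "0 \<le> x" using assms by (simp add: x_def)
  have "cmod (1 + z / of_real (real N * \<kappa>)) \<le> 1 + cmod (z / of_real (real N * \<kappa>))"
    by (metis norm_one norm_triangle_ineq)
  also have "cmod (z / of_real (real N * \<kappa>)) = x"
    using assms by (simp add: x_def norm_divide norm_mult)
  also have "1 + x \<le> exp x" by (rule exp_ge_add_one_self)
  finally have "cmod (1 + z / of_real (real N * \<kappa>)) ^ n \<le> exp x ^ n" by (rule power_mono) simp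
  also have "\<dots> = exp (real n * x)" by (simp add: exp_of_nat_mult)
  also have "\<dots> \<le> exp (real (2 * N) * x)" using assms(3) x by (simp add: mult_right_mono)
  also have "real (2 * N) * x = 2 * cmod z / \<kappa>" using False assms(2) by (simp add: x_def)
  finally have 1: "cmod (1 + z / of_real (real N * \<kappa>)) ^ n \<le> exp (2 * cmod z / \<kappa>)" .
  have 2: "cmod (exp (- (of_real b * z / of_real \<kappa>))) \<le> exp (b * cmod z / \<kappa>)"
    using norm_exp[of "- (of_real b * z / of_real \<kappa>)"] assms by (simp add: norm_mult norm_divide)
  have "cmod (edge_factor b \<kappa> N z n) \<le> exp (b * cmod z / \<kappa>) * exp (2 * cmod z / \<kappa>)"
    unfolding edge_factor_def norm_mult norm_power by (intro mult_mono 1 2) auto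
  also have "\<dots> = exp ((2 + b) * cmod z / \<kappa>)"
    by (simp add: algebra_simps add_divide_distrib flip: exp_add)
  also have "\<dots> \<le> exp ((2 + b) * M / \<kappa>)"
    using assms by (simp add: divide_right_mono mult_left_mono)
  finally show ?thesis .
qed

lemma edge_factor_limit:
  assumes N: "filterlim N at_top sequentially" and "\<kappa> > 0" and z: "z \<longlonglongrightarrow> z0"
    and n: "(\<lambda>i. real (n i) / real (N i)) \<longlonglongrightarrow> 2 * t"
  shows "(\<lambda>i. edge_factor b \<kappa> (N i) (z i) (n i)) \<longlonglongrightarrow> exp (z0 * of_real ((2 * t - b) / \<kappa>))"
proof -
  note inv = one_over_filterlim_at_top[OF N]
  have "(\<lambda>i. z i * of_real (1 / real (N i)) / of_real \<kappa>) \<longlonglongrightarrow> z0 * of_real 0 / of_real \<kappa>"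
    using assms(2) by (intro tendsto_intros z inv) auto
  then have w0: "(\<lambda>i. z i / of_real (real (N i) * \<kappa>)) \<longlonglongrightarrow> 0" by simp
  have "(\<lambda>i. z i * of_real (real (n i) / real (N i)) / of_real \<kappa>) \<longlonglongrightarrow> z0 * of_real (2 * t) / of_real \<kappa>"
    using assms(2) by (intro tendsto_intros z n) auto
  then have "(\<lambda>i. of_nat (n i) * (z i / of_real (real (N i) * \<kappa>))) \<longlonglongrightarrow> z0 * of_real (2 * t) / of_real \<kappa>"
    by (simp add: mult_ac)
  from power_tendsto_exp[OF w0 this]
  have "(\<lambda>i. exp (- (of_real b * z i / of_real \<kappa>)) * (1 + z i / of_real (real (N i) * \<kappa>)) ^ n i) \<longlonglongrightarrow>
      exp (- (of_real b * z0 / of_real \<kappa>)) * exp (z0 * of_real (2 * t) / of_real \<kappa>)"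
    using assms(2) by (intro tendsto_intros z) auto
  moreover have "exp (- (of_real b * z0 / of_real \<kappa>)) * exp (z0 * of_real (2 * t) / of_real \<kappa>) =
      exp (z0 * of_real ((2 * t - b) / \<kappa>))"
    by (simp add: diff_divide_distrib algebra_simps flip: exp_add)
  ultimately show ?thesis by (simp add: edge_factor_def)
qed

lemma floor_fraction_limit:
  assumes N: "filterlim N at_top sequentially" and "0 \<le> t"
  shows "(\<lambda>i. real (nat \<lfloor>real (N i) * t\<rfloor>) / real (N i)) \<longlonglongrightarrow> t"
proof (rule tendsto_sandwich)
  have N0: "\<forall>\<^sub>F i in sequentially. N i > 0" by (rule eventually_compose_filterlim[OF eventually_gt_at_top N])
  have nat: "real (nat \<lfloor>real (N i) * t\<rfloor>) = of_int \<lfloor>real (N i) * t\<rfloor>" for i using assms(2) by simp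
  show "\<forall>\<^sub>F i in sequentially. t - 1 / real (N i) \<le> real (nat \<lfloor>real (N i) * t\<rfloor>) / real (N i)"
    using N0
  proof eventually_elim
    case (elim i)
    have "real (N i) * t - 1 \<le> of_int \<lfloor>real (N i) * t\<rfloor>" by linarith
    then have "(real (N i) * t - 1) / real (N i) \<le> of_int \<lfloor>real (N i) * t\<rfloor> / real (N i)"
      by (rule divide_right_mono) simp
    with elim show ?case unfolding nat by (simp add: diff_divide_distrib)
  qed
  show "\<forall>\<^sub>F i in sequentially. real (nat \<lfloor>real (N i) * t\<rfloor>) / real (N i) \<le> t"
    using N0
  proof eventually_elim
    case (elim i)
    have "of_int \<lfloor>real (N i) * t\<rfloor> \<le> real (N i) * t" by linarith
    with elim show ?case unfolding nat by (simp add: field_simps)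
  qed
  from tendsto_diff[OF tendsto_const[of t] one_over_filterlim_at_top[OF N]] show "(\<lambda>i. t - 1 / real (N i)) \<longlonglongrightarrow> t" by simp
qed simp

lemma measurable_floor_step [measurable]:
  fixes F :: "nat \<Rightarrow> complex"
  shows "(\<lambda>t::real. F (nat \<lfloor>x * t\<rfloor>)) \<in> borel_measurable borel"
proof -
  have "(\<lambda>t::real. \<lfloor>x * t\<rfloor>) \<in> measurable borel (count_space UNIV)"
    by (rule measurable_compose[OF _ measurable_real_floor]) simp
  then have "(\<lambda>t::real. nat \<lfloor>x * t\<rfloor>) \<in> measurable borel (count_space UNIV)"
    by (rule measurable_compose) simp
  then show ?thesis by (rule measurable_compose) simp
qed

lemma measurable_edge_profile [measurable]: "edge_profile b \<kappa> z \<in> borel_measurable borel"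
  unfolding edge_profile_def[abs_def] divide_inverse
  by (intro borel_measurable_continuous_onI continuous_intros)

lemma has_bochner_integral_unit_interval:
  "has_bochner_integral lborel (\<lambda>t::real. indicator {0..<1} t * C) (C :: real)"
proof -
  have "has_bochner_integral lborel (indicator {0..<1} :: real \<Rightarrow> real) (measure lborel {0..<1::real})"
    by (rule has_bochner_integral_real_indicator) auto
  from has_bochner_integral_mult_left[OF this, of C] show ?thesis by simp
qed

text \<open>Dominated convergence is used twice, for the inner variable at fixed \<open>t\<close>
  and then for the outer one, with the same constant \<open>C\<close> as bound. The summation range
  \<open>l \<le> m\<close> becomes \<open>s < t\<close>, the diagonal being a null set.\<close>

lemma edge_sum_limit:
  assumes b: "0 \<le> b" and \<kappa>: "0 < \<kappa>" and N: "filterlim N at_top sequentially"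
    and z: "z \<longlonglongrightarrow> z0" and w: "w \<longlonglongrightarrow> w0"
  shows "(\<lambda>i. edge_sum b \<kappa> (N i) (z i) (w i)) \<longlonglongrightarrow>
    (\<integral>t. indicator {0..<1} t *\<^sub>R (\<integral>s. indicator {0..<1} s *\<^sub>R
        (if s < t then edge_profile b \<kappa> z0 t * edge_profile b \<kappa> w0 s else 0) \<partial>lborel) \<partial>lborel)"
proof -
  let ?h = "\<lambda>t s. if s < t then edge_profile b \<kappa> z0 t * edge_profile b \<kappa> w0 s else 0"
  obtain M1 M2 where "\<And>i. cmod (z i) \<le> M1" "\<And>i. cmod (w i) \<le> M2"
    using convergent_imp_Bseq[OF convergentI[OF z]] convergent_imp_Bseq[OF convergentI[OF w]]
    unfolding Bseq_def by blast
  then obtain M where M: "\<And>i. cmod (z i) \<le> M" "\<And>i. cmod (w i) \<le> M"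
    by (meson max.cobounded1 max.cobounded2 order_trans)
  have "0 \<le> M" using M(1)[of 0] norm_ge_zero order_trans by blast
  define C where "C = 2 * exp ((2 + b) * M / \<kappa>) * exp ((2 + b) * M / \<kappa>)"
  have C: "C \<ge> 0" by (simp add: C_def)
  obtain i0 where i0: "\<And>i. i \<ge> i0 \<Longrightarrow> N i > 0"
    using eventually_compose_filterlim[OF eventually_gt_at_top[of 0] N] by (auto simp: eventually_sequentially)
  define f where "f i m l = (if l \<le> m then of_real (edge_coeff b (N i) m l) *
      edge_factor b \<kappa> (N i) (z i) (2 * m + 1) * edge_factor b \<kappa> (N i) (w i) (2 * l) else 0)" for i m l
  define fl where "fl i t = nat \<lfloor>real (N i) * t\<rfloor>" for i and t :: real
  define J where "J i m = (\<integral>s. indicator {0..<1} s *\<^sub>R f i m (fl i s) \<partial>lborel)" for i m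
  define J0 where "J0 t = (\<integral>s. indicator {0..<1} s *\<^sub>R
        ?h t s \<partial>lborel)" for t :: real
  have fl_less: "fl i t < N i" if "0 \<le> t" "t < 1" "i \<ge> i0" for i t
  proof -
    have "real (N i) * t < real (N i) * 1" using that i0[OF that(3)] by (intro mult_strict_left_mono) auto
    then show ?thesis using that by (simp add: fl_def nat_less_iff floor_less_iff)
  qed
  have f_bound: "cmod (f i m l) \<le> C" if "m < N i" for i m l
  proof (cases "l \<le> m")
    case True
    have "cmod (f i m l) = edge_coeff b (N i) m l * cmod (edge_factor b \<kappa> (N i) (z i) (2 * m + 1)) *
        cmod (edge_factor b \<kappa> (N i) (w i) (2 * l))"
      using True edge_coeff_nonneg[OF b] by (simp add: f_def norm_mult)
    also have "\<dots> \<le> C"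
      unfolding C_def using True that b \<kappa> edge_coeff_nonneg[OF b]
      by (intro mult_mono norm_edge_factor_le edge_coeff_le M) auto
    finally show ?thesis .
  next
    case False
    then show ?thesis using C by (simp add: f_def)
  qed
  have Cint: "integrable lborel (\<lambda>t::real. indicator {0..<1} t * C)"
    using has_bochner_integral_unit_interval[of C] by (auto simp: has_bochner_integral_iff)
  have edge_sum_eq: "edge_sum b \<kappa> (N i) (z i) (w i) = (\<integral>t. indicator {0..<1} t *\<^sub>R J i (fl i t) \<partial>lborel)"
    if "i \<ge> i0" for i
  proof -
    have N0: "N i > 0" using i0[OF that] .
    have Jm: "J i m = (\<Sum>l<N i. f i m l) / of_nat (N i)" for m
      unfolding J_def fl_def by (rule has_bochner_integral_integral_eq[OF sum_eq_integral_floor[OF N0]])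
    have "(\<integral>t. indicator {0..<1} t *\<^sub>R J i (fl i t) \<partial>lborel) = (\<Sum>m<N i. J i m) / of_nat (N i)"
      unfolding fl_def by (rule has_bochner_integral_integral_eq[OF sum_eq_integral_floor[OF N0]])
    also have "\<dots> = (\<Sum>m<N i. \<Sum>l<N i. f i m l) / of_nat (N i) ^ 2"
      by (simp add: Jm sum_divide_distrib[symmetric] power2_eq_square)
    also have "(\<Sum>m<N i. \<Sum>l<N i. f i m l) = (\<Sum>m<N i. \<Sum>l\<le>m. f i m l)"
      by (intro sum.cong refl sum.mono_neutral_right) (auto simp: f_def)
    also have "\<dots> / of_nat (N i) ^ 2 = edge_sum b \<kappa> (N i) (z i) (w i)"
      unfolding edge_sum_def by (simp add: f_def)
    finally show ?thesis by simp
  qed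
  have J_bound: "cmod (J i m) \<le> C" if "m < N i" for i m
  proof -
    have "cmod (J i m) \<le> (\<integral>s. indicator {0..<1::real} s * C \<partial>lborel)"
      unfolding J_def
    proof (rule Bochner_Integration.integral_norm_bound_integral[OF _ Cint])
      show "integrable lborel (\<lambda>s. indicator {0..<1} s *\<^sub>R f i m (fl i s))"
      proof (rule Bochner_Integration.integrable_bound[OF Cint])
        show "(\<lambda>s. indicator {0..<1} s *\<^sub>R f i m (fl i s)) \<in> borel_measurable lborel"
          unfolding fl_def by measurable
      qed (use f_bound[OF that] C in \<open>auto simp: indicator_def\<close>)
    qed (use f_bound[OF that] in \<open>auto simp: indicator_def\<close>)
    also have "\<dots> = C"
      using has_bochner_integral_unit_interval[of C] by (rule has_bochner_integral_integral_eq)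
    finally show ?thesis .
  qed
  let ?k = "\<lambda>i t s. indicator {0..<1} s *\<^sub>R f (i + i0) (fl (i + i0) t) (fl (i + i0) s)" and ?j = "\<lambda>i t. indicator {0..<1} t *\<^sub>R J (i + i0) (fl (i + i0) t)"
  have J_lim: "(\<lambda>i. J (i + i0) (fl (i + i0) t)) \<longlonglongrightarrow> J0 t" if t: "0 \<le> t" "t < 1" for t
    unfolding J_def J0_def
  proof (rule integral_dominated_convergence[where w = "\<lambda>s. indicator {0..<1::real} s * C"])
    show "(\<lambda>s. indicator {0..<1} s *\<^sub>R ?h t s) \<in> borel_measurable lborel"
      by measurable
    show "(\<lambda>s. ?k i t s) \<in> borel_measurable lborel" for i
      unfolding fl_def by measurable
    show "integrable lborel (\<lambda>s. indicator {0..<1::real} s * C)" by (rule Cint)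
    show "AE s in lborel. norm (?k i t s) \<le> indicator {0..<1} s * C" for i
      using f_bound[OF fl_less[OF t], of "i + i0"] by (intro AE_I2) (auto simp: indicator_def)
    have "AE s in lborel. s \<noteq> t" by (rule AE_lborel_singleton)
    then show "AE s in lborel. (\<lambda>i. ?k i t s) \<longlonglongrightarrow>
        indicator {0..<1} s *\<^sub>R ?h t s"
    proof eventually_elim
      case (elim s)
      show ?case
      proof (cases "s \<in> {0..<1}")
        case True
        note lim_t = floor_fraction_limit[OF N t(1), folded fl_def]
        note lim_s = floor_fraction_limit[OF N, of s, folded fl_def]
        have "(\<lambda>i. f i (fl i t) (fl i s)) \<longlonglongrightarrow> ?h t s"
        proof (cases "s < t")
          case st: True
          have le: "fl i s \<le> fl i t" for i
            unfolding fl_def using st by (intro nat_mono floor_mono mult_left_mono) auto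
          have "(\<lambda>i. of_real (edge_coeff b (N i) (fl i t) (fl i s)) *
              edge_factor b \<kappa> (N i) (z i) (2 * fl i t + 1) * edge_factor b \<kappa> (N i) (w i) (2 * fl i s)) \<longlonglongrightarrow>
            of_real (sqrt (max 0 (2 * t - b)) * sqrt (max 0 (2 * s - b))) *
              exp (z0 * of_real ((2 * t - b) / \<kappa>)) * exp (w0 * of_real ((2 * s - b) / \<kappa>))"
            using True le
            by (intro tendsto_mult tendsto_of_real edge_coeff_limit edge_factor_limit b N \<kappa> z w lim_t lim_s
                double_fraction_limit always_eventually allI) auto
          then show ?thesis using le st by (simp add: f_def edge_profile_def mult_ac)
        next
          case False
          with elim have ts: "t < s" by simp
          \<comment> \<open>The midpoint of \<open>s\<close> and \<open>t\<close> eventually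
            separates the two rescaled indices, so the term lies outside the range of
            summation.\<close>
          have "\<forall>\<^sub>F i in sequentially. real (fl i t) / real (N i) < (s + t) / 2"
            by (rule order_tendstoD(2)[OF lim_t]) (use ts in simp)
          moreover have "\<forall>\<^sub>F i in sequentially. (s + t) / 2 < real (fl i s) / real (N i)"
            by (rule order_tendstoD(1)[OF lim_s]) (use ts True in auto)
          ultimately have "\<forall>\<^sub>F i in sequentially. f i (fl i t) (fl i s) = 0"
          proof eventually_elim
            case (elim i)
            then have "real (fl i t) / real (N i) < real (fl i s) / real (N i)" by linarith
            then have "fl i t < fl i s" by (auto simp: divide_less_cancel)
            then show ?case by (simp add: f_def)
          qed
          then show ?thesis using False by (simp add: tendsto_eventually)
        qed
        from LIMSEQ_ignore_initial_segment[OF this, of i0] show ?thesis using True by simp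
      qed simp
    qed
  qed
  have "(\<lambda>i. \<integral>t. ?j i t \<partial>lborel) \<longlonglongrightarrow> (\<integral>t. indicator {0..<1} t *\<^sub>R J0 t \<partial>lborel)"
  proof (rule integral_dominated_convergence[where w = "\<lambda>s. indicator {0..<1::real} s * C"])
    show meas: "(\<lambda>t. ?j i t) \<in> borel_measurable lborel" for i
      unfolding fl_def by measurable
    show lim: "AE t in lborel. (\<lambda>i. ?j i t) \<longlonglongrightarrow> indicator {0..<1} t *\<^sub>R J0 t"
      using J_lim by (intro AE_I2) (auto simp: indicator_def)
    \<comment> \<open>Measurability of the parameter integral \<open>J0\<close> is inherited from
      the step functions of which it is the pointwise limit.\<close>
    show "(\<lambda>t. indicator {0..<1} t *\<^sub>R J0 t) \<in> borel_measurable lborel"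
    proof (rule borel_measurable_LIMSEQ_metric[OF meas])
      show "(\<lambda>i. ?j i t) \<longlonglongrightarrow> indicator {0..<1} t *\<^sub>R J0 t" for t
        using J_lim by (auto simp: indicator_def)
    qed
    show "AE t in lborel. norm (?j i t) \<le> indicator {0..<1} t * C" for i
      using J_bound fl_less by (intro AE_I2) (auto simp: indicator_def)
  qed (rule Cint)
  then have "(\<lambda>i. edge_sum b \<kappa> (N (i + i0)) (z (i + i0)) (w (i + i0))) \<longlonglongrightarrow> (\<integral>t. indicator {0..<1} t *\<^sub>R J0 t \<partial>lborel)"
    by (simp add: edge_sum_eq)
  then show ?thesis
    unfolding J0_def by (rule LIMSEQ_offset)
qed

section \<open>The limiting kernel\<close>

lemma continuous_on_edge_integrand:
  "continuous_on S (\<lambda>t. complex_of_real (sqrt t) * exp (2 * z * complex_of_real t))"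
  by (intro continuous_intros)

lemma edge_fun_vector_derivative:
  assumes "0 < u"
  shows "(edge_fun z has_vector_derivative of_real (sqrt u) * exp (2 * z * of_real u)) (at u)"
proof -
  \<comment> \<open>The interval extends beyond \<open>u\<close>, so that \<open>u\<close> is
    interior and the derivative within it is two-sided.\<close>
  have "((\<lambda>x. integral {0..x} (\<lambda>t. complex_of_real (sqrt t) * exp (2 * z * complex_of_real t)))
      has_vector_derivative of_real (sqrt u) * exp (2 * z * of_real u)) (at u within {0..u+1})"
    using assms by (intro integral_has_vector_derivative continuous_on_edge_integrand) auto
  moreover have "at u within {0..u+1} = at u"
    using assms by (intro at_within_interior) (simp add: interior_atLeastAtMost_real)
  ultimately show ?thesis by (simp add: edge_fun_def[abs_def])
qed

lemma continuous_on_edge_fun: "continuous_on {0..1} (edge_fun z)"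
  unfolding edge_fun_def[abs_def]
  by (intro indefinite_integral_continuous_1 integrable_continuous_interval continuous_on_edge_integrand)

text \<open>One term of the integrated Wronskian: up to a constant, the limit of a single
  \<open>edge_sum\<close> before antisymmetrisation.\<close>

definition edge_half_kernel :: "complex \<Rightarrow> complex \<Rightarrow> complex" where
  "edge_half_kernel z w = integral {0..1} (\<lambda>u. of_real (sqrt u) * exp (2 * z * of_real u) * edge_fun w u)"

lemma edge_kernel_eq: "edge_kernel z w = edge_half_kernel z w - edge_half_kernel w z"
proof -
  let ?g = "\<lambda>z w u. of_real (sqrt u) * exp (2 * z * of_real u) * edge_fun w u"
  have int: "?g z w integrable_on {0..1}" for z w
    by (intro integrable_continuous_interval continuous_intros continuous_on_edge_fun)
  have "edge_kernel z w = integral {0..1} (\<lambda>u. ?g z w u - ?g w z u)"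
    unfolding edge_kernel_def
  \<comment> \<open>The derivative formula is established for \<open>u > 0\<close> only; the
    endpoint does not affect the integral.\<close>
  proof (rule integral_spike[of "{0}"])
    fix u :: real assume "u \<in> {0..1} - {0}"
    then have "0 < u" by simp
    then show "?g z w u - ?g w z u = wronskian (edge_fun w) (edge_fun z) u"
      by (simp add: wronskian_def vector_derivative_at[OF edge_fun_vector_derivative] mult_ac)
  qed simp
  also have "\<dots> = edge_half_kernel z w - edge_half_kernel w z"
    unfolding edge_half_kernel_def by (rule integral_diff[OF int int])
  finally show ?thesis .
qed

lemma lebesgue_integral_eq_integral_half_open:
  fixes f :: "real \<Rightarrow> complex"
  assumes "continuous_on {a..u} f"
  shows "(\<integral>v. indicator {a..<u} v *\<^sub>R f v \<partial>lborel) = integral {a..u} f"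
proof -
  have "(\<integral>v. indicator {a..<u} v *\<^sub>R f v \<partial>lborel) = (\<integral>v. indicator {a..u} v *\<^sub>R f v \<partial>lborel)"
  proof (rule integral_cong_AE)
    have *: "(\<lambda>v. indicator {a..u} v *\<^sub>R f v) \<in> borel_measurable lborel"
      using integrable_indicator_continuous[OF assms] by (rule borel_measurable_integrable)
    then show "(\<lambda>v. indicator {a..u} v *\<^sub>R f v) \<in> borel_measurable lborel" .
    have "(\<lambda>v. indicator {a..<u} v *\<^sub>R (indicator {a..u} v *\<^sub>R f v)) \<in> borel_measurable lborel"
      by (rule borel_measurable_scaleR[OF borel_measurable_indicator *]) simp
    moreover have "(\<lambda>v. indicator {a..<u} v *\<^sub>R (indicator {a..u} v *\<^sub>R f v)) = (\<lambda>v. indicator {a..<u} v *\<^sub>R f v)"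
      by (auto simp: indicator_def fun_eq_iff)
    ultimately show "(\<lambda>v. indicator {a..<u} v *\<^sub>R f v) \<in> borel_measurable lborel" by (simp only:)
    have "AE v in lborel. v \<noteq> u" by (rule AE_lborel_singleton)
    then show "AE v in lborel. indicator {a..<u} v *\<^sub>R f v = indicator {a..u} v *\<^sub>R f v"
      by eventually_elim (auto simp: indicator_def)
  qed
  also have "\<dots> = integral {a..u} f"
    using set_borel_integral_eq_integral(2)[of "{a..u}" f] integrable_indicator_continuous[OF assms]
    by (simp add: set_integrable_def set_lebesgue_integral_def)
  finally show ?thesis .
qed

text \<open>Since \<open>2 * t - b = 2 * \<kappa> * v\<close> for
  \<open>t = b / 2 + \<kappa> * v\<close>, this substitution produces the integrand of
  \<open>edge_fun\<close> and turns the truncation in the square root into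
  \<open>v \<ge> 0\<close>.\<close>

lemma edge_profile_affine:
  assumes "\<kappa> > 0"
  shows "edge_profile b \<kappa> z (b / 2 + \<kappa> * v) =
    (if 0 \<le> v then of_real (sqrt (2 * \<kappa>)) * (of_real (sqrt v) * exp (2 * z * of_real v)) else 0)"
proof -
  have "2 * (b / 2 + \<kappa> * v) - b = 2 * \<kappa> * v" by simp
  moreover have "2 * \<kappa> * v / \<kappa> = 2 * v" using assms by simp
  ultimately have "edge_profile b \<kappa> z (b / 2 + \<kappa> * v) =
      of_real (sqrt (max 0 (2 * \<kappa> * v))) * exp (z * of_real (2 * v))"
    by (simp only: edge_profile_def)
  then show ?thesis
    using assms by (auto simp: max_def real_sqrt_mult zero_le_mult_iff mult_ac)
qed

lemma integral_edge_profile_inner: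
  assumes "\<kappa> > 0" "0 \<le> b" "t < 1"
  shows "(\<integral>s. indicator {0..<1} s *\<^sub>R (if s < t then c * edge_profile b \<kappa> w s else 0) \<partial>lborel) =
    c * of_real (\<kappa> * sqrt (2 * \<kappa>)) * edge_fun w ((t - b / 2) / \<kappa>)"
proof -
  let ?p = "\<lambda>v. if b / 2 + \<kappa> * v < t then c * edge_profile b \<kappa> w (b / 2 + \<kappa> * v) else 0"
  let ?u = "(t - b / 2) / \<kappa>" and ?g = "\<lambda>v. complex_of_real (sqrt v) * exp (2 * w * of_real v)"
  have "(\<integral>s. indicator {0..<1} s *\<^sub>R (if s < t then c * edge_profile b \<kappa> w s else 0) \<partial>lborel) =
    \<bar>\<kappa>\<bar> *\<^sub>R (\<integral>v. indicator {0..<1} (b / 2 + \<kappa> * v) *\<^sub>R ?p v \<partial>lborel)"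
    by (rule lborel_integral_real_affine) (use assms in simp)
  also have "(\<lambda>v. indicator {0..<1} (b / 2 + \<kappa> * v) *\<^sub>R ?p v) =
     (\<lambda>v. (c * of_real (sqrt (2 * \<kappa>))) * (indicator {0..<?u} v *\<^sub>R ?g v))"
  proof
    fix v
    show "indicator {0..<1} (b / 2 + \<kappa> * v) *\<^sub>R ?p v =
      (c * of_real (sqrt (2 * \<kappa>))) * (indicator {0..<?u} v *\<^sub>R ?g v)"
    proof (cases "0 \<le> v")
      case True
      then have "0 \<le> b / 2 + \<kappa> * v" using assms by simp
      moreover have "b / 2 + \<kappa> * v < t \<longleftrightarrow> v < ?u" using assms(1) by (simp add: field_simps)
      ultimately show ?thesis
        using True assms(3) unfolding edge_profile_affine[OF assms(1)] by (auto simp: indicator_def)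
    next
      case False
      then show ?thesis unfolding edge_profile_affine[OF assms(1)] by simp
    qed
  qed
  also have "(\<integral>v. (c * of_real (sqrt (2 * \<kappa>))) * (indicator {0..<?u} v *\<^sub>R ?g v) \<partial>lborel) =
      (c * of_real (sqrt (2 * \<kappa>))) * (\<integral>v. indicator {0..<?u} v *\<^sub>R ?g v \<partial>lborel)"
    by (rule integral_mult_right_zero)
  also have "(\<integral>v. indicator {0..<?u} v *\<^sub>R ?g v \<partial>lborel) = edge_fun w ?u"
    unfolding edge_fun_def by (rule lebesgue_integral_eq_integral_half_open[OF continuous_on_edge_integrand])
  finally show ?thesis using assms(1) by (simp add: scaleR_conv_of_real mult_ac)
qed

text \<open>The relation \<open>b + 2 * \<kappa> = 2\<close> says that \<open>t = 1\<close>
  corresponds to \<open>v = 1\<close>. The constant collects \<open>\<kappa>\<close> from each of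
  the two substitutions and \<open>sqrt (2 * \<kappa>)\<close> from each of the two
  profiles.\<close>

lemma integral_edge_profile:
  assumes "\<kappa> > 0" "0 \<le> b" "b + 2 * \<kappa> = 2"
  shows "(\<integral>t. indicator {0..<1} t *\<^sub>R (\<integral>s. indicator {0..<1} s *\<^sub>R
        (if s < t then edge_profile b \<kappa> z t * edge_profile b \<kappa> w s else 0) \<partial>lborel) \<partial>lborel) =
    of_real (2 * \<kappa> ^ 3) * edge_half_kernel z w"
proof -
  let ?g = "\<lambda>v. complex_of_real (sqrt v) * exp (2 * z * of_real v) * edge_fun w v"
  let ?F = "\<lambda>t. indicator {0..<1} t *\<^sub>R (edge_profile b \<kappa> z t * of_real (\<kappa> * sqrt (2 * \<kappa>)) * edge_fun w ((t - b / 2) / \<kappa>))"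
  have "(\<integral>t. indicator {0..<1} t *\<^sub>R (\<integral>s. indicator {0..<1} s *\<^sub>R
        (if s < t then edge_profile b \<kappa> z t * edge_profile b \<kappa> w s else 0) \<partial>lborel) \<partial>lborel) = (\<integral>t. ?F t \<partial>lborel)"
  proof (rule Bochner_Integration.integral_cong[OF refl])
    fix t :: real
    show "indicator {0..<1} t *\<^sub>R (\<integral>s. indicator {0..<1} s *\<^sub>R
        (if s < t then edge_profile b \<kappa> z t * edge_profile b \<kappa> w s else 0) \<partial>lborel) = ?F t"
      using assms by (cases "t < 1") (simp_all add: integral_edge_profile_inner)
  qed
  also have "\<dots> = \<bar>\<kappa>\<bar> *\<^sub>R (\<integral>v. ?F (b / 2 + \<kappa> * v) \<partial>lborel)"
    by (rule lborel_integral_real_affine) (use assms in simp)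
  also have "(\<lambda>v. ?F (b / 2 + \<kappa> * v)) = (\<lambda>v. of_real (2 * \<kappa>\<^sup>2) * (indicator {0..<1} v *\<^sub>R ?g v))"
  proof
    fix v
    show "?F (b / 2 + \<kappa> * v) = of_real (2 * \<kappa>\<^sup>2) * (indicator {0..<1} v *\<^sub>R ?g v)"
    proof (cases "0 \<le> v")
      case True
      then have "0 \<le> b / 2 + \<kappa> * v" using assms by simp
      moreover have "b / 2 + \<kappa> * v < 1 \<longleftrightarrow> v < 1"
      proof -
        have "b / 2 + \<kappa> * v < 1 \<longleftrightarrow> \<kappa> * v < \<kappa> * 1" using assms(3) by auto
        also have "\<dots> \<longleftrightarrow> v < 1" using assms(1) by (simp only: mult_less_cancel_left_pos)
        finally show ?thesis .
      qed
      moreover have "(b / 2 + \<kappa> * v - b / 2) / \<kappa> = v" using assms(1) by simp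
      moreover have "complex_of_real (sqrt (2 * \<kappa>)) * of_real (sqrt (2 * \<kappa>)) = of_real (2 * \<kappa>)"
        using assms(1) by (simp only: of_real_mult[symmetric] real_sqrt_mult_self) simp
      then have "complex_of_real (sqrt (2 * \<kappa>)) * x * of_real (\<kappa> * sqrt (2 * \<kappa>)) * y = of_real (2 * \<kappa>\<^sup>2) * (x * y)" for x y
        by (simp add: power2_eq_square mult_ac)
      ultimately show ?thesis
        using True unfolding edge_profile_affine[OF assms(1)] by (auto simp: indicator_def mult.assoc)
    next
      case False
      then show ?thesis unfolding edge_profile_affine[OF assms(1)] by simp
    qed
  qed
  also have "(\<integral>v. of_real (2 * \<kappa>\<^sup>2) * (indicator {0..<1} v *\<^sub>R ?g v) \<partial>lborel) =
      of_real (2 * \<kappa>\<^sup>2) * (\<integral>v. indicator {0..<1} v *\<^sub>R ?g v \<partial>lborel)"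
    by (rule integral_mult_right_zero)
  also have "(\<integral>v. indicator {0..<1} v *\<^sub>R ?g v \<partial>lborel) = edge_half_kernel z w"
    unfolding edge_half_kernel_def
    by (intro lebesgue_integral_eq_integral_half_open continuous_intros continuous_on_edge_fun)
  finally show ?thesis
    using assms(1) by (simp add: scaleR_conv_of_real power3_eq_cube power2_eq_square mult_ac)
qed

lemma edge_sum_difference_limit:
  assumes "\<kappa> > 0" "0 \<le> b" "b + 2 * \<kappa> = 2" "filterlim N at_top sequentially" "z \<longlonglongrightarrow> z0" "w \<longlonglongrightarrow> w0"
  shows "(\<lambda>i. (edge_sum b \<kappa> (N i) (z i) (w i) - edge_sum b \<kappa> (N i) (w i) (z i)) / of_real (2 * \<kappa> ^ 3))
    \<longlonglongrightarrow> edge_kernel z0 w0"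
proof -
  note lim = edge_sum_limit[OF assms(2,1,4), unfolded integral_edge_profile[OF assms(1-3)]]
  have "(\<lambda>i. (edge_sum b \<kappa> (N i) (z i) (w i) - edge_sum b \<kappa> (N i) (w i) (z i)) / of_real (2 * \<kappa> ^ 3))
    \<longlonglongrightarrow> (of_real (2 * \<kappa> ^ 3) * edge_half_kernel z0 w0 - of_real (2 * \<kappa> ^ 3) * edge_half_kernel w0 z0) / of_real (2 * \<kappa> ^ 3)"
    using assms(1) by (intro tendsto_intros lim assms(5,6)) auto
  then show ?thesis
    using assms(1) by (simp add: edge_kernel_eq diff_divide_distrib)
qed

section \<open>The rescaled correlation functions\<close>

lemma pfaffian_cong:
  assumes "\<And>i j. i \<in> {1..2*n} \<Longrightarrow> j \<in> {1..2*n} \<Longrightarrow> A i j = B i j"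
  shows "pfaffian n A = pfaffian n B"
  unfolding pfaffian_def
proof (intro arg_cong2[where f = "(*)"] sum.cong prod.cong refl)
  fix p j assume p: "p \<in> {p. p permutes {1..2*n}}" and j: "j \<in> {1..n}"
  then have "2*j-1 \<in> {1..2*n}" "2*j \<in> {1..2*n}" by auto
  moreover have "p permutes {1..2*n}" using p by simp
  ultimately have "p (2*j-1) \<in> {1..2*n}" "p (2*j) \<in> {1..2*n}"
    by (simp_all only: permutes_in_image)
  then show "A (p (2*j-1)) (p (2*j)) = B (p (2*j-1)) (p (2*j))" by (rule assms)
qed

text \<open>Every index of \<open>{1..2*n}\<close> occurs exactly once in each product of the
  expansion, so the factors \<open>d\<close> come out as one common product.\<close>

lemma pfaffian_scale:
  "pfaffian n (\<lambda>i j. c * d i * d j * A i j) = c ^ n * (\<Prod>i=1..2*n. d i) * pfaffian n A"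
proof -
  have "(\<Prod>j=1..n. c * d (p (2*j-1)) * d (p (2*j)) * A (p (2*j-1)) (p (2*j))) =
      c ^ n * (\<Prod>i=1..2*n. d i) * (\<Prod>j=1..n. A (p (2*j-1)) (p (2*j)))"
    if p: "p permutes {1..2*n}" for p
  proof -
    have "(\<Prod>i=1..2*n. d i) = (\<Prod>i=1..2*n. d (p i))"
      by (subst prod.permute[OF p]) simp
    also have "\<dots> = (\<Prod>j=1..n. d (p (2*j-1)) * d (p (2*j)))"
      by (rule prod_doubled_interval)
    finally show ?thesis by (simp add: prod.distrib mult_ac)
  qed
  then have "(\<Sum>p | p permutes {1..2*n}. of_int (sign p) *
        (\<Prod>j=1..n. c * d (p (2*j-1)) * d (p (2*j)) * A (p (2*j-1)) (p (2*j)))) =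
      (\<Sum>p | p permutes {1..2*n}. c ^ n * (\<Prod>i=1..2*n. d i) *
        (of_int (sign p) * (\<Prod>j=1..n. A (p (2*j-1)) (p (2*j)))))"
    by (intro sum.cong refl) (simp add: mult_ac)
  then show ?thesis
    unfolding pfaffian_def by (simp add: sum_distrib_left mult_ac)
qed

lemma tendsto_pfaffian:
  assumes "\<And>i j. i \<in> {1..2*n} \<Longrightarrow> j \<in> {1..2*n} \<Longrightarrow> ((\<lambda>x. A x i j) \<longlongrightarrow> B i j) F"
  shows "((\<lambda>x. pfaffian n (A x)) \<longlongrightarrow> pfaffian n B) F"
  unfolding pfaffian_def
proof (intro tendsto_intros assms)
  fix p j assume p: "p \<in> {p. p permutes {1..2*n}}" and j: "j \<in> {1..n}"
  then have "2*j-1 \<in> {1..2*n}" "2*j \<in> {1..2*n}" by auto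
  moreover have "p permutes {1..2*n}" using p by simp
  ultimately show "p (2*j-1) \<in> {1..2*n}" "p (2*j) \<in> {1..2*n}"
    by (simp_all only: permutes_in_image)
qed

lemma skew_coeff_disk_moment:
  assumes "b > 0" "l \<le> m"
  shows "skew_coeff (disk_moment b N) m l = b ^ (m - l) * skew_coeff (edge_moment b N) m l"
proof -
  have "skew_coeff (disk_moment b N) m l =
      (\<Prod>j\<in>{l..<m}. b * (edge_moment b N (2 * j + 2) / edge_moment b N (2 * j + 1)))"
    unfolding skew_coeff_def disk_moment_eq_edge_moment[OF assms(1)]
    using assms(1) by (intro prod.cong refl) (simp add: field_simps)
  then show ?thesis
    by (simp only: prod.distrib prod_constant card_atLeastLessThan skew_coeff_def)
qed

text \<open>The exponent of \<open>R\<close> is \<open>4*m+1\<close> in the numerator and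
  \<open>4*m+4\<close> in the denominator. The surplus \<open>R ^ 3\<close> does not depend on the
  indices, so the whole double sum has a common prefactor.\<close>

lemma skew_coeff_over_moment:
  assumes "R > 0" "l \<le> m" "N > 0"
  shows "skew_coeff (disk_moment (R\<^sup>2) N) m l * (R ^ (2*l) * R ^ (2*m+1)) / disk_moment (R\<^sup>2) N (2*m+1) =
    exp (real N * R\<^sup>2) * (real N / R ^ 3) * edge_coeff (R\<^sup>2) N m l"
proof -
  let ?H = "edge_moment (R\<^sup>2) N" and ?A = "skew_coeff (edge_moment (R\<^sup>2) N) m l"
  have b: "R\<^sup>2 > 0" using assms by simp
  have pos: "?H (2*m+1) > 0" by (rule edge_moment_pos) simp
  have p1: "(R\<^sup>2) ^ (m - l) * (R ^ (2*l) * R ^ (2*m+1)) = R ^ (4*m+1)"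
    using assms(2) by (simp only: power_mult[symmetric] power_add[symmetric]) (intro arg_cong[where f = "power R"], auto)
  have p2: "(R\<^sup>2) ^ (2*m+1+1) = R ^ (4*m+1) * R ^ 3"
    by (simp only: power_mult[symmetric] power_add[symmetric]) (intro arg_cong[where f = "power R"], auto)
  have "skew_coeff (disk_moment (R\<^sup>2) N) m l * (R ^ (2*l) * R ^ (2*m+1)) / disk_moment (R\<^sup>2) N (2*m+1) =
      ((R\<^sup>2) ^ (m - l) * (R ^ (2*l) * R ^ (2*m+1))) * ?A / ((R\<^sup>2) ^ (2*m+1+1) * exp (- (real N * R\<^sup>2)) * ?H (2*m+1))"
    unfolding skew_coeff_disk_moment[OF b assms(2)] disk_moment_eq_edge_moment[OF b] by (simp only: mult_ac)
  also have "\<dots> = ?A / (R ^ 3 * exp (- (real N * R\<^sup>2)) * ?H (2*m+1))"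
    unfolding p1 p2 using assms(1) by simp
  also have "\<dots> = exp (real N * R\<^sup>2) * (real N / R ^ 3) * edge_coeff (R\<^sup>2) N m l"
    using assms(1,3) pos by (simp add: edge_coeff_def exp_minus field_simps)
  finally show ?thesis .
qed

text \<open>The exponents \<open>2*l + (2*m+1)\<close> are odd, which leaves a single
  \<open>\<sigma>\<close>. The minus sign arises because \<open>edge_sum\<close> gives the odd power
  to its first argument, whereas the first product of the kernel gives it to the second. The factors
  \<open>E\<close> undo the exponentials in \<open>edge_factor\<close>.\<close>

lemma skew_kernel_eq_edge_sum:
  fixes \<sigma> :: complex
  assumes "R > 0" "\<kappa> > 0" "N > 0" "\<sigma>\<^sup>2 = 1"
  defines "h \<equiv> disk_moment (R\<^sup>2) N"
    and "X \<equiv> \<lambda>z. \<sigma> * of_real R * (1 + z / of_real (real N * \<kappa>))"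
    and "E \<equiv> \<lambda>z. exp (of_real (R\<^sup>2) * z / of_real \<kappa>)"
  shows "(\<Sum>m=1..N. (poly (skew_basis h (2*m-1)) (X z) * poly (skew_basis h (2*m)) (X w) -
       poly (skew_basis h (2*m)) (X z) * poly (skew_basis h (2*m-1)) (X w)) / h (2*m-1)) =
    - (\<sigma> * of_real (exp (real N * R\<^sup>2) * (real N / R) ^ 3)) * E z * E w *
      (edge_sum (R\<^sup>2) \<kappa> N z w - edge_sum (R\<^sup>2) \<kappa> N w z)"
proof -
  define G where "G z n = (1 + z / of_real (real N * \<kappa>)) ^ n" for z :: complex and n
  define c where "c = exp (real N * R\<^sup>2) * (real N / R ^ 3)"
  let ?e = "\<lambda>m l. complex_of_real (edge_coeff (R\<^sup>2) N m l)"
  have \<sigma>_pow: "\<sigma> ^ (2 * n) = 1" for n using assms(4) by (simp add: power_mult)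
  have GE: "G z n = E z * edge_factor (R\<^sup>2) \<kappa> N z n" for z n
    unfolding E_def edge_factor_def G_def by (simp add: exp_minus)
  have X: "X z ^ n = \<sigma> ^ n * of_real (R ^ n) * G z n" for z n
    by (simp add: X_def G_def power_mult_distrib)
  have term_eq: "complex_of_real (skew_coeff h m l) * (X z ^ (2*l) * X w ^ (2*m+1)) / of_real (h (2*m+1)) =
      \<sigma> * of_real c * (?e m l * G z (2*l) * G w (2*m+1))" if "l \<le> m" for m l z w
  proof -
    have "complex_of_real (skew_coeff h m l) * (X z ^ (2*l) * X w ^ (2*m+1)) / of_real (h (2*m+1)) =
      \<sigma> * of_real (skew_coeff h m l * (R ^ (2*l) * R ^ (2*m+1)) / h (2*m+1)) * (G z (2*l) * G w (2*m+1))"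
      unfolding X by (simp add: \<sigma>_pow)
    also have "skew_coeff h m l * (R ^ (2*l) * R ^ (2*m+1)) / h (2*m+1) = c * edge_coeff (R\<^sup>2) N m l"
      unfolding h_def c_def by (rule skew_coeff_over_moment[OF assms(1) that assms(3)])
    finally show ?thesis by (simp add: mult_ac)
  qed
  have S: "(\<Sum>m<N. \<Sum>l\<le>m. ?e m l * G z (2*l) * G w (2*m+1)) = of_nat N ^ 2 * E z * E w * edge_sum (R\<^sup>2) \<kappa> N w z" for z w
  proof -
    have "(\<Sum>m<N. \<Sum>l\<le>m. ?e m l * G z (2*l) * G w (2*m+1)) =
        E z * E w * (\<Sum>m<N. \<Sum>l\<le>m. ?e m l * edge_factor (R\<^sup>2) \<kappa> N w (2*m+1) * edge_factor (R\<^sup>2) \<kappa> N z (2*l))"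
      unfolding GE sum_distrib_left by (simp only: mult_ac)
    then show ?thesis using assms(3) by (simp add: edge_sum_def)
  qed
  have "(\<Sum>m=1..N. (poly (skew_basis h (2*m-1)) (X z) * poly (skew_basis h (2*m)) (X w) -
       poly (skew_basis h (2*m)) (X z) * poly (skew_basis h (2*m-1)) (X w)) / h (2*m-1)) =
     (\<Sum>m<N. (poly (skew_poly h m) (X z) * X w ^ (2*m+1) - X z ^ (2*m+1) * poly (skew_poly h m) (X w)) / h (2*m+1))"
    unfolding One_nat_def sum.atLeast1_atMost_eq
    by (intro sum.cong refl) (simp add: skew_basis_def poly_monom)
  also have "\<dots> = (\<Sum>m<N. \<Sum>l\<le>m. complex_of_real (skew_coeff h m l) * (X z ^ (2*l) * X w ^ (2*m+1)) / of_real (h (2*m+1)) -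
      complex_of_real (skew_coeff h m l) * (X w ^ (2*l) * X z ^ (2*m+1)) / of_real (h (2*m+1)))"
    unfolding poly_skew_poly
    by (intro sum.cong refl)
      (simp only: sum_distrib_left sum_distrib_right sum_subtractf[symmetric] sum_divide_distrib diff_divide_distrib mult_ac)
  also have "\<dots> = (\<Sum>m<N. \<Sum>l\<le>m. \<sigma> * of_real c * (?e m l * G z (2*l) * G w (2*m+1)) -
      \<sigma> * of_real c * (?e m l * G w (2*l) * G z (2*m+1)))"
    by (intro sum.cong refl) (simp only: term_eq atMost_iff)
  also have "\<dots> = \<sigma> * of_real c * ((\<Sum>m<N. \<Sum>l\<le>m. ?e m l * G z (2*l) * G w (2*m+1)) -
      (\<Sum>m<N. \<Sum>l\<le>m. ?e m l * G w (2*l) * G z (2*m+1)))"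
    by (simp only: sum_subtractf sum_distrib_left right_diff_distrib)
  also have "\<dots> = \<sigma> * of_real c * (of_nat N ^ 2 * E z * E w * (edge_sum (R\<^sup>2) \<kappa> N w z - edge_sum (R\<^sup>2) \<kappa> N z w))"
    unfolding S by (simp add: algebra_simps)
  also have "\<dots> = - (\<sigma> * of_real (c * (real N)\<^sup>2)) * E z * E w * (edge_sum (R\<^sup>2) \<kappa> N z w - edge_sum (R\<^sup>2) \<kappa> N w z)"
    by (simp add: algebra_simps)
  also have "c * (real N)\<^sup>2 = exp (real N * R\<^sup>2) * (real N / R) ^ 3"
    by (simp add: c_def power_divide power2_eq_square power3_eq_cube)
  finally show ?thesis .
qed

text \<open>Each particle carries \<open>\<gamma>\<^sup>2\<close> from the rescaling and a third
  \<open>\<gamma>\<close> from \<open>\<zeta> j - cnj (\<zeta> j)\<close>; with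
  \<open>(N / R) ^ 3\<close> from the kernel they give \<open>1 / \<kappa> ^ 3\<close>. The factors
  \<open>E\<close> cancel the part of the weight linear in \<open>z j\<close> and its conjugate,
  leaving a Gaussian correction that tends to 1. The sign of the kernel's constant reverses
  \<open>z j - cnj (z j)\<close>.\<close>

lemma rescaled_correlation_eq:
  fixes \<sigma> :: complex
  assumes "R > 0" "\<kappa> > 0" "N > 0" "k \<le> N" and \<sigma>: "\<sigma> \<in> {1, -1}"
    and Q: "\<And>\<zeta>. boltzmann N (Q \<zeta>) = disk_weight R N \<zeta>"
    and \<gamma>: "\<gamma> = R / (real N * \<kappa>)"
    and inside: "\<And>j. j \<in> {1..k} \<Longrightarrow> cmod (of_real R + of_real \<gamma> * z j) \<le> R"
  shows "complex_of_real (rescaled_correlation Q N k (\<sigma> * of_real R) \<sigma> \<gamma> z) =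
    (\<Prod>j=1..k. (cnj (z j) - z j) * of_real (exp (- (R\<^sup>2 * (cmod (z j))\<^sup>2 / (real N * \<kappa>\<^sup>2))))) *
    pfaffian k (\<lambda>i i'. (edge_sum (R\<^sup>2) \<kappa> N (doubled z i) (doubled z i') -
        edge_sum (R\<^sup>2) \<kappa> N (doubled z i') (doubled z i)) / of_real (2 * \<kappa> ^ 3))"
proof -
  define \<zeta> where "\<zeta> = (\<lambda>j\<in>{1..k}. \<sigma> * of_real R + \<sigma> * complex_of_real \<gamma> * z j)"
  define h where "h = disk_moment (R\<^sup>2) N"
  define E where "E z = exp (of_real (R\<^sup>2) * z / of_real \<kappa>)" for z :: complex
  define D where "D i i' = edge_sum (R\<^sup>2) \<kappa> N (doubled z i) (doubled z i') -
        edge_sum (R\<^sup>2) \<kappa> N (doubled z i') (doubled z i)" for i i'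
  define C where "C = - (\<sigma> * of_real (exp (real N * R\<^sup>2) * (real N / R) ^ 3))"
  define g where "g w = exp (- (R\<^sup>2 * (cmod w)\<^sup>2 / (real N * \<kappa>\<^sup>2)))" for w
  \<comment> \<open>Since \<open>\<sigma>\<close> is real, the conjugate of a rescaled point is the
    rescaled point of the conjugate, so both nodes of a particle have the same form.\<close>
  have \<sigma>2: "\<sigma>\<^sup>2 = 1" and cnj_\<sigma>: "cnj \<sigma> = \<sigma>" and norm_\<sigma>: "cmod \<sigma> = 1" using \<sigma> by auto
  have \<zeta>j: "\<zeta> j = \<sigma> * of_real R * (1 + z j / of_real (real N * \<kappa>))" if "j \<in> {1..k}" for j
    using that assms(2,3) by (simp add: \<zeta>_def \<gamma> field_simps)
  have d\<zeta>: "doubled \<zeta> i = \<sigma> * of_real R * (1 + doubled z i / of_real (real N * \<kappa>))" if i: "i \<in> {1..2*k}" for i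
  proof (cases "odd i")
    case True
    then have "(i + 1) div 2 \<in> {1..k}" using i by auto presburger
    then show ?thesis using True by (simp add: doubled_def \<zeta>j)
  next
    case False
    then have "i div 2 \<in> {1..k}" using i by auto
    then show ?thesis using False by (simp add: doubled_def \<zeta>j cnj_\<sigma>)
  qed
  have hne: "h n \<noteq> 0" for n
    using edge_moment_pos[of "R\<^sup>2" N n] assms(1) by (simp add: h_def disk_moment_eq_edge_moment)
  let ?Pf = "pfaffian k (\<lambda>i i'. \<Sum>m=1..N.
      (poly (skew_basis h (2*m-1)) (doubled \<zeta> i) * poly (skew_basis h (2*m)) (doubled \<zeta> i') -
       poly (skew_basis h (2*m)) (doubled \<zeta> i) * poly (skew_basis h (2*m-1)) (doubled \<zeta> i')) / h (2*m-1))"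
  have "complex_of_real (correlation Q N k \<zeta>) =
    (\<Prod>j=1..k. (\<zeta> j - cnj (\<zeta> j)) * disk_weight R N (\<zeta> j) / 2) *
    ?Pf"
    unfolding h_def using assms(1,4) hne[unfolded h_def] Q by (intro correlation_eq_pfaffian) auto
  also have "?Pf =
     pfaffian k (\<lambda>i i'. C * E (doubled z i) * E (doubled z i') * D i i')"
    unfolding h_def C_def E_def D_def
    by (intro pfaffian_cong) (simp only: d\<zeta> skew_kernel_eq_edge_sum[OF assms(1-3) \<sigma>2])
  also have "\<dots> = C ^ k * (\<Prod>i=1..2*k. E (doubled z i)) * pfaffian k D"
    by (rule pfaffian_scale)
  also have "(\<Prod>i=1..2*k. E (doubled z i)) = (\<Prod>j=1..k. E (z j) * E (cnj (z j)))"
    unfolding prod_doubled_interval by (intro prod.cong refl) (simp only: doubled_odd doubled_even atLeastAtMost_iff)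
  also have "C ^ k = (\<Prod>j=1..k. C)" by simp
  finally have corr: "complex_of_real (correlation Q N k \<zeta>) =
    (\<Prod>j=1..k. ((\<zeta> j - cnj (\<zeta> j)) * disk_weight R N (\<zeta> j) / 2) * C * (E (z j) * E (cnj (z j)))) * pfaffian k D"
    by (simp only: prod.distrib mult.assoc)
  let ?T = "\<lambda>j. ((\<zeta> j - cnj (\<zeta> j)) * disk_weight R N (\<zeta> j) / 2) * C * (E (z j) * E (cnj (z j)))"
  have factor: "of_real (\<gamma>\<^sup>2) * ?T j =
      (cnj (z j) - z j) * of_real (g (z j)) * of_real (1 / (2 * \<kappa> ^ 3))" if j: "j \<in> {1..k}" for j
  proof -
    have diff: "\<zeta> j - cnj (\<zeta> j) = \<sigma> * of_real \<gamma> * (z j - cnj (z j))"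
      using j cnj_\<sigma> by (simp add: \<zeta>_def algebra_simps)
    have \<zeta>': "\<zeta> j = \<sigma> * (of_real R + of_real \<gamma> * z j)" using j by (simp add: \<zeta>_def algebra_simps)
    have norm: "cmod (\<zeta> j) = cmod (of_real R + of_real \<gamma> * z j)"
      unfolding \<zeta>' norm_mult norm_\<sigma> by simp
    have sq: "complex_of_real (real N * (cmod (\<zeta> j))\<^sup>2) =
        of_real (real N * R\<^sup>2) + of_real (R\<^sup>2) * z j / of_real \<kappa> + of_real (R\<^sup>2) * cnj (z j) / of_real \<kappa> +
        of_real (R\<^sup>2 * (cmod (z j))\<^sup>2 / (real N * \<kappa>\<^sup>2))"
    proof -
      have "complex_of_real (real N * (cmod (\<zeta> j))\<^sup>2) =
        of_nat N * ((of_real R + of_real \<gamma> * z j) * (of_real R + of_real \<gamma> * cnj (z j)))"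
        unfolding norm of_real_mult complex_norm_square by simp
      also have "\<dots> = of_real (real N * R\<^sup>2) + of_real (real N * R * \<gamma>) * z j + of_real (real N * R * \<gamma>) * cnj (z j) +
          of_real (real N * \<gamma>\<^sup>2) * (z j * cnj (z j))"
        by (simp add: algebra_simps power2_eq_square)
      also have "real N * R * \<gamma> = R\<^sup>2 / \<kappa>" using assms(3) by (simp add: \<gamma> power2_eq_square)
      also have "real N * \<gamma>\<^sup>2 = R\<^sup>2 / (real N * \<kappa>\<^sup>2)"
        using assms(2,3) by (simp add: \<gamma> power2_eq_square field_simps)
      finally show ?thesis unfolding complex_norm_square[symmetric] by simp
    qed
    have "complex_of_real (disk_weight R N (\<zeta> j)) = exp (- complex_of_real (real N * (cmod (\<zeta> j))\<^sup>2))"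
      using inside[OF j] unfolding disk_weight_def norm[symmetric] by (simp add: exp_of_real[symmetric])
    also have "\<dots> = exp (- of_real (real N * R\<^sup>2)) * exp (- (of_real (R\<^sup>2) * z j / of_real \<kappa>)) *
        exp (- (of_real (R\<^sup>2) * cnj (z j) / of_real \<kappa>)) * exp (- of_real (R\<^sup>2 * (cmod (z j))\<^sup>2 / (real N * \<kappa>\<^sup>2)))"
      unfolding sq by (simp only: exp_add[symmetric] minus_add_distrib)
    finally have "complex_of_real (disk_weight R N (\<zeta> j)) * (E (z j) * E (cnj (z j))) =
        exp (- of_real (real N * R\<^sup>2)) * exp (- of_real (R\<^sup>2 * (cmod (z j))\<^sup>2 / (real N * \<kappa>\<^sup>2)))"
      by (simp add: E_def exp_minus field_simps)
    also have "\<dots> = of_real (exp (- (real N * R\<^sup>2)) * g (z j))"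
      by (simp add: g_def exp_of_real[symmetric])
    finally have w: "complex_of_real (disk_weight R N (\<zeta> j)) * (E (z j) * E (cnj (z j))) =
        of_real (exp (- (real N * R\<^sup>2)) * g (z j))" .
    have const: "\<gamma> ^ 3 * (exp (real N * R\<^sup>2) * (real N / R) ^ 3) * exp (- (real N * R\<^sup>2)) = 1 / \<kappa> ^ 3"
      using assms(1-3) by (simp add: \<gamma> exp_minus power_divide power_mult_distrib)
    have "of_real (\<gamma>\<^sup>2) * ?T j =
        of_real (\<gamma>\<^sup>2) * (\<zeta> j - cnj (\<zeta> j)) / 2 * C * (complex_of_real (disk_weight R N (\<zeta> j)) * (E (z j) * E (cnj (z j))))"
      by (simp add: mult_ac)
    also have "\<dots> = \<sigma>\<^sup>2 * (cnj (z j) - z j) * of_real (g (z j)) *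
        of_real (\<gamma> ^ 3 * (exp (real N * R\<^sup>2) * (real N / R) ^ 3) * exp (- (real N * R\<^sup>2))) / 2"
    proof -
      have "of_real (a\<^sup>2) * (s * of_real a * (x - y)) / 2 * - (s * of_real c) * of_real (e * d) =
          s\<^sup>2 * (y - x) * of_real d * of_real (a ^ 3 * c * e) / 2" for a c d e :: real and s x y :: complex
        by (simp add: power2_eq_square power3_eq_cube algebra_simps)
      then show ?thesis unfolding w diff C_def .
    qed
    finally show ?thesis unfolding const \<sigma>2 by simp
  qed
  have "complex_of_real (rescaled_correlation Q N k (\<sigma> * of_real R) \<sigma> \<gamma> z) =
      of_real (\<gamma>\<^sup>2) ^ k * complex_of_real (correlation Q N k \<zeta>)"
    unfolding rescaled_correlation_def \<zeta>_def by (simp add: power_mult)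
  also have "\<dots> = (\<Prod>j=1..k. of_real (\<gamma>\<^sup>2) * ?T j) * pfaffian k D"
  proof -
    have "(\<Prod>j=1..k. c * T j) = c ^ k * (\<Prod>j=1..k. T j)" for c :: complex and T
      by (simp add: prod.distrib)
    then show ?thesis unfolding corr by (simp only: mult.assoc)
  qed
  also have "\<dots> = (\<Prod>j=1..k. (cnj (z j) - z j) * of_real (g (z j)) * of_real (1 / (2 * \<kappa> ^ 3))) * pfaffian k D"
    by (intro arg_cong2[where f = "(*)"] prod.cong refl factor)
  also have "\<dots> = (\<Prod>j=1..k. (cnj (z j) - z j) * of_real (g (z j))) *
      (of_real (1 / (2 * \<kappa> ^ 3)) ^ k * pfaffian k D)"
  proof -
    have eq: "(\<Prod>j=1..k. T j * c) = (\<Prod>j=1..k. T j) * c ^ k" for c :: complex and T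
      by (simp add: prod.distrib)
    show ?thesis by (subst eq) (rule mult.assoc)
  qed
  also have "of_real (1 / (2 * \<kappa> ^ 3)) ^ k * pfaffian k D = pfaffian k (\<lambda>i i'. D i i' / of_real (2 * \<kappa> ^ 3))"
    using pfaffian_scale[of k "of_real (1 / (2 * \<kappa> ^ 3))" "\<lambda>_. 1" D] by (simp add: field_simps)
  finally show ?thesis unfolding D_def g_def .
qed

section \<open>Locally uniform convergence\<close>

text \<open>Convergence along all sequences makes \<open>g\<close> continuous on \<open>K\<close>, so a failure of uniform
  convergence would be visible along a convergent sequence.\<close>

lemma uniform_limit_compact_sequentially:
  fixes f :: "nat \<Rightarrow> 'a::metric_space \<Rightarrow> 'b::metric_space"
  assumes "compact K"
    and lim: "\<And>N z z0. \<lbrakk>filterlim N at_top sequentially; \<And>i. z i \<in> K; z0 \<in> K; z \<longlonglongrightarrow> z0\<rbrakk>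
      \<Longrightarrow> (\<lambda>i. f (N i) (z i)) \<longlonglongrightarrow> g z0"
  shows "uniform_limit K f g sequentially"
proof (rule ccontr)
  assume "\<not> uniform_limit K f g sequentially"
  then obtain e where e: "e > 0" and "\<not> (\<forall>\<^sub>F n in sequentially. \<forall>x\<in>K. dist (f n x) (g x) < e)"
    by (auto simp: uniform_limit_iff)
  then have "\<forall>i. \<exists>n\<ge>i. \<exists>x\<in>K. e \<le> dist (f n x) (g x)"
    by (auto simp: eventually_sequentially not_less)
  then obtain N x where N: "\<And>i. i \<le> N i" and x: "\<And>i. x i \<in> K" "\<And>i. e \<le> dist (f (N i) (x i)) (g (x i))"
    by metis
  have "\<exists>n\<ge>i. dist (f n (x i)) (g (x i)) < 1 / real (Suc i)" for i
  proof -
    have "(\<lambda>n. f n (x i)) \<longlonglongrightarrow> g (x i)"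
      by (rule lim[of "\<lambda>n. n" "\<lambda>_. x i"]) (use x in \<open>auto simp: filterlim_ident\<close>)
    then have "\<forall>\<^sub>F n in sequentially. dist (f n (x i)) (g (x i)) < 1 / real (Suc i)"
      by (rule tendstoD) simp
    then show ?thesis
      unfolding eventually_sequentially by (meson le_cases order_refl order_trans)
  qed
  \<comment> \<open>A diagonal choice: \<open>f (M i) (x i)\<close> is close to
    \<open>g (x i)\<close>, so applying \<open>lim\<close> along \<open>M\<close> as well shows that
    the values of \<open>g\<close> approach \<open>g x0\<close>, without a separate continuity
    proof.\<close>
  then obtain M where M: "\<And>i. i \<le> M i" "\<And>i. dist (f (M i) (x i)) (g (x i)) < 1 / real (Suc i)"
    by metis
  obtain x0 r where r: "x0 \<in> K" "strict_mono r" "(x \<circ> r) \<longlonglongrightarrow> x0"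
    using assms(1) x(1) unfolding compact_def by metis
  have large: "filterlim (\<lambda>i. L (r i)) at_top sequentially" if "\<And>i. i \<le> L i" for L :: "nat \<Rightarrow> nat"
  proof (rule filterlim_at_top_mono[OF filterlim_ident always_eventually], rule allI)
    show "i \<le> L (r i)" for i using that[of "r i"] seq_suble[OF r(2), of i] by linarith
  qed
  have 1: "(\<lambda>i. f (N (r i)) (x (r i))) \<longlonglongrightarrow> g x0"
    by (rule lim[OF large[OF N]]) (use x(1) r in \<open>auto simp: o_def\<close>)
  have 2: "(\<lambda>i. f (M (r i)) (x (r i))) \<longlonglongrightarrow> g x0"
    by (rule lim[OF large[OF M(1)]]) (use x(1) r in \<open>auto simp: o_def\<close>)
  have "(\<lambda>i. dist (f (M (r i)) (x (r i))) (g (x (r i)))) \<longlonglongrightarrow> 0"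
  proof (rule tendsto_sandwich[of "\<lambda>_. 0" _ _ "\<lambda>i. 1 / real (Suc (r i))"])
    show "(\<lambda>i. 1 / real (Suc (r i))) \<longlonglongrightarrow> 0"
      using LIMSEQ_subseq_LIMSEQ[OF LIMSEQ_Suc[OF lim_1_over_n] r(2)] by (simp add: o_def)
    show "\<forall>\<^sub>F i in sequentially. dist (f (M (r i)) (x (r i))) (g (x (r i))) \<le> 1 / real (Suc (r i))"
      by (intro always_eventually allI less_imp_le M(2))
  qed simp_all
  moreover have "(\<lambda>i. dist (f (N (r i)) (x (r i))) (f (M (r i)) (x (r i)))) \<longlonglongrightarrow> 0"
    using tendsto_dist[OF 1 2] by simp
  ultimately have "(\<lambda>i. dist (f (N (r i)) (x (r i))) (f (M (r i)) (x (r i))) +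
      dist (f (M (r i)) (x (r i))) (g (x (r i)))) \<longlonglongrightarrow> 0 + 0"
    by (intro tendsto_add)
  then have "\<forall>\<^sub>F i in sequentially. dist (f (N (r i)) (x (r i))) (f (M (r i)) (x (r i))) +
      dist (f (M (r i)) (x (r i))) (g (x (r i))) < e"
    by (intro order_tendstoD(2)) (use e in auto)
  then obtain i where "dist (f (N (r i)) (x (r i))) (f (M (r i)) (x (r i))) +
      dist (f (M (r i)) (x (r i))) (g (x (r i))) < e"
    by (auto simp: eventually_sequentially)
  moreover have "e \<le> dist (f (N (r i)) (x (r i))) (g (x (r i)))" by (rule x(2))
  ultimately show False
    using dist_triangle[of "f (N (r i)) (x (r i))" "g (x (r i))" "f (M (r i)) (x (r i))"] by linarith
qed

text \<open>Extensional functions equal \<open>undefined\<close> off \<open>J\<close>, so with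
  singleton factors there the set is a product over all of \<open>nat\<close>, to which the
  Tychonoff theorem applies.\<close>

lemma compact_PiE_finite_dim:
  fixes C :: "nat \<Rightarrow> complex set"
  assumes "\<And>j. j \<in> J \<Longrightarrow> compact (C j)"
  shows "compact ((J \<rightarrow>\<^sub>E UNIV) \<inter> {z. \<forall>j\<in>J. z j \<in> C j})"
proof -
  define S where "S j = (if j \<in> J then C j else {undefined})" for j
  have "(J \<rightarrow>\<^sub>E UNIV) \<inter> {z. \<forall>j\<in>J. z j \<in> C j} = PiE UNIV S"
    by (auto simp: S_def PiE_iff extensional_def split: if_splits)
  moreover have "compactin (product_topology (\<lambda>_. euclidean) UNIV) (PiE UNIV S)"
    unfolding compactin_PiE using assms by (auto simp: S_def)
  ultimately show ?thesis by (simp add: euclidean_product_topology)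
qed

lemma limit_correlation_eq:
  "limit_correlation k z = (\<Prod>j=1..k. cnj (z j) - z j) *
     pfaffian k (\<lambda>i i'. edge_kernel (doubled z i) (doubled z i'))"
  unfolding limit_correlation_def
proof (intro arg_cong2[where f = "(*)"] refl pfaffian_cong)
  fix i i' :: nat
  have "(i + 1) div 2 = i div 2" if "even i" for i :: nat using that by presburger
  then show "block_matrix (\<lambda>j l. vector
       [vector [edge_kernel (z j) (z l), edge_kernel (z j) (cnj (z l))],
        vector [edge_kernel (cnj (z j)) (z l), edge_kernel (cnj (z j)) (cnj (z l))]]) i i' =
      edge_kernel (doubled z i) (doubled z i')"
    by (auto simp: block_matrix_def doubled_def)
qed

text \<open>The squared modulus is \<open>R\<^sup>2\<close> plus \<open>\<gamma>\<close> times a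
  quantity that tends to \<open>2 * R * Re z0 < 0\<close>. This is where the left half-plane enters:
  there the indicator in the weight is eventually 1.\<close>

lemma eventually_inside_disk:
  assumes "R > 0" and \<gamma>: "\<gamma> \<longlonglongrightarrow> 0" "\<And>i. 0 \<le> \<gamma> i" and z: "z \<longlonglongrightarrow> z0" "Re z0 < 0"
  shows "\<forall>\<^sub>F i in sequentially. cmod (of_real R + of_real (\<gamma> i) * z i) \<le> R"
proof -
  have "(\<lambda>i. 2 * R * Re (z i) + \<gamma> i * (cmod (z i))\<^sup>2) \<longlonglongrightarrow> 2 * R * Re z0 + 0 * (cmod z0)\<^sup>2"
    by (intro tendsto_intros \<gamma> z)
  then have "\<forall>\<^sub>F i in sequentially. 2 * R * Re (z i) + \<gamma> i * (cmod (z i))\<^sup>2 < 0"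
    by (rule order_tendstoD(2)) (use assms in \<open>simp add: mult_pos_neg\<close>)
  then show ?thesis
  proof eventually_elim
    case (elim i)
    have "(cmod (of_real R + of_real (\<gamma> i) * z i))\<^sup>2 = R\<^sup>2 + \<gamma> i * (2 * R * Re (z i) + \<gamma> i * (cmod (z i))\<^sup>2)"
      unfolding cmod_power2 by (simp add: power2_eq_square algebra_simps)
    also have "\<dots> \<le> R\<^sup>2"
      using mult_nonneg_nonpos[OF \<gamma>(2)[of i] less_imp_le[OF elim]] by linarith
    finally show ?case by (rule power2_le_imp_le) (use assms(1) in simp)
  qed
qed

theorem rescaled_correlation_sequence_limit:
  fixes \<sigma> :: complex and Q :: "complex \<Rightarrow> ereal"
  assumes "R > 0" "\<kappa> > 0" "R\<^sup>2 + 2 * \<kappa> = 2" and \<sigma>: "\<sigma> \<in> {1, -1}"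
    and Q: "\<And>N \<zeta>. boltzmann N (Q \<zeta>) = disk_weight R N \<zeta>"
    and \<gamma>: "\<And>N. \<gamma> N = R / (real N * \<kappa>)"
    and N: "filterlim N at_top sequentially"
    and z: "\<And>j. j \<in> {1..k} \<Longrightarrow> (\<lambda>i. z i j) \<longlonglongrightarrow> z0 j" and left: "\<And>j. j \<in> {1..k} \<Longrightarrow> Re (z0 j) < 0"
  shows "(\<lambda>i. complex_of_real (rescaled_correlation Q (N i) k (\<sigma> * of_real R) \<sigma> (\<gamma> (N i)) (z i)))
    \<longlonglongrightarrow> limit_correlation k z0"
proof -
  let ?D = "\<lambda>i a a'. (edge_sum (R\<^sup>2) \<kappa> (N i) (doubled (z i) a) (doubled (z i) a') -
        edge_sum (R\<^sup>2) \<kappa> (N i) (doubled (z i) a') (doubled (z i) a)) / of_real (2 * \<kappa> ^ 3)"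
  let ?F = "\<lambda>i. (\<Prod>j=1..k. (cnj (z i j) - z i j) *
      of_real (exp (- (R\<^sup>2 * (cmod (z i j))\<^sup>2 / (real (N i) * \<kappa>\<^sup>2))))) * pfaffian k (?D i)"
  note inv = one_over_filterlim_at_top[OF N]
  have \<gamma>_lim: "(\<lambda>i. \<gamma> (N i)) \<longlonglongrightarrow> 0"
    using tendsto_mult_right[OF inv, of "R / \<kappa>"] by (simp add: \<gamma> mult_ac)
  have "\<forall>\<^sub>F i in sequentially. \<forall>j\<in>{1..k}. cmod (of_real R + of_real (\<gamma> (N i)) * z i j) \<le> R"
    using assms(1,2) z left \<gamma>_lim
    by (intro eventually_ball_finite ballI eventually_inside_disk) (auto simp: \<gamma>)
  moreover have "\<forall>\<^sub>F i in sequentially. N i > 0" "\<forall>\<^sub>F i in sequentially. N i \<ge> k"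
    by (rule eventually_compose_filterlim[OF eventually_gt_at_top N] eventually_compose_filterlim[OF eventually_ge_at_top N])+
  ultimately have "\<forall>\<^sub>F i in sequentially. ?F i =
      complex_of_real (rescaled_correlation Q (N i) k (\<sigma> * of_real R) \<sigma> (\<gamma> (N i)) (z i))"
  proof eventually_elim
    case (elim i)
    show ?case
      by (rule rescaled_correlation_eq[symmetric]) (use elim assms(1,2) \<sigma> Q \<gamma> in auto)
  qed
  moreover have "?F \<longlonglongrightarrow> (\<Prod>j=1..k. (cnj (z0 j) - z0 j) * of_real (exp (- 0))) *
      pfaffian k (\<lambda>a a'. edge_kernel (doubled z0 a) (doubled z0 a'))"
  proof (intro tendsto_mult tendsto_prod tendsto_of_real tendsto_exp tendsto_minus tendsto_diff tendsto_cnj z tendsto_pfaffian)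
    fix j assume j: "j \<in> {1..k}"
    have "(\<lambda>i. (R\<^sup>2 / \<kappa>\<^sup>2) * (cmod (z i j))\<^sup>2 * (1 / real (N i))) \<longlonglongrightarrow> (R\<^sup>2 / \<kappa>\<^sup>2) * (cmod (z0 j))\<^sup>2 * 0"
      by (intro tendsto_intros z[OF j] inv)
    then show "(\<lambda>i. R\<^sup>2 * (cmod (z i j))\<^sup>2 / (real (N i) * \<kappa>\<^sup>2)) \<longlonglongrightarrow> 0" by (simp add: mult_ac)
  next
    fix a a' assume aa': "a \<in> {1..2*k}" "a' \<in> {1..2*k}"
    have "(\<lambda>i. doubled (z i) c) \<longlonglongrightarrow> doubled z0 c" if c: "c \<in> {1..2*k}" for c
    proof (cases "odd c")
      case True
      then have "(c + 1) div 2 \<in> {1..k}" using c by auto presburger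
      then show ?thesis using True z by (simp add: doubled_def)
    next
      case False
      then have "c div 2 \<in> {1..k}" using c by auto
      from tendsto_cnj[OF z[OF this]] show ?thesis using False by (simp add: doubled_def)
    qed
    then show "(\<lambda>i. ?D i a a') \<longlonglongrightarrow> edge_kernel (doubled z0 a) (doubled z0 a')"
      using assms(1-3) N aa' by (intro edge_sum_difference_limit) auto
  qed
  ultimately show ?thesis
    unfolding limit_correlation_eq by (simp add: Lim_transform_eventually)
qed

theorem theorem2p4:
  fixes \<rho> :: real and \<sigma> p :: complex and Q :: "complex \<Rightarrow> ereal"
    and \<gamma> :: "nat \<Rightarrow> real" and k :: nat
  assumes "0 < \<rho>" and "\<rho> < 1"
    and "\<And>\<zeta>. Q \<zeta> = (if cmod \<zeta> \<le> sqrt 2 * \<rho> then ereal ((cmod \<zeta>)\<^sup>2) else \<infinity>)"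
    and "\<sigma> \<in> {1, -1}"
    and "p = \<sigma> * complex_of_real (sqrt 2 * \<rho>)"
    and "\<And>N. \<gamma> N = sqrt 2 * \<rho> / (real N * (1 - \<rho>\<^sup>2))"
    and "k \<ge> 1"
  shows "locally_uniform_limit
           (product_topology (\<lambda>_. euclidean) {1..k})
           ({1..k} \<rightarrow>\<^sub>E {z::complex. Re z < 0})
           (\<lambda>N z. complex_of_real (rescaled_correlation Q N k p \<sigma> (\<gamma> N) z))
           (limit_correlation k)
           sequentially"
  unfolding locally_uniform_limit_def
proof
  let ?S = "{1..k} \<rightarrow>\<^sub>E {z::complex. Re z < 0}"
  let ?f = "\<lambda>N z. complex_of_real (rescaled_correlation Q N k p \<sigma> (\<gamma> N) z)"
  let ?X = "product_topology (\<lambda>_. euclidean) {1..k} :: (nat \<Rightarrow> complex) topology"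
  define R where "R = sqrt 2 * \<rho>"
  define \<kappa> where "\<kappa> = 1 - \<rho>\<^sup>2"
  have R: "R > 0" "R\<^sup>2 + 2 * \<kappa> = 2" using assms(1) by (simp_all add: R_def \<kappa>_def power_mult_distrib)
  have \<kappa>: "\<kappa> > 0" using assms(1,2) by (simp add: \<kappa>_def power_less_one_iff)
  have Q: "boltzmann N (Q \<zeta>) = disk_weight R N \<zeta>" for N \<zeta>
    by (simp add: assms(3) boltzmann_def disk_weight_def R_def)
  have \<gamma>: "\<gamma> N = R / (real N * \<kappa>)" for N by (simp add: assms(6) R_def \<kappa>_def)
  fix x assume x: "x \<in> ?S"
  \<comment> \<open>Half the distance to the imaginary axis keeps even the closed ball in the open
    half-plane.\<close>
  define r where "r j = - Re (x j) / 2" for j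
  have r: "0 < r j" "cball (x j) (r j) \<subseteq> {z. Re z < 0}" if "j \<in> {1..k}" for j
  proof -
    have neg: "Re (x j) < 0" using x that by auto
    then show "0 < r j" by (simp add: r_def)
    show "cball (x j) (r j) \<subseteq> {z. Re z < 0}"
    proof
      fix w assume "w \<in> cball (x j) (r j)"
      then have "cmod (x j - w) \<le> - Re (x j) / 2" by (simp add: r_def dist_norm)
      moreover have "Re (w - x j) \<le> cmod (x j - w)" by (metis complex_Re_le_cmod norm_minus_commute)
      ultimately have "Re w < 0" using neg by simp
      then show "w \<in> {z. Re z < 0}" by simp
    qed
  qed
  define U where "U = PiE {1..k} (\<lambda>j. ball (x j) (r j))"
  \<comment> \<open>The neighbourhood \<open>U\<close> is open but not compact; uniform convergence
    is proved on the product \<open>K\<close> of closed balls and then restricted to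
    \<open>U\<close>.\<close>
  define K where "K = ({1..k} \<rightarrow>\<^sub>E UNIV) \<inter> {z. \<forall>j\<in>{1..k}. z j \<in> cball (x j) (r j)}"
  have K: "z j \<in> cball (x j) (r j)" if "z \<in> K" "j \<in> {1..k}" for z j
    using that by (auto simp: K_def)
  have "openin ?X U"
    unfolding U_def by (simp add: openin_PiE)
  moreover have "U \<subseteq> ?S"
    unfolding U_def using r(2) by (intro PiE_mono) (meson ball_subset_cball subset_trans)
  ultimately have "openin (subtopology ?X ?S) U"
    by (auto simp: openin_subtopology intro!: exI[of _ U])
  moreover have "x \<in> U" using x r(1) by (auto simp: U_def PiE_iff)
  moreover have "uniform_limit K ?f
      (limit_correlation k) sequentially"
  proof (rule uniform_limit_compact_sequentially)
    show "compact K" unfolding K_def by (intro compact_PiE_finite_dim compact_cball)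
    fix N :: "nat \<Rightarrow> nat" and z :: "nat \<Rightarrow> nat \<Rightarrow> complex" and z0 :: "nat \<Rightarrow> complex"
    assume N: "filterlim N at_top sequentially" and zK: "\<And>i. z i \<in> K" "z0 \<in> K" and z: "z \<longlonglongrightarrow> z0"
    have "(\<lambda>i. z i j) \<longlonglongrightarrow> z0 j" for j
      by (rule continuous_on_tendsto_compose[OF continuous_on_product_coordinates z]) auto
    moreover have "Re (z0 j) < 0" if "j \<in> {1..k}" for j
      using K[OF zK(2) that] r(2)[OF that] by blast
    ultimately show "(\<lambda>i. complex_of_real (rescaled_correlation Q (N i) k p \<sigma> (\<gamma> (N i)) (z i))) \<longlonglongrightarrow> limit_correlation k z0"
      unfolding assms(5) R_def[symmetric] using R \<kappa> N assms(4) Q \<gamma>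
      by (intro rescaled_correlation_sequence_limit[where \<kappa> = \<kappa>]) auto
  qed
  then have "uniform_limit U ?f
      (limit_correlation k) sequentially"
    by (rule uniform_limit_on_subset) (auto simp: U_def K_def PiE_iff intro: less_imp_le)
  ultimately show "\<exists>U. openin (subtopology ?X ?S) U \<and> x \<in> U \<and>
      uniform_limit U ?f (limit_correlation k) sequentially"
    by blast
qed

end
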